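(* Let $n\ge1$, $\xi\in\partial\mathbb B_n$, $\alpha>-1$, $\beta>0$ and let $\mu$ be a positive Borel measure on $[0,1)$. Then the following assertions hold. (i) For $0<p\le1$, the operator $\mathcal C_{\mu,\beta}^{\xi}:A_\alpha^p(\mathbb B_n)\to H^\infty(\mathbb B_n)$ is bounded if and only if $$\sup_{0\le r<1}\frac{\hat\mu(r)}{(1-r)^{\beta+(n+1+\alpha)/p}}<\infty .$$ (ii) For $1<p<\infty$, let $\frac1p+\frac1{p'}=1$. Then $\mathcal C_{\mu,\beta}^{\xi}:A_\alpha^p(\mathbb B_n)\to H^\infty(\mathbb B_n)$ is bounded if and only if $\mu$ is finite and $$\left\{\frac{\hat\mu(r_k)}{\delta_k^{\,\beta+(n+1+\alpha)/p}}\right\}_{k\ge1}\in\ell^{p'} .$$ (iii) The operator $\mathcal C_{\mu,\beta}^{\xi}:H^\infty(\mathbb B_n)\to H^\infty(\mathbb B_n)$ is bounded if and only if $$\int_{[0,1)}\frac{d\mu(t)}{(1-t)^\beta}<\infty .$$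
   Context: $\mathbb B_n=\{z\in\mathbb C^n:|z|<1\}$ is the open unit ball, $\langle z,w\rangle=\sum_{k=1}^n z_k\overline{w_k}$, $|z|=\sqrt{\langle z,z\rangle}$, and $\partial\mathbb B_n$ is the unit sphere. $dv$ is the normalized volume measure on $\mathbb B_n$ and $dv_\alpha(z)=c_\alpha(1-|z|^2)^\alpha dv(z)$ with $c_\alpha=\frac{\Gamma(n+1+\alpha)}{n!\,\Gamma(\alpha+1)}$, so that $v_\alpha(\mathbb B_n)=1$. $H(\mathbb B_n)$ is the space of holomorphic functions on $\mathbb B_n$. For $0<p<\infty$, $A_\alpha^p(\mathbb B_n)$ is the weighted Bergman space of all $f\in H(\mathbb B_n)$ with $\|f\|_{p,\alpha}=\left(\int_{\mathbb B_n}|f|^p\,dv_\alpha\right)^{1/p}<\infty$. $H^\infty(\mathbb B_n)$ is the space of bounded holomorphic functions with the supremum norm. For a positive Borel measure $\mu$ on $[0,1)$, $\hat\mu(r)=\mu([r,1))$ for $r\in[0,1)$. For $k\in\mathbb N$, $\delta_k=2^{-k}$ and $r_k=1-2^{-k}$. The weighted Ces\`aro type operator is $$\mathcal C_{\mu,\beta}^{\xi}f(z)=\int_{[0,1)}\frac{f(tz)}{(1-t\langle z,\xi\rangle)^\beta}\,d\mu(t),\qquad z\in\mathbb B_n,$$ (principal branch of the power). It is bounded from $X$ to $Y$ if $\mathcal C_{\mu,\beta}^{\xi}f$ is well defined and lies in $Y$ for all $f\in X$ and $\|\mathcal C_{\mu,\beta}^{\xi}f\|_Y\le C\|f\|_X$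 with $C$ independent of $f$. *)

theory Defs
  imports "HOL-Analysis.Analysis"
begin

definition hinner :: "complex ^ 'n \<Rightarrow> complex ^ 'n \<Rightarrow> complex"
  where "hinner z w = (\<Sum>k\<in>UNIV. z $ k * cnj (w $ k))"

text \<open>The library norm on \<^typ>\<open>complex ^ 'n\<close> is the one induced by \<^const>\<open>hinner\<close>, so the unit
  ball and the unit sphere are \<^term>\<open>ball 0 1\<close> and \<^term>\<open>sphere 0 1\<close>.\<close>

lemma hinner_self: "hinner z z = complex_of_real ((norm z)\<^sup>2)"
proof -
  have "(norm z)\<^sup>2 = (\<Sum>k\<in>UNIV. (norm (z $ k))\<^sup>2)"
    by (simp add: norm_vec_def L2_set_def sum_nonneg)
  then show ?thesis
    by (simp only: hinner_def complex_norm_square of_real_sum)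
qed

lemma norm_eq_hinner: "norm z = sqrt (Re (hinner z z))"
  by (simp add: hinner_self)

text \<open>Holomorphy in several variables: complex Frechet differentiability at every point, that is,
  the real derivative exists and is complex linear.  For open sets only.\<close>

definition holomorphic_vec :: "(complex ^ 'n \<Rightarrow> complex) \<Rightarrow> (complex ^ 'n) set \<Rightarrow> bool"
  where "holomorphic_vec f S \<longleftrightarrow>
    (\<forall>z\<in>S. \<exists>f'. (f has_derivative f') (at z) \<and> (\<forall>c v. f' (c *s v) = c * f' v))"

text \<open>The measures live on the subspace \<^term>\<open>ball 0 1\<close>, so that the values of a function outside
  the ball affect neither measurability nor integrals.\<close>

definition ball_volume :: "(complex ^ 'n) measure"
  where "ball_volume = restrict_space (uniform_measure lborel (ball 0 1)) (ball 0 1)"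

definition weight_const :: "'n itself \<Rightarrow> real \<Rightarrow> real"
  where "weight_const _ \<alpha> =
    Gamma (real CARD('n) + 1 + \<alpha>) / (fact CARD('n) * Gamma (\<alpha> + 1))"

definition weighted_volume :: "real \<Rightarrow> (complex ^ 'n) measure"
  where "weighted_volume \<alpha> =
    density ball_volume (\<lambda>z. ennreal (weight_const TYPE('n) \<alpha> * (1 - (norm z)\<^sup>2) powr \<alpha>))"

definition bergman_space :: "real \<Rightarrow> real \<Rightarrow> (complex ^ 'n \<Rightarrow> complex) set"
  where "bergman_space p \<alpha> =
    {f. holomorphic_vec f (ball 0 1) \<and> integrable (weighted_volume \<alpha>) (\<lambda>z. norm (f z) powr p)}"

definition bergman_norm :: "real \<Rightarrow> real \<Rightarrow> (complex ^ 'n \<Rightarrow> complex) \<Rightarrow> real"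
  where "bergman_norm p \<alpha> f = (LINT z|weighted_volume \<alpha>. norm (f z) powr p) powr (1 / p)"

definition H_infty :: "(complex ^ 'n \<Rightarrow> complex) set"
  where "H_infty = {f. holomorphic_vec f (ball 0 1) \<and> bounded (f ` ball 0 1)}"

definition H_infty_norm :: "(complex ^ 'n \<Rightarrow> complex) \<Rightarrow> real"
  where "H_infty_norm f = (SUP z\<in>ball 0 1. norm (f z))"

definition cesaro_integrand ::
    "real \<Rightarrow> complex ^ 'n \<Rightarrow> (complex ^ 'n \<Rightarrow> complex) \<Rightarrow> complex ^ 'n \<Rightarrow> real \<Rightarrow> complex"
  where "cesaro_integrand \<beta> \<xi> f z t =
    f (t *\<^sub>R z) / (1 - complex_of_real t * hinner z \<xi>) powr complex_of_real \<beta>"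

definition cesaro ::
    "real measure \<Rightarrow> real \<Rightarrow> complex ^ 'n \<Rightarrow> (complex ^ 'n \<Rightarrow> complex) \<Rightarrow> complex ^ 'n \<Rightarrow> complex"
  where "cesaro \<mu> \<beta> \<xi> f z = (LINT t|\<mu>. cesaro_integrand \<beta> \<xi> f z t)"

text \<open>Since the Bochner integral of a non-integrable function is \<^term>\<open>0\<close> by convention,
  well-definedness of the operator has to be required explicitly.\<close>

definition cesaro_bounded ::
    "real measure \<Rightarrow> real \<Rightarrow> complex ^ 'n \<Rightarrow>
     (complex ^ 'n \<Rightarrow> complex) set \<Rightarrow> ((complex ^ 'n \<Rightarrow> complex) \<Rightarrow> real) \<Rightarrow>
     (complex ^ 'n \<Rightarrow> complex) set \<Rightarrow> ((complex ^ 'n \<Rightarrow> complex) \<Rightarrow> real) \<Rightarrow> bool"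
  where "cesaro_bounded \<mu> \<beta> \<xi> X normX Y normY \<longleftrightarrow>
    (\<forall>f\<in>X. (\<forall>z\<in>ball 0 1. integrable \<mu> (cesaro_integrand \<beta> \<xi> f z)) \<and> cesaro \<mu> \<beta> \<xi> f \<in> Y) \<and>
    (\<exists>C. \<forall>f\<in>X. normY (cesaro \<mu> \<beta> \<xi> f) \<le> C * normX f)"

definition ell_p :: "real \<Rightarrow> (nat \<Rightarrow> real) set"
  where "ell_p q = {a. summable (\<lambda>k. \<bar>a k\<bar> powr q)}"

definition delta :: "nat \<Rightarrow> real"
  where "delta k = 1 / 2 ^ k"

definition radius :: "nat \<Rightarrow> real"
  where "radius k = 1 - 1 / 2 ^ k"

text \<open>The measure is not assumed finite, so its tail takes values in \<^typ>\<open>ennreal\<close>.\<close>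

definition tail :: "real measure \<Rightarrow> real \<Rightarrow> ennreal"
  where "tail \<mu> r = emeasure \<mu> {r..<1}"

end

theory Submission
  imports Defs "HOL-Complex_Analysis.Cauchy_Integral_Formula"
begin

text \<open>Fix \<open>f\<close> in the Bergman space and put \<open>d = n + 1 + \<alpha>\<close>.  The submean value property of
  \<open>norm f powr p\<close> on ellipsoids adapted to the sphere bounds \<open>norm (f z) powr p * (1 - norm z) powr d\<close>
  by the integral of \<open>norm f powr p\<close> over the annulus \<open>1 - (norm w)\<^sup>2 \<approx> 1 - norm z\<close>.  These annuli
  overlap boundedly along \<open>1 - norm z \<approx> 2 ^ -m\<close>, so that \<open>f\<close> is bounded by
  \<open>2 ^ (m * d / p) * \<phi> m\<close> there, with \<open>\<phi>\<close> in \<open>\<ell>\<^sup>p\<close>.  Since the kernel of the operator is at most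
  \<open>(1 - t * norm z) powr -\<beta>\<close>, the operator is controlled by the pairing of \<open>\<phi>\<close> with the dyadic
  tail sequence of \<open>\<mu>\<close>, and sufficiency is the duality of \<open>\<ell>\<^sup>p\<close>, or \<open>\<ell>\<^sup>p \<subseteq> \<ell>\<^sup>1\<close> if \<open>p \<le> 1\<close>.

  Conversely, the functions \<open>f\<^sub>k z = \<delta>\<^sub>k powr s / (1 - r\<^sub>k * hinner z \<xi>) powr (2 * s)\<close>, \<open>s = d / p\<close>,
  are almost disjoint: a combination with coefficients \<open>c\<close> has Bergman norm at most a constant times
  the \<open>\<ell>\<^sup>p\<close> norm of \<open>c\<close>, while the operator evaluated near \<open>\<xi>\<close> recovers the pairing of \<open>c\<close> with the
  tail sequence.\<close>

section \<open>Invariance of Lebesgue measure\<close>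

lemma nn_integral_lborel_translate:
  fixes a :: "'a::euclidean_space"
  assumes [measurable]: "g \<in> borel_measurable borel"
  shows "(\<integral>\<^sup>+x. g (a + x) \<partial>lborel) = (\<integral>\<^sup>+x. g x \<partial>lborel)"
proof -
  have "(\<integral>\<^sup>+x. g x \<partial>lborel) = (\<integral>\<^sup>+x. g x \<partial>distr lborel borel ((+) a))"
    by (simp add: lborel_distr_plus)
  then show ?thesis
    by (simp add: nn_integral_distr)
qed

text \<open>Uniqueness of Haar measure in disguise: in the double integral of \<open>g (U x) * h (y - U x)\<close>
  each variable may be shifted separately, which moves the isometry from \<open>g\<close> to the
  isometry-invariant function \<open>h\<close>.\<close>

lemma nn_integral_lborel_isometry:
  fixes U :: "'a::euclidean_space \<Rightarrow> 'a"
  assumes U: "linear U" and iso: "\<And>x. norm (U x) = norm x"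
    and g[measurable]: "g \<in> borel_measurable borel"
  shows "(\<integral>\<^sup>+x. g (U x) \<partial>lborel) = (\<integral>\<^sup>+x. g x \<partial>lborel)"
proof -
  define h where "h = (indicator (ball 0 1) :: 'a \<Rightarrow> ennreal)"
  have h[measurable]: "h \<in> borel_measurable borel" unfolding h_def by (intro borel_measurable_indicator) simp
  have [measurable]: "U \<in> borel_measurable borel"
    using U by (intro borel_measurable_continuous_onI linear_continuous_on linear_conv_bounded_linear[THEN iffD1])
  have "inj U"
    using iso U by (metis linear_injective_0 norm_eq_zero)
  then have "surj U" using U linear_injective_imp_surjective by blast
  then obtain V where V: "\<And>y. U (V y) = y" by (metis surjD)
  have hU: "h (- U x) = h x" for x by (simp add: h_def indicator_def iso)
  let ?B = "\<integral>\<^sup>+x. h x \<partial>lborel"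
  have "(\<integral>\<^sup>+x. g (U x) \<partial>lborel) * ?B = (\<integral>\<^sup>+x. (\<integral>\<^sup>+y. g (U x) * h (- U x + y) \<partial>lborel) \<partial>lborel)"
  proof -
    have "(\<integral>\<^sup>+y. g (U x) * h (- U x + y) \<partial>lborel) = g (U x) * ?B" for x
    proof -
      have "(\<lambda>y. h (- U x + y)) \<in> borel_measurable lborel" by measurable
      then show ?thesis by (simp only: nn_integral_cmult nn_integral_lborel_translate[OF h])
    qed
    then have "(\<integral>\<^sup>+x. (\<integral>\<^sup>+y. g (U x) * h (- U x + y) \<partial>lborel) \<partial>lborel) = (\<integral>\<^sup>+x. g (U x) * ?B \<partial>lborel)"
      by (simp only:)
    moreover have "(\<lambda>x. g (U x)) \<in> borel_measurable lborel" by measurable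
    ultimately show ?thesis by (simp only: nn_integral_multc)
  qed
  also have "\<dots> = (\<integral>\<^sup>+y. (\<integral>\<^sup>+x. g (U x) * h (- U x + y) \<partial>lborel) \<partial>lborel)"
    by (rule lborel_pair.Fubini'[symmetric]) measurable
  also have "\<dots> = (\<integral>\<^sup>+y. (\<integral>\<^sup>+x. g (U (V y + x)) * h (- U (V y + x) + y) \<partial>lborel) \<partial>lborel)"
  proof (rule nn_integral_cong)
    fix y :: 'a
    have [measurable]: "(\<lambda>x. g (U x) * h (- U x + y)) \<in> borel_measurable borel"
      by measurable
    show "(\<integral>\<^sup>+x. g (U x) * h (- U x + y) \<partial>lborel) = (\<integral>\<^sup>+x. g (U (V y + x)) * h (- U (V y + x) + y) \<partial>lborel)"
      by (rule nn_integral_lborel_translate[symmetric, where g="\<lambda>x. g (U x) * h (- U x + y)"]) measurable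
  qed
  also have "\<dots> = (\<integral>\<^sup>+y. (\<integral>\<^sup>+x. g (U x + y) * h x \<partial>lborel) \<partial>lborel)"
    by (intro nn_integral_cong) (simp add: linear_add[OF U] V hU add.commute)
  also have "\<dots> = (\<integral>\<^sup>+x. (\<integral>\<^sup>+y. g (U x + y) * h x \<partial>lborel) \<partial>lborel)"
    by (rule lborel_pair.Fubini') measurable
  also have "\<dots> = (\<integral>\<^sup>+x. g x \<partial>lborel) * ?B"
  proof -
    have "(\<integral>\<^sup>+y. g (U x + y) * h x \<partial>lborel) = (\<integral>\<^sup>+x. g x \<partial>lborel) * h x" for x
    proof -
      have "(\<lambda>y. g (U x + y)) \<in> borel_measurable lborel" by measurable
      then show ?thesis by (simp only: nn_integral_multc nn_integral_lborel_translate[OF g])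
    qed
    then have "(\<integral>\<^sup>+x. (\<integral>\<^sup>+y. g (U x + y) * h x \<partial>lborel) \<partial>lborel) = (\<integral>\<^sup>+x. (\<integral>\<^sup>+x. g x \<partial>lborel) * h x \<partial>lborel)"
      by (simp only:)
    moreover have "h \<in> borel_measurable lborel" by measurable
    ultimately show ?thesis by (simp only: nn_integral_cmult)
  qed
  finally have eq: "(\<integral>\<^sup>+x. g (U x) \<partial>lborel) * ?B = (\<integral>\<^sup>+x. g x \<partial>lborel) * ?B" .
  have B: "?B = ennreal (unit_ball_vol (real DIM('a)))"
    by (simp add: h_def emeasure_ball)
  have "?B \<noteq> 0" "?B \<noteq> \<infinity>"
    using unit_ball_vol_pos[of "real DIM('a)"] unfolding B by (simp_all del: unit_ball_vol_pos)
  with eq show ?thesis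
    by (metis mult_divide_eq_ennreal infinity_ennreal_def)
qed

lemma linear_scaleC_vec: "linear ((*s) (c::complex) :: complex ^ 'n \<Rightarrow> complex ^ 'n)"
  by (rule linearI) (simp_all add: vector_add_ldistrib vec_eq_iff algebra_simps)

lemma norm_scaleC_vec: "norm (c *s (v :: complex ^ 'n)) = cmod c * norm v"
  by (simp add: norm_vec_def L2_set_def norm_mult power_mult_distrib sum_distrib_left[symmetric]
      real_sqrt_mult)

section \<open>The Hermitian inner product and unitary maps\<close>

lemma hinner_add_left: "hinner (x + y) z = hinner x z + hinner y z"
  by (simp add: hinner_def algebra_simps sum.distrib)

lemma hinner_diff_left: "hinner (x - y) z = hinner x z - hinner y z"
  by (simp add: hinner_def algebra_simps sum_subtractf)

lemma hinner_diff_right: "hinner z (x - y) = hinner z x - hinner z y"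
  by (simp add: hinner_def algebra_simps sum_subtractf)

lemma hinner_scaleC_left: "hinner (c *s x) z = c * hinner x z"
  by (simp add: hinner_def algebra_simps sum_distrib_left)

lemma hinner_scaleC_right: "hinner x (c *s z) = cnj c * hinner x z"
  by (simp add: hinner_def algebra_simps sum_distrib_left)

lemma scaleR_eq_scaleC_vec: "r *\<^sub>R (x :: complex ^ 'n) = complex_of_real r *s x"
  by (simp add: vec_eq_iff scaleR_conv_of_real[where x="a::complex" for a])

lemma hinner_scaleR_left: "hinner (r *\<^sub>R x) z = complex_of_real r * hinner x z"
  by (simp add: scaleR_eq_scaleC_vec hinner_scaleC_left)

lemma hinner_cnj: "hinner y x = cnj (hinner x y)"
  by (simp add: hinner_def mult.commute)

lemma Re_hinner: "Re (hinner x y) = x \<bullet> y"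
  by (simp add: hinner_def inner_vec_def inner_complex_def)

lemma cmod_hinner_le: "cmod (hinner x y) \<le> norm x * norm y"
proof -
  obtain c where c: "cmod c = 1" "c * hinner x y = cmod (hinner x y)"
  proof (cases "hinner x y = 0")
    case False
    have "cnj (hinner x y) * hinner x y = (of_real (cmod (hinner x y)))\<^sup>2"
      by (subst mult.commute) (simp only: complex_norm_square[symmetric] of_real_power)
    with False show ?thesis
      by (intro that[of "cnj (hinner x y) / cmod (hinner x y)"])
        (simp_all add: norm_divide power2_eq_square)
  qed (use that[of 1] in auto)
  have "cmod (hinner x y) = Re (hinner (c *s x) y)"
    by (simp add: hinner_scaleC_left c)
  also have "\<dots> \<le> norm (c *s x) * norm y"
    by (simp add: Re_hinner norm_cauchy_schwarz)
  finally show ?thesis by (simp add: norm_scaleC_vec c)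
qed

definition unitary_map :: "(complex ^ 'n \<Rightarrow> complex ^ 'n) \<Rightarrow> bool"
  where "unitary_map U \<longleftrightarrow> linear U \<and> (\<forall>c x. U (c *s x) = c *s U x) \<and> (\<forall>x. norm (U x) = norm x)"

lemma unitary_map_hinner:
  assumes "unitary_map U"
  shows "hinner (U x) (U y) = hinner x y"
proof -
  have lin: "linear U" and U: "\<And>c x. U (c *s x) = c *s U x" "\<And>x. norm (U x) = norm x"
    using assms by (auto simp: unitary_map_def)
  have Re: "Re (hinner (U x) (U y)) = Re (hinner x y)" for x y
    using U(2)[of "x + y"] U(2)[of x] U(2)[of y]
    by (simp add: Re_hinner dot_norm linear_add[OF lin])
  have "Im (hinner (U x) (U y)) = Re (hinner (U ((-\<i>) *s x)) (U y))"
    by (simp only: U hinner_scaleC_left) simp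
  also have "\<dots> = Im (hinner x y)"
    unfolding Re by (simp only: hinner_scaleC_left) simp
  finally show ?thesis using Re[of x y] by (simp add: complex_eq_iff)
qed

text \<open>After a phase factor makes \<open>hinner e \<zeta>\<close> real, the reflection exchanging the two vectors does it.\<close>

lemma unitary_map_exists:
  fixes e \<zeta> :: "complex ^ 'n"
  assumes e: "norm e = 1" and z: "norm \<zeta> = 1"
  obtains U where "unitary_map U" "U e = \<zeta>"
proof -
  obtain c where c: "cmod c = 1" "hinner e (c *s \<zeta>) \<in> \<real>"
  proof (cases "hinner e \<zeta> = 0")
    case True
    then show ?thesis using that[of 1] by (simp add: hinner_scaleC_right)
  next
    case False
    then show ?thesis
      by (intro that[of "hinner e \<zeta> / cmod (hinner e \<zeta>)"])
        (simp_all add: norm_divide hinner_scaleC_right mult.commute complex_mult_cnj flip: complex_norm_square of_real_power)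
  qed
  define y where "y = c *s \<zeta>"
  have y: "norm y = 1" by (simp add: y_def norm_scaleC_vec c z)
  have ey: "hinner e y = of_real (Re (hinner e y))"
    using c(2) by (simp add: y_def)
  define v where "v = e - y"
  define R where "R w = w - (2 * hinner w v / of_real ((norm v)\<^sup>2)) *s v" for w
  have lin: "linear R"
  proof (rule linearI)
    show "R (x + y) = R x + R y" for x y
      by (simp add: R_def vec_eq_iff hinner_add_left add_divide_distrib ring_distribs)
    show "R (r *\<^sub>R x) = r *\<^sub>R R x" for r x
      by (simp add: R_def vec_eq_iff hinner_scaleC_left scaleR_eq_scaleC_vec right_diff_distrib mult_ac)
  qed
  have Rc: "R (a *s x) = a *s R x" for a x
    by (simp add: R_def vec_eq_iff hinner_scaleC_left algebra_simps)
  have Rn: "norm (R w) = norm w" for w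
  proof (cases "v = 0")
    case True
    then show ?thesis by (simp add: R_def)
  next
    case False
    define a where "a = 2 * hinner w v / of_real ((norm v)\<^sup>2)"
    have v0: "complex_of_real (norm v) \<noteq> 0" using False by simp
    have "hinner (w - a *s v) (w - a *s v)
        = hinner w w - cnj a * hinner w v - a * hinner v w + a * cnj a * hinner v v"
      by (simp add: hinner_diff_left hinner_diff_right hinner_scaleC_left hinner_scaleC_right algebra_simps)
    also have "\<dots> = hinner w w"
      unfolding hinner_cnj[of v w] using v0
      by (simp add: a_def hinner_self[of v] divide_simps power2_eq_square)
    finally have "hinner (R w) (R w) = hinner w w" by (simp add: R_def a_def)
    then show ?thesis by (simp add: norm_eq_hinner)
  qed
  have Re: "R e = y"
  proof (cases "v = 0")
    case True
    then show ?thesis by (simp add: R_def v_def)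
  next
    case False
    have "2 * hinner e v = of_real ((norm v)\<^sup>2)"
    proof -
      have "hinner e v = 1 - hinner e y"
        by (simp add: v_def hinner_diff_right hinner_self e)
      moreover have "complex_of_real ((norm v)\<^sup>2) = 2 - hinner e y - hinner y e"
        unfolding hinner_self[symmetric] unfolding v_def hinner_diff_left hinner_diff_right
        by (simp add: hinner_self e y)
      moreover have "hinner y e = hinner e y"
        using ey hinner_cnj[of y e] by (metis complex_cnj_complex_of_real)
      ultimately show ?thesis by simp
    qed
    then have "R e = e - 1 *s v" using False by (simp add: R_def)
    then show ?thesis by (simp add: v_def)
  qed
  have c0: "c \<noteq> 0" using c(1) by auto
  show ?thesis
  proof (rule that[of "\<lambda>x. inverse c *s R x"])
    show "unitary_map (\<lambda>x. inverse c *s R x)"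
      unfolding unitary_map_def
      using linear_compose[OF lin linear_scaleC_vec[of "inverse c"]] c(1)
      by (auto simp: o_def Rc vec_eq_iff norm_scaleC_vec Rn norm_inverse)
    show "inverse c *s R e = \<zeta>"
      using c0 by (simp add: Re y_def vec_eq_iff flip: mult.assoc)
  qed
qed

section \<open>Holomorphic functions of several variables\<close>

lemma holomorphic_vec_continuous_on: "holomorphic_vec f S \<Longrightarrow> continuous_on S f"
  unfolding holomorphic_vec_def
  by (meson continuous_at_imp_continuous_on has_derivative_continuous)

lemma holomorphic_vec_subset: "holomorphic_vec f S \<Longrightarrow> T \<subseteq> S \<Longrightarrow> holomorphic_vec f T"
  unfolding holomorphic_vec_def by blast

lemma holomorphic_vec_affine:
  assumes f: "holomorphic_vec f S" and A: "linear A" "\<And>c x. A (c *s x) = c *s A x"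
    and sub: "\<And>x. x \<in> T \<Longrightarrow> a + A x \<in> S"
  shows "holomorphic_vec (\<lambda>x. f (a + A x)) T"
  unfolding holomorphic_vec_def
proof
  fix x assume "x \<in> T"
  with f sub obtain f' where f': "(f has_derivative f') (at (a + A x))" "\<And>c v. f' (c *s v) = c * f' v"
    unfolding holomorphic_vec_def by blast
  have "bounded_linear A" using A(1) by (simp add: linear_conv_bounded_linear)
  then have "((\<lambda>x. a + A x) has_derivative A) (at x)"
    by (auto intro!: derivative_eq_intros bounded_linear_imp_has_derivative)
  from has_derivative_compose[OF this f'(1)]
  show "\<exists>f'. ((\<lambda>x. f (a + A x)) has_derivative f') (at x) \<and> (\<forall>c v. f' (c *s v) = c * f' v)"
    using f'(2) A(2) by (intro exI[of _ "\<lambda>v. f' (A v)"]) simp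
qed

lemma bounded_linear_scaleC_left: "bounded_linear (\<lambda>c. c *s (v :: complex ^ 'n))"
  by (rule linear_conv_bounded_linear[THEN iffD1], rule linearI)
    (simp_all add: vec_eq_iff algebra_simps)

lemma holomorphic_vec_line:
  fixes f :: "complex ^ 'n \<Rightarrow> complex"
  assumes f': "(f has_derivative f') (at (z + c *s v))" "\<And>c v. f' (c *s v) = c * f' v"
  shows "((\<lambda>c. f (z + c *s v)) has_field_derivative f' v) (at c)"
proof -
  have "((\<lambda>c. z + c *s v) has_derivative (\<lambda>c. c *s v)) (at c)"
    by (auto intro!: derivative_eq_intros bounded_linear_imp_has_derivative bounded_linear_scaleC_left)
  from has_derivative_compose[OF this f'(1)] show ?thesis
    unfolding has_field_derivative_def f'(2) by (simp add: mult.commute[of _ "f' v"])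
qed

lemma holomorphic_on_line:
  assumes f: "holomorphic_vec f S" and "open S" and A: "\<And>c. c \<in> A \<Longrightarrow> z + c *s v \<in> S"
  shows "(\<lambda>c. f (z + c *s v)) holomorphic_on A"
  unfolding holomorphic_on_def
proof
  fix c assume "c \<in> A"
  with A f obtain f' where f': "(f has_derivative f') (at (z + c *s v))" "\<And>c v. f' (c *s v) = c * f' v"
    unfolding holomorphic_vec_def by blast
  from holomorphic_vec_line[OF this]
  show "(\<lambda>c. f (z + c *s v)) field_differentiable at c within A"
    by (meson field_differentiable_at_within field_differentiable_def)
qed

lemma holomorphic_vec_measurable:
  assumes "holomorphic_vec f S" "open S"
  shows "(\<lambda>x. indicator S x *\<^sub>R f x) \<in> borel_measurable borel"
  using assms holomorphic_vec_continuous_on[OF assms(1)]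
  by (intro borel_measurable_continuous_on_indicator) auto

lemma holomorphic_vec_powr_measurable:
  assumes "holomorphic_vec f S" "open S" "0 < p"
  shows "(\<lambda>x. ennreal (norm (f x) powr p) * indicator S x) \<in> borel_measurable borel"
proof -
  have [measurable]: "(\<lambda>x. indicator S x *\<^sub>R f x) \<in> borel_measurable borel"
    using assms by (intro holomorphic_vec_measurable)
  have "(\<lambda>x. ennreal (norm (indicator S x *\<^sub>R f x) powr p)) \<in> borel_measurable borel"
    by measurable
  also have "(\<lambda>x. ennreal (norm (indicator S x *\<^sub>R f x) powr p)) = (\<lambda>x. ennreal (norm (f x) powr p) * indicator S x)"
    using assms(3) by (auto simp: indicator_def)
  finally show ?thesis .
qed

lemma holomorphic_vec_mean_value:
  assumes g: "holomorphic_vec g (ball 0 R)" and w: "norm w < R"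
  shows "((\<lambda>t. g (exp (2 * of_real pi * \<i> * of_real t) *s w)) has_integral g 0) {0..1}"
proof -
  have "(\<lambda>c. g (0 + c *s w)) holomorphic_on cball 0 1"
  proof (rule holomorphic_on_line[OF g])
    show "0 + c *s w \<in> ball 0 R" if "c \<in> cball 0 1" for c
      using that w mult_right_mono[of "cmod c" 1 "norm w"] by (simp add: norm_scaleC_vec)
  qed simp
  from Cauchy_integral_circlepath_simple[OF this, of 0]
  have "((\<lambda>u. g (u *s w) / u) has_contour_integral (2 * of_real pi * \<i> * g 0)) (circlepath 0 1)"
    by simp
  then have "((\<lambda>t. g (exp (2 * of_real pi * \<i> * of_real t) *s w) * (2 * of_real pi * \<i>)) has_integral
      (2 * of_real pi * \<i> * g 0)) {0..1}"
    unfolding has_contour_integral vector_derivative_circlepath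
    by (simp add: circlepath[of 0 1, THEN fun_cong] mult_ac)
  from has_integral_mult_left[OF this, of "1 / (2 * of_real pi * \<i>)"] show ?thesis
    by (simp add: mult_ac)
qed

lemma norm_mean_value_ball:
  fixes g :: "complex ^ 'n \<Rightarrow> complex"
  assumes g: "holomorphic_vec g (ball 0 R)" and r: "0 < r" "r \<le> R"
  shows "ennreal (norm (g 0)) * emeasure lborel (ball 0 r :: (complex ^ 'n) set)
    \<le> (\<integral>\<^sup>+x\<in>ball 0 r. ennreal (norm (g x)) \<partial>lborel)"
proof -
  define h where "h = (\<lambda>x. indicator (ball 0 R) x *\<^sub>R g x)"
  have h[measurable]: "h \<in> borel_measurable borel"
    unfolding h_def by (rule holomorphic_vec_measurable[OF g]) simp
  define e where "e t = exp (2 * of_real pi * \<i> * of_real t)" for t :: real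
  have norm_e: "norm (e t) = 1" for t by (simp add: e_def norm_exp_eq_Re)
  have [measurable]: "(\<lambda>(t, w :: complex ^ 'n). e t *s w) \<in> borel_measurable (borel \<Otimes>\<^sub>M borel)"
  proof -
    have "continuous_on UNIV (\<lambda>p :: real \<times> (complex ^ 'n). e (fst p) *s snd p)"
      unfolding vector_scalar_mult_def e_def
      by (intro continuous_intros)
    from borel_measurable_continuous_onI[OF this] show ?thesis
      by (simp add: borel_prod split_beta')
  qed
  define G where "G x = ennreal (norm (h x)) * indicator (ball 0 r) x" for x
  have [measurable]: "ball 0 r \<in> sets (borel :: (complex ^ 'n) measure)" by simp
  have [measurable]: "G \<in> borel_measurable borel" unfolding G_def by measurable
  have [measurable]: "(\<lambda>(t, w). G (e t *s w)) \<in> borel_measurable (borel \<Otimes>\<^sub>M borel)"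
    by measurable
  have "ennreal (norm (g 0)) * indicator (ball 0 r) w \<le> (\<integral>\<^sup>+t. indicator {0..1} t * G (e t *s w) \<partial>lborel)" for w
  proof (cases "norm w < r")
    case True
    then have inR: "norm w < R" using r by simp
    have hg: "h (e t *s w) = g (e t *s w)" for t
      using inR by (simp add: h_def norm_scaleC_vec norm_e)
    have int: "((\<lambda>t. h (e t *s w)) has_integral g 0) {0..1}"
      using holomorphic_vec_mean_value[OF g inR] unfolding hg by (simp only: e_def)
    have "continuous_on {0..1} (\<lambda>t. g (e t *s w))"
      using inR unfolding e_def vector_scalar_mult_def
      by (intro continuous_on_compose2[OF holomorphic_vec_continuous_on[OF g]] continuous_intros)
        (auto simp: norm_scaleC_vec norm_exp_eq_Re simp flip: vector_scalar_mult_def)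
    then have "continuous_on {0..1} (\<lambda>t. norm (h (e t *s w)))"
      unfolding hg by (intro continuous_intros)
    then have nint: "((\<lambda>t. norm (h (e t *s w))) has_integral integral {0..1} (\<lambda>t. norm (h (e t *s w)))) {0..1}"
      by (intro integrable_integral integrable_continuous_interval)
    have "norm (g 0) \<le> integral {0..1} (\<lambda>t. norm (h (e t *s w)))"
      using integral_norm_bound_integral[OF has_integral_integrable[OF int] has_integral_integrable[OF nint]]
      by (simp add: integral_unique[OF int])
    also have "ennreal \<dots> = (\<integral>\<^sup>+t. indicator {0..1} t * ennreal (norm (h (e t *s w))) \<partial>lborel)"
    proof -
      have "(\<lambda>t. e t *s w) \<in> borel_measurable borel"
        unfolding e_def vector_scalar_mult_def
        by (intro borel_measurable_continuous_onI continuous_intros)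
      then have [measurable]: "(\<lambda>t. norm (h (e t *s w))) \<in> borel_measurable borel" by measurable
      have "((\<lambda>t. indicator {0..1} t * norm (h (e t *s w))) has_integral
          integral {0..1} (\<lambda>t. norm (h (e t *s w)))) UNIV"
      proof -
        have "(\<lambda>t. indicator {0..1} t * norm (h (e t *s w))) = (\<lambda>t. if t \<in> {0..1} then norm (h (e t *s w)) else 0)"
          by auto
        then show ?thesis using nint by (simp only: has_integral_restrict_UNIV)
      qed
      then have "(\<integral>\<^sup>+t. ennreal (indicator {0..1} t * norm (h (e t *s w))) \<partial>lborel) =
          integral {0..1} (\<lambda>t. norm (h (e t *s w)))"
        by (rule nn_integral_has_integral_lborel[rotated 2]) simp_all
      then show ?thesis
        by (simp add: ennreal_mult'' ennreal_indicator)
    qed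
    also have "\<dots> = (\<integral>\<^sup>+t. indicator {0..1} t * G (e t *s w) \<partial>lborel)"
      using True by (simp add: G_def norm_scaleC_vec norm_e)
    finally show ?thesis using True by (simp add: ennreal_leI)
  qed simp
  then have "(\<integral>\<^sup>+w. ennreal (norm (g 0)) * indicator (ball 0 r :: (complex ^ 'n) set) w \<partial>lborel)
      \<le> (\<integral>\<^sup>+w. (\<integral>\<^sup>+t. indicator {0..1} t * G (e t *s w) \<partial>lborel) \<partial>lborel)"
    by (intro nn_integral_mono) auto
  also have "\<dots> = (\<integral>\<^sup>+t. (\<integral>\<^sup>+w. indicator {0..1} t * G (e t *s w) \<partial>lborel) \<partial>(lborel :: real measure))"
    by (rule lborel_pair.Fubini'[where f="\<lambda>t w. indicator {0..1} t * G (e t *s w)"]) measurable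
  also have "\<dots> = (\<integral>\<^sup>+t. indicator {0..1} t * (\<integral>\<^sup>+w. G w \<partial>lborel) \<partial>(lborel :: real measure))"
  proof (rule nn_integral_cong)
    fix t :: real
    have "(\<lambda>w. e t *s w :: complex ^ 'n) \<in> borel_measurable borel"
      by (intro borel_measurable_continuous_onI linear_continuous_on linear_conv_bounded_linear[THEN iffD1] linear_scaleC_vec)
    then have "(\<lambda>w. G (e t *s w)) \<in> borel_measurable lborel" by measurable
    then have "(\<integral>\<^sup>+w. indicator {0..1} t * G (e t *s w) \<partial>lborel) = indicator {0..1} t * (\<integral>\<^sup>+w. G (e t *s w) \<partial>lborel)"
      by (rule nn_integral_cmult)
    also have "(\<integral>\<^sup>+w. G (e t *s w) \<partial>lborel) = (\<integral>\<^sup>+w. G w \<partial>lborel)"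
      by (rule nn_integral_lborel_isometry) (simp_all add: linear_scaleC_vec norm_scaleC_vec norm_e)
    finally show "(\<integral>\<^sup>+w. indicator {0..1} t * G (e t *s w) \<partial>lborel) = indicator {0..1} t * (\<integral>\<^sup>+w. G w \<partial>lborel)" .
  qed
  also have "\<dots> = (\<integral>\<^sup>+w. G w \<partial>lborel)"
    by (simp add: nn_integral_multc)
  also have "\<dots> = (\<integral>\<^sup>+x\<in>ball 0 r. ennreal (norm (g x)) \<partial>lborel)"
    using r by (intro nn_integral_cong) (auto simp: G_def h_def indicator_def)
  finally show ?thesis by (simp add: nn_integral_cmult)
qed

lemma norm_mean_value_ball_shift:
  fixes g :: "complex ^ 'n \<Rightarrow> complex"
  assumes g: "holomorphic_vec g (ball w r)" and r: "0 < r"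
  shows "ennreal (norm (g w)) * emeasure lborel (ball 0 r :: (complex ^ 'n) set)
    \<le> (\<integral>\<^sup>+x\<in>ball w r. ennreal (norm (g x)) \<partial>lborel)"
proof -
  have g': "holomorphic_vec (\<lambda>x. g (w + id x)) (ball 0 r)"
    by (rule holomorphic_vec_affine[OF g]) (auto simp: dist_norm id_def linear_iff)
  define h where "h = (\<lambda>x. indicator (ball w r) x *\<^sub>R g x)"
  have [measurable]: "h \<in> borel_measurable borel"
    unfolding h_def by (rule holomorphic_vec_measurable[OF g]) simp
  have "ennreal (norm (g w)) * emeasure lborel (ball 0 r :: (complex ^ 'n) set)
    \<le> (\<integral>\<^sup>+x\<in>ball 0 r. ennreal (norm (g (w + x))) \<partial>lborel)"
    using norm_mean_value_ball[OF g' r] by simp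
  also have "\<dots> = (\<integral>\<^sup>+x. ennreal (norm (h (w + x))) \<partial>lborel)"
    by (intro nn_integral_cong) (auto simp: h_def indicator_def dist_norm)
  also have "\<dots> = (\<integral>\<^sup>+x. ennreal (norm (h x)) \<partial>lborel)"
    by (rule nn_integral_lborel_translate) measurable
  also have "\<dots> = (\<integral>\<^sup>+x\<in>ball w r. ennreal (norm (g x)) \<partial>lborel)"
    by (intro nn_integral_cong) (auto simp: h_def indicator_def)
  finally show ?thesis .
qed

lemma le_powr_interpolate:
  fixes x l p :: real
  assumes "0 \<le> x" "0 < l" "1 \<le> p"
  shows "x \<le> l + l powr (1 - p) * x powr p"
proof (cases "x \<le> l")
  case True
  then show ?thesis by (simp add: add_increasing2)
next
  case False
  then have "x = x powr (1 - p) * x powr p"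
    using assms by (simp flip: powr_add)
  also have "\<dots> \<le> l powr (1 - p) * x powr p"
    using False assms by (intro mult_right_mono powr_mono2') auto
  finally show ?thesis using assms by linarith
qed

lemma le_powr_product:
  fixes x m p :: real
  assumes "0 \<le> x" "x \<le> m" "0 < p" "p \<le> 1"
  shows "x \<le> m powr (1 - p) * x powr p"
proof (cases "x = 0")
  case False
  then have "x = x powr (1 - p) * x powr p"
    using assms by (simp flip: powr_add)
  also have "\<dots> \<le> m powr (1 - p) * x powr p"
    using assms by (intro mult_right_mono powr_mono2) auto
  finally show ?thesis .
qed simp

lemma emeasure_ball_measure:
  "emeasure lborel (ball c r :: 'a::euclidean_space set) = ennreal (measure lborel (ball c r))"
  by (rule emeasure_eq_ennreal_measure) (use emeasure_lborel_ball_finite[of c r] in auto)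

lemma submean_powr_ge_1:
  fixes p :: real
  assumes p: "1 \<le> p"
  shows "\<exists>C>0. \<forall>g :: complex ^ 'n \<Rightarrow> complex. holomorphic_vec g (ball 0 1) \<longrightarrow>
    ennreal (norm (g 0) powr p) \<le> ennreal C * (\<integral>\<^sup>+x\<in>ball 0 1. ennreal (norm (g x) powr p) \<partial>lborel)"
proof -
  let ?B = "ball 0 1 :: (complex ^ 'n) set"
  define V where "V = measure lborel ?B"
  have eV: "emeasure lborel ?B = ennreal V"
    unfolding V_def by (rule emeasure_ball_measure)
  have V: "0 < V" unfolding V_def by (simp add: content_ball_pos)
  define C where "C = (1 + 1 / V) powr p"
  have "0 < 1 + 1 / V" using V by (simp add: add_pos_pos)
  then have C: "0 < C" unfolding C_def by simp
  show ?thesis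
  proof (intro exI[of _ C] conjI allI impI)
    fix g :: "complex ^ 'n \<Rightarrow> complex" assume g: "holomorphic_vec g ?B"
    let ?I = "\<integral>\<^sup>+x\<in>?B. ennreal (norm (g x) powr p) \<partial>lborel"
    have [measurable]: "(\<lambda>x. ennreal (norm (g x) powr p) * indicator ?B x) \<in> borel_measurable borel"
      by (rule holomorphic_vec_powr_measurable[OF g]) (use p in auto)
    show "ennreal (norm (g 0) powr p) \<le> ennreal C * ?I"
    proof (cases "?I = \<infinity>")
      case True
      then show ?thesis using C by (simp add: ennreal_mult_top)
    next
      case False
      then obtain i where i: "0 \<le> i" "?I = ennreal i" by (cases "?I") auto
      have "norm (g 0) powr p \<le> C * \<mu>" if \<mu>: "i < \<mu>" for \<mu>
      proof -
        define l where "l = \<mu> powr (1 / p)"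
        have \<mu>0: "0 < \<mu>" using i \<mu> by simp
        have l: "0 < l" "l powr p = \<mu>" using \<mu>0 p by (auto simp: l_def powr_powr)
        have "ennreal (norm (g 0)) * ennreal V \<le> (\<integral>\<^sup>+x\<in>?B. ennreal (norm (g x)) \<partial>lborel)"
          using norm_mean_value_ball[OF g, of 1] by (simp add: eV)
        also have "\<dots> \<le> (\<integral>\<^sup>+x. ennreal l * indicator ?B x + ennreal (l powr (1 - p)) * (ennreal (norm (g x) powr p) * indicator ?B x) \<partial>lborel)"
        proof (intro nn_integral_mono)
          fix x
          show "ennreal (norm (g x)) * indicator ?B x \<le> ennreal l * indicator ?B x + ennreal (l powr (1 - p)) * (ennreal (norm (g x) powr p) * indicator ?B x)"
            using le_powr_interpolate[OF norm_ge_zero l(1) p, of "g x"] l(1)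
            by (auto simp: indicator_def ennreal_mult'[symmetric] ennreal_plus[symmetric] simp del: ennreal_plus)
        qed
        also have "\<dots> = ennreal l * ennreal V + ennreal (l powr (1 - p)) * ?I"
        proof -
          have [measurable]: "?B \<in> sets lborel" by simp
          have m1: "(\<lambda>x. ennreal l * indicator ?B x) \<in> borel_measurable lborel" by measurable
          have m2: "(\<lambda>x. ennreal (norm (g x) powr p) * indicator ?B x) \<in> borel_measurable lborel" by simp
          have m3: "(\<lambda>x. ennreal (l powr (1 - p)) * (ennreal (norm (g x) powr p) * indicator ?B x)) \<in> borel_measurable lborel" by measurable
          show ?thesis
            by (simp only: nn_integral_add[OF m1 m3] nn_integral_cmult[OF m2])
              (simp add: nn_integral_cmult_indicator eV)
        qed
        also have "\<dots> = ennreal (l * V + l powr (1 - p) * i)"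
          using l V i by (simp add: ennreal_mult ennreal_plus)
        finally have "norm (g 0) * V \<le> l * V + l powr (1 - p) * i"
          using l V i by (simp add: ennreal_mult[symmetric] del: ennreal_plus)
        also have "l powr (1 - p) * i \<le> l powr (1 - p) * l powr p"
          using l \<mu> by (intro mult_left_mono) auto
        also have "\<dots> = l" using l(1) by (simp flip: powr_add)
        finally have "norm (g 0) \<le> (1 + 1 / V) * l"
          using V by (simp add: field_simps)
        then have "norm (g 0) powr p \<le> ((1 + 1 / V) * l) powr p"
          using p by (intro powr_mono2) auto
        also have "\<dots> = C * \<mu>" using V l by (simp add: C_def powr_mult)
        finally show ?thesis .
      qed
      note le = this
      have "norm (g 0) powr p / C \<le> \<mu>" if "i < \<mu>" for \<mu>
        using le[OF that] C by (simp add: pos_divide_le_eq mult.commute)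
      then have "norm (g 0) powr p / C \<le> i" by (rule dense_ge)
      then have "norm (g 0) powr p \<le> C * i" using C by (simp add: field_simps)
      then show ?thesis using C i by (simp add: ennreal_mult[symmetric])
    qed
  qed (rule C)
qed

text \<open>For \<open>p \<le> 1\<close> the case \<open>p = 1\<close> is applied on the balls of radius \<open>(1 - norm w) / 2\<close>, and all but
  the \<open>p\<close>-th power of \<open>norm (g x)\<close> is absorbed by the supremum of
  \<open>(1 - norm w) powr (d / p) * norm (g w)\<close>.\<close>

lemma submean_powr_le_1:
  fixes p :: real
  assumes p: "0 < p" "p \<le> 1"
  shows "\<exists>C>0. \<forall>g :: complex ^ 'n \<Rightarrow> complex. holomorphic_vec g (ball 0 2) \<longrightarrow>
    ennreal (norm (g 0) powr p) \<le> ennreal C * (\<integral>\<^sup>+x\<in>ball 0 1. ennreal (norm (g x) powr p) \<partial>lborel)"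
proof -
  let ?B = "ball 0 1 :: (complex ^ 'n) set"
  define d where "d = DIM(complex ^ 'n)"
  define V where "V = unit_ball_vol (real d)"
  have V: "0 < V" by (simp add: V_def)
  have eV: "emeasure lborel (ball 0 r :: (complex ^ 'n) set) = ennreal (V * r ^ d)" if "0 \<le> r" for r
    using that by (simp add: emeasure_ball V_def d_def)
  define q where "q = real d / p"
  have q: "0 \<le> q" "q * p = d" using p by (auto simp: q_def)
  define C where "C = 2 powr q / V"
  have C: "0 < C" using V by (simp add: C_def)
  show ?thesis
  proof (intro exI[of _ C] conjI allI impI)
    fix g :: "complex ^ 'n \<Rightarrow> complex" assume g2: "holomorphic_vec g (ball 0 2)"
    then have g: "holomorphic_vec g ?B" by (rule holomorphic_vec_subset) auto
    let ?I = "\<integral>\<^sup>+x\<in>?B. ennreal (norm (g x) powr p) \<partial>lborel"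
    have [measurable]: "(\<lambda>x. ennreal (norm (g x) powr p) * indicator ?B x) \<in> borel_measurable borel"
      by (rule holomorphic_vec_powr_measurable[OF g]) (use p in auto)
    define h where "h w = (1 - norm w) powr q * norm (g w)" for w
    define M where "M = (SUP w\<in>?B. h w)"
    have "continuous_on (cball 0 1) (\<lambda>w. norm (g w))"
      by (intro continuous_intros continuous_on_subset[OF holomorphic_vec_continuous_on[OF g2]]) auto
    then have "bounded ((\<lambda>w. norm (g w)) ` cball 0 1)"
      by (intro compact_imp_bounded compact_continuous_image) auto
    then obtain K where "\<forall>w\<in>cball 0 1. norm (g w) \<le> K"
      by (auto simp: bounded_iff)
    then have K: "norm (g w) \<le> K" if "w \<in> ?B" for w
      using that by auto
    have hK: "h w \<le> 1 * K" if "w \<in> ?B" for w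
      unfolding h_def using that K[OF that] q by (intro mult_mono powr_le1) auto
    then have bdd: "bdd_above (h ` ?B)" by (intro bdd_aboveI2)
    have hM: "h w \<le> M" if "w \<in> ?B" for w
      unfolding M_def using bdd that by (intro cSUP_upper)
    have g0: "norm (g 0) \<le> M" using hM[of 0] by (simp add: h_def)
    show "ennreal (norm (g 0) powr p) \<le> ennreal C * ?I"
    proof (cases "?I = \<infinity> \<or> M = 0")
      case True
      then show ?thesis using C g0 by (auto simp: ennreal_mult_top)
    next
      case False
      then obtain i where i: "0 \<le> i" "?I = ennreal i" by (cases "?I") auto
      have M: "0 < M" using False g0 norm_ge_zero[of "g 0"] by linarith
      have "h w \<le> C * M powr (1 - p) * i" if w: "w \<in> ?B" for w
      proof -
        define r where "r = (1 - norm w) / 2"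
        have r: "0 < r" using w by (simp add: r_def)
        have sub: "1 - norm x \<ge> r" if "x \<in> ball w r" for x
          using that norm_triangle_ineq2[of x w] by (simp add: dist_norm norm_minus_commute r_def)
        then have sub': "ball w r \<subseteq> ?B" using r by (force)
        define m where "m = M * r powr (- q)"
        have gx: "norm (g x) \<le> m" if "x \<in> ball w r" for x
        proof -
          have "r powr q * norm (g x) \<le> h x"
            unfolding h_def using sub[OF that] r q by (intro mult_right_mono powr_mono2) auto
          also have "\<dots> \<le> M" using hM sub' that by blast
          finally show ?thesis using r by (simp add: m_def powr_minus field_simps)
        qed
        have "ennreal (norm (g w)) * ennreal (V * r ^ d) \<le> (\<integral>\<^sup>+x\<in>ball w r. ennreal (norm (g x)) \<partial>lborel)"
          using norm_mean_value_ball_shift[OF holomorphic_vec_subset[OF g sub'] r] r by (simp add: eV)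
        also have "\<dots> \<le> (\<integral>\<^sup>+x. ennreal (m powr (1 - p)) * (ennreal (norm (g x) powr p) * indicator ?B x) \<partial>lborel)"
        proof (intro nn_integral_mono)
          fix x
          show "ennreal (norm (g x)) * indicator (ball w r) x \<le> ennreal (m powr (1 - p)) * (ennreal (norm (g x) powr p) * indicator ?B x)"
            using le_powr_product[OF norm_ge_zero gx p, of x] sub'
            by (auto simp: indicator_def ennreal_mult'[symmetric])
        qed
        also have "\<dots> = ennreal (m powr (1 - p) * i)"
          using i by (simp add: nn_integral_cmult ennreal_mult)
        finally have "norm (g w) * (V * r ^ d) \<le> m powr (1 - p) * i"
          using V r i by (simp add: ennreal_mult[symmetric])
        also have "m powr (1 - p) = M powr (1 - p) * r powr (d - q)"
        proof -
          have "- q * (1 - p) = d - q" using q by (simp add: algebra_simps)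
          then show ?thesis using M r by (simp add: m_def powr_mult powr_powr)
        qed
        also have "r powr (d - q) = r ^ d / r powr q"
          using r by (simp add: powr_diff powr_realpow)
        finally have "r powr q * norm (g w) \<le> M powr (1 - p) * i / V"
          using V r by (simp add: field_simps)
        moreover have "h w = 2 powr q * (r powr q * norm (g w))"
          using w by (simp add: h_def r_def powr_divide)
        ultimately have "h w \<le> 2 powr q * (M powr (1 - p) * i / V)"
          by (simp only:) (intro mult_left_mono, auto)
        then show ?thesis by (simp add: C_def mult_ac)
      qed
      then have "M \<le> C * M powr (1 - p) * i"
        unfolding M_def by (intro cSUP_least) auto
      then have "M / M powr (1 - p) \<le> C * i" using M by (simp add: field_simps)
      also have "M / M powr (1 - p) = M powr p" using M by (simp add: powr_diff)
      finally have "norm (g 0) powr p \<le> C * i"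
        using g0 p by (meson norm_ge_zero order_trans powr_mono2 less_imp_le)
      then show ?thesis using C i by (simp add: ennreal_mult[symmetric])
    qed
  qed (rule C)
qed

lemma submean_powr:
  fixes p :: real
  assumes p: "0 < p"
  obtains C where "C > 0" "\<And>g :: complex ^ 'n \<Rightarrow> complex. holomorphic_vec g (ball 0 2) \<Longrightarrow>
    ennreal (norm (g 0) powr p) \<le> ennreal C * (\<integral>\<^sup>+x\<in>ball 0 1. ennreal (norm (g x) powr p) \<partial>lborel)"
proof (cases "p \<le> 1")
  case True
  from submean_powr_le_1[OF p True, where 'n='n] show ?thesis by (auto intro: that)
next
  case False
  then have "1 \<le> p" by simp
  have "holomorphic_vec g (ball 0 1)" if "holomorphic_vec g (ball 0 2)" for g :: "complex ^ 'n \<Rightarrow> complex"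
    using that by (rule holomorphic_vec_subset) auto
  with submean_powr_ge_1[OF \<open>1 \<le> p\<close>, where 'n='n] show ?thesis by (auto intro: that)
qed

section \<open>Weighted integrals over subsets of the ball\<close>

abbreviation (input) weight :: "real \<Rightarrow> complex ^ 'n \<Rightarrow> real"
  where "weight \<alpha> w \<equiv> (1 - (norm w)\<^sup>2) powr \<alpha>"

definition bergman_int :: "real \<Rightarrow> real \<Rightarrow> (complex ^ 'n \<Rightarrow> complex) \<Rightarrow> (complex ^ 'n) set \<Rightarrow> ennreal"
  where "bergman_int \<alpha> p f A =
    (\<integral>\<^sup>+w. ennreal (norm (f w) powr p * weight \<alpha> w) * indicator (A \<inter> ball 0 1) w \<partial>lborel)"

lemma bergman_int_measurable:
  assumes f: "holomorphic_vec f (ball 0 1)" and p: "0 < p" and A: "A \<in> sets borel"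
  shows "(\<lambda>w. ennreal (norm (f w) powr p * weight \<alpha> w) * indicator (A \<inter> ball 0 1) w)
    \<in> borel_measurable borel"
proof -
  note [measurable] = holomorphic_vec_powr_measurable[OF f open_ball p] A
  have "(\<lambda>w. ennreal (norm (f w) powr p) * indicator (ball 0 1) w * ennreal (weight \<alpha> w) * indicator A w)
    \<in> borel_measurable borel" by measurable
  also have "(\<lambda>w. ennreal (norm (f w) powr p) * indicator (ball 0 1) w * ennreal (weight \<alpha> w) * indicator A w)
    = (\<lambda>w. ennreal (norm (f w) powr p * weight \<alpha> w) * indicator (A \<inter> ball 0 1) w)"
    by (auto simp: indicator_def ennreal_mult)
  finally show ?thesis .
qed

lemma bergman_int_unitary:
  assumes f: "holomorphic_vec f (ball 0 1)" and p: "0 < p" and A: "A \<in> sets borel"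
    and U: "unitary_map U" and AU: "\<And>x. U x \<in> A \<longleftrightarrow> x \<in> A"
  shows "bergman_int \<alpha> p (\<lambda>x. f (U x)) A = bergman_int \<alpha> p f A"
proof -
  have lin: "linear U" and nU: "\<And>x. norm (U x) = norm x" using U by (auto simp: unitary_map_def)
  define G where "G w = ennreal (norm (f w) powr p * weight \<alpha> w) * indicator (A \<inter> ball 0 1) w" for w
  have G: "G \<in> borel_measurable borel"
    unfolding G_def by (rule bergman_int_measurable[OF f p A])
  have "bergman_int \<alpha> p (\<lambda>x. f (U x)) A = (\<integral>\<^sup>+w. G (U w) \<partial>lborel)"
    unfolding bergman_int_def G_def by (intro nn_integral_cong) (simp add: indicator_def AU nU)
  also have "\<dots> = (\<integral>\<^sup>+w. G w \<partial>lborel)"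
    by (rule nn_integral_lborel_isometry[OF lin nU G])
  finally show ?thesis by (simp add: bergman_int_def G_def)
qed

lemma prod_Basis_vec:
  "(\<Prod>j\<in>Basis. f j) = (\<Prod>i\<in>UNIV. f (axis i 1) * f (axis i \<i>))"
  for f :: "complex ^ 'n \<Rightarrow> real"
proof -
  have inj: "inj_on (\<lambda>(i, u). axis i u :: complex ^ 'n) (UNIV \<times> Basis)"
    by (auto simp: inj_on_def axis_eq_axis Basis_complex_def)
  have "Basis = (\<lambda>(i, u). axis i u :: complex ^ 'n) ` (UNIV \<times> Basis)"
    by (auto simp: Basis_vec_def)
  then have "(\<Prod>j\<in>Basis. f j) = prod f ((\<lambda>(i, u). axis i u) ` (UNIV \<times> Basis))"
    by (rule arg_cong)
  also have "\<dots> = (\<Prod>(i, u)\<in>UNIV \<times> Basis. f (axis i u))"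
    unfolding prod.reindex[OF inj] by (simp add: o_def case_prod_beta)
  finally have "(\<Prod>j\<in>Basis. f j) = (\<Prod>(i, u)\<in>UNIV \<times> Basis. f (axis i u))" .
  then show ?thesis
    by (simp add: prod.cartesian_product[symmetric] Basis_complex_def)
qed

text \<open>Unlike a Euclidean ball, the image of the unit ball under \<open>x \<mapsto> r *\<^sub>R axis k 1 + D x\<close> with \<open>D\<close>
  as below has a volume of the sharp order \<open>(1 - r) ^ (n + 1)\<close> while keeping \<open>1 - (norm w)\<^sup>2\<close>
  comparable to \<open>1 - r\<close>.\<close>

definition aniso :: "'n \<Rightarrow> real \<Rightarrow> complex ^ 'n \<Rightarrow> complex ^ 'n"
  where "aniso k \<delta> x = (\<chi> i. of_real (if i = k then \<delta> / 4 else sqrt \<delta> / 4) * x $ i)"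

lemma linear_aniso: "linear (aniso k \<delta>)"
  by (rule linearI) (simp_all add: aniso_def vec_eq_iff algebra_simps)

lemma aniso_scaleC: "aniso k \<delta> (c *s x) = c *s aniso k \<delta> x"
  by (simp add: aniso_def vec_eq_iff)

lemma norm_aniso_le:
  assumes "0 < \<delta>" "\<delta> \<le> 1"
  shows "norm (aniso k \<delta> x) \<le> sqrt \<delta> / 4 * norm x"
proof -
  have "\<delta> \<le> sqrt \<delta>" using assms by (simp add: real_le_rsqrt power2_eq_square mult_left_le)
  then have "L2_set (\<lambda>i. norm (aniso k \<delta> x $ i)) UNIV \<le> L2_set (\<lambda>i. sqrt \<delta> / 4 * norm (x $ i)) UNIV"
    using assms by (intro L2_set_mono) (auto simp: aniso_def norm_mult intro!: mult_right_mono)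
  also have "\<dots> = sqrt \<delta> / 4 * norm x"
    unfolding norm_vec_def by (rule L2_set_right_distrib[symmetric]) (use assms in simp)
  finally show ?thesis by (simp add: norm_vec_def)
qed

lemma norm_aniso_shift:
  fixes r :: real and k :: "'n::finite"
  assumes r: "0 \<le> r" "r < 1"
  defines "w x \<equiv> r *\<^sub>R axis k 1 + aniso k (1 - r) x"
  shows "norm x < 2 \<Longrightarrow> norm (w x) < 1"
    and "norm x < 1 \<Longrightarrow> (1 - r) / 2 \<le> 1 - (norm (w x))\<^sup>2 \<and> 1 - (norm (w x))\<^sup>2 \<le> 3 * (1 - r)"
proof -
  define \<delta> where "\<delta> = 1 - r"
  have \<delta>: "0 < \<delta>" "\<delta> \<le> 1" using r by (auto simp: \<delta>_def)
  have eq: "(norm (w x))\<^sup>2 = r\<^sup>2 + r * \<delta> / 2 * Re (x $ k) + (norm (aniso k \<delta> x))\<^sup>2"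
  proof -
    have "axis k 1 \<bullet> aniso k \<delta> x = \<delta> / 4 * Re (x $ k)"
      by (simp add: inner_axis' aniso_def inner_complex_def)
    note ax = this
    have "norm (axis k (1 :: complex)) = 1" by (simp add: norm_eq_1 inner_axis')
    then show ?thesis
      using dot_norm[of "r *\<^sub>R axis k 1" "aniso k \<delta> x"] r
      unfolding w_def \<delta>_def[symmetric] inner_scaleR_left ax by (simp add: field_simps)
  qed
  have Re: "\<bar>Re (x $ k)\<bar> \<le> norm x"
    using abs_Re_le_cmod Finite_Cartesian_Product.norm_nth_le order_trans by blast
  have "norm (aniso k \<delta> x) \<le> sqrt \<delta> / 4 * norm x" using norm_aniso_le[OF \<delta>] .
  then have "(norm (aniso k \<delta> x))\<^sup>2 \<le> (sqrt \<delta> / 4 * norm x)\<^sup>2" by (intro power_mono) auto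
  also have "\<dots> = \<delta> / 16 * (norm x)\<^sup>2" using \<delta> by (simp add: power_mult_distrib power_divide)
  finally have D: "(norm (aniso k \<delta> x))\<^sup>2 \<le> \<delta> / 16 * (norm x)\<^sup>2" .
  have rd: "0 \<le> r * \<delta> / 2" using r \<delta> by simp
  have main: "1 - (norm (w x))\<^sup>2 \<ge> \<delta> * (1 + r) - r * \<delta> / 2 * X - \<delta> / 16 * X\<^sup>2"
      "1 - (norm (w x))\<^sup>2 \<le> \<delta> * (1 + r) + r * \<delta> / 2 * X"
    if X: "norm x \<le> X" for X
  proof -
    have "\<bar>Re (x $ k)\<bar> \<le> X" using Re X by simp
    then have "\<bar>r * \<delta> / 2 * Re (x $ k)\<bar> \<le> r * \<delta> / 2 * X"
      unfolding abs_mult using rd by (simp add: mult_left_mono)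
    moreover have "\<delta> / 16 * (norm x)\<^sup>2 \<le> \<delta> / 16 * X\<^sup>2"
      using X \<delta> by (intro mult_left_mono power_mono) auto
    moreover have "1 - r\<^sup>2 = \<delta> * (1 + r)" by (simp add: \<delta>_def power2_eq_square algebra_simps)
    moreover have "0 \<le> (norm (aniso k \<delta> x))\<^sup>2" by simp
    ultimately show "1 - (norm (w x))\<^sup>2 \<ge> \<delta> * (1 + r) - r * \<delta> / 2 * X - \<delta> / 16 * X\<^sup>2"
      "1 - (norm (w x))\<^sup>2 \<le> \<delta> * (1 + r) + r * \<delta> / 2 * X"
      using eq D by linarith+
  qed
  show "norm (w x) < 1" if "norm x < 2"
  proof -
    have "1 - (norm (w x))\<^sup>2 \<ge> \<delta> * (1 + r) - r * \<delta> / 2 * 2 - \<delta> / 16 * 2\<^sup>2"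
      using that by (intro main) simp
    also have "\<delta> * (1 + r) - r * \<delta> / 2 * 2 - \<delta> / 16 * 2\<^sup>2 = \<delta> * (3 / 4)" by (simp add: algebra_simps)
    finally have "(norm (w x))\<^sup>2 < 1" using \<delta> by linarith
    then show ?thesis by (simp add: power_less_one_iff abs_square_less_1)
  qed
  show "(1 - r) / 2 \<le> 1 - (norm (w x))\<^sup>2 \<and> 1 - (norm (w x))\<^sup>2 \<le> 3 * (1 - r)" if "norm x < 1"
  proof -
    have m: "1 - (norm (w x))\<^sup>2 \<ge> \<delta> * (1 + r) - r * \<delta> / 2 * 1 - \<delta> / 16 * 1\<^sup>2"
       "1 - (norm (w x))\<^sup>2 \<le> \<delta> * (1 + r) + r * \<delta> / 2 * 1"
      using that by (intro main; simp)+
    have "r * \<delta> \<le> \<delta>" "0 \<le> r * \<delta>" using r \<delta> by (auto simp: mult_left_le_one_le)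
    moreover have "\<delta> * (1 + r) = \<delta> + r * \<delta>" by (simp add: algebra_simps)
    ultimately have "\<delta> / 2 \<le> 1 - (norm (w x))\<^sup>2" "1 - (norm (w x))\<^sup>2 \<le> 3 * \<delta>"
      using m \<delta> by (simp_all only: one_power2 mult_1_right)
    then show ?thesis unfolding \<delta>_def[symmetric] by blast
  qed
qed

lemma nn_integral_aniso:
  fixes k :: "'n::finite"
  assumes \<delta>: "0 < \<delta>" and H[measurable]: "H \<in> borel_measurable borel"
  shows "(\<integral>\<^sup>+w. H w \<partial>lborel)
    = ennreal ((1 / 4) ^ (2 * CARD('n)) * \<delta> ^ (CARD('n) + 1)) * (\<integral>\<^sup>+x. H (t + aniso k \<delta> x) \<partial>lborel)"
proof -
  define c where "c j = (if j $ k = 0 then sqrt \<delta> / 4 else \<delta> / 4)" for j :: "complex ^ 'n"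
  have c: "c j \<noteq> 0" for j using \<delta> by (auto simp: c_def)
  define T where "T x = t + (\<Sum>j\<in>Basis. (c j * (x \<bullet> j)) *\<^sub>R j)" for x
  have T: "T x = t + aniso k \<delta> x" for x
  proof -
    have "(\<Sum>j\<in>Basis. (c j * (x \<bullet> j)) *\<^sub>R j) = aniso k \<delta> x"
    proof (rule euclidean_eqI)
      fix b :: "complex ^ 'n" assume b: "b \<in> Basis"
      then have "(\<Sum>j\<in>Basis. (c j * (x \<bullet> j)) *\<^sub>R j) \<bullet> b = c b * (x \<bullet> b)"
        by (simp add: inner_sum_left inner_Basis if_distrib sum.delta cong: if_cong)
      also have "\<dots> = aniso k \<delta> x \<bullet> b"
      proof -
        obtain i u where iu: "b = axis i u" "u = 1 \<or> u = \<i>"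
          using b by (auto simp: Basis_vec_def Basis_complex_def)
        then have "c b = (if i = k then \<delta> / 4 else sqrt \<delta> / 4)"
          by (auto simp: c_def axis_def)
        then show ?thesis using iu(2)
          unfolding iu(1) by (auto simp: inner_axis aniso_def inner_complex_def)
      qed
      finally show "(\<Sum>j\<in>Basis. (c j * (x \<bullet> j)) *\<^sub>R j) \<bullet> b = aniso k \<delta> x \<bullet> b" .
    qed
    then show ?thesis by (simp add: T_def)
  qed
  have [measurable]: "T \<in> borel_measurable borel"
    unfolding T_def by measurable
  have J: "(\<Prod>j\<in>Basis. \<bar>c j\<bar>) = (1 / 4) ^ (2 * CARD('n)) * \<delta> ^ (CARD('n) + 1)"
  proof -
    have "(\<Prod>j\<in>Basis. \<bar>c j\<bar>) = (\<Prod>i\<in>(UNIV :: 'n set). \<bar>c (axis i 1)\<bar> * \<bar>c (axis i \<i>)\<bar>)"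
      by (rule prod_Basis_vec)
    also have "\<dots> = (\<Prod>i\<in>(UNIV :: 'n set). (1 / 4)\<^sup>2 * (\<delta> * (if i = k then \<delta> else 1)))"
      using \<delta> by (intro prod.cong) (auto simp: c_def axis_def power2_eq_square)
    also have "\<dots> = (1 / 4) ^ (2 * CARD('n)) * \<delta> ^ (CARD('n) + 1)"
      by (simp add: prod.distrib power_mult)
    finally show ?thesis .
  qed
  have "(\<integral>\<^sup>+w. H w \<partial>lborel) = (\<integral>\<^sup>+w. H w \<partial>density (distr lborel borel T) (\<lambda>_. ennreal (\<Prod>j\<in>Basis. \<bar>c j\<bar>)))"
    using lborel_affine_euclidean[OF c, of t] by (simp only: T_def[abs_def])
  also have "\<dots> = ennreal (\<Prod>j\<in>Basis. \<bar>c j\<bar>) * (\<integral>\<^sup>+x. H (T x) \<partial>lborel)"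
    by (simp add: nn_integral_density nn_integral_cmult nn_integral_distr)
  finally show ?thesis by (simp only: J T)
qed

definition annulus :: "real \<Rightarrow> (complex ^ 'n) set"
  where "annulus \<delta> = {w. \<delta> / 2 \<le> 1 - (norm w)\<^sup>2 \<and> 1 - (norm w)\<^sup>2 \<le> 3 * \<delta>}"

lemma annulus_borel [measurable]: "annulus \<delta> \<in> sets borel"
  unfolding annulus_def by measurable

lemma weight_annulus:
  fixes \<alpha> :: real
  assumes "0 < \<delta>" "\<delta> / 2 \<le> x" "x \<le> 3 * \<delta>"
  shows "min (2 powr - \<alpha>) (3 powr \<alpha>) * \<delta> powr \<alpha> \<le> x powr \<alpha>"
proof (cases "0 \<le> \<alpha>")
  case True
  have "min (2 powr - \<alpha>) (3 powr \<alpha>) * \<delta> powr \<alpha> \<le> 2 powr - \<alpha> * \<delta> powr \<alpha>"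
    by (intro mult_right_mono) auto
  also have "\<dots> = (\<delta> / 2) powr \<alpha>"
    using assms by (simp add: powr_divide powr_minus field_simps)
  also have "\<dots> \<le> x powr \<alpha>" using assms True by (intro powr_mono2) auto
  finally show ?thesis .
next
  case False
  have "min (2 powr - \<alpha>) (3 powr \<alpha>) * \<delta> powr \<alpha> \<le> 3 powr \<alpha> * \<delta> powr \<alpha>"
    by (intro mult_right_mono) auto
  also have "\<dots> = (3 * \<delta>) powr \<alpha>"
    using assms by (simp add: powr_mult)
  also have "\<dots> \<le> x powr \<alpha>" using assms False by (intro powr_mono2') auto
  finally show ?thesis .
qed

lemma bergman_pointwise:
  assumes p: "0 < p"
  obtains C where "0 < C" "\<And>(f :: complex ^ 'n \<Rightarrow> complex) z. holomorphic_vec f (ball 0 1) \<Longrightarrow> norm z < 1 \<Longrightarrow>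
    ennreal (norm (f z) powr p)
      \<le> ennreal (C * (1 - norm z) powr - (real CARD('n) + 1 + \<alpha>)) * bergman_int \<alpha> p f (annulus (1 - norm z))"
proof -
  obtain C0 where C0: "0 < C0" "\<And>g :: complex ^ 'n \<Rightarrow> complex. holomorphic_vec g (ball 0 2) \<Longrightarrow>
    ennreal (norm (g 0) powr p) \<le> ennreal C0 * (\<integral>\<^sup>+x\<in>ball 0 1. ennreal (norm (g x) powr p) \<partial>lborel)"
    using submean_powr[OF p, where 'n='n] by blast
  define \<kappa> where "\<kappa> = min (2 powr - \<alpha>) (3 powr \<alpha>)"
  have \<kappa>: "0 < \<kappa>" by (simp add: \<kappa>_def)
  define c4 where "c4 = (1 / 4 :: real) ^ (2 * CARD('n))"
  have c4: "0 < c4" by (simp add: c4_def)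
  define C where "C = C0 / (c4 * \<kappa>)"
  have C: "0 < C" using C0 c4 \<kappa> by (simp add: C_def)
  show ?thesis
  proof (rule that[of C])
    fix f :: "complex ^ 'n \<Rightarrow> complex" and z :: "complex ^ 'n"
    assume f: "holomorphic_vec f (ball 0 1)" and z: "norm z < 1"
    define r where "r = norm z"
    define \<delta> where "\<delta> = 1 - r"
    have r: "0 \<le> r" "r < 1" using z by (auto simp: r_def)
    have \<delta>: "0 < \<delta>" using r by (simp add: \<delta>_def)
    define k :: 'n where "k = undefined"
    define e :: "complex ^ 'n" where "e = axis k 1"
    have e: "norm e = 1" by (simp add: e_def norm_eq_1 inner_axis')
    obtain U where U: "unitary_map U" and Uz: "U (r *\<^sub>R e) = z"
    proof (cases "z = 0")
      case True
      show ?thesis by (rule that[of id]) (auto simp: unitary_map_def r_def True id_def linear_iff)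
    next
      case False
      obtain U where U: "unitary_map U" "U e = z /\<^sub>R norm z"
        using unitary_map_exists[OF e, of "z /\<^sub>R norm z"] False by auto
      then show ?thesis using False
        by (intro that[of U]) (auto simp: unitary_map_def linear_scale r_def)
    qed
    have lin: "linear U" and Uc: "\<And>c x. U (c *s x) = c *s U x" and nU: "\<And>x. norm (U x) = norm x"
      using U by (auto simp: unitary_map_def)
    define w where "w x = r *\<^sub>R e + aniso k \<delta> x" for x
    have w1: "norm (w x) < 1" if "norm x < 2" for x
      using norm_aniso_shift(1)[OF r that] by (simp add: w_def e_def \<delta>_def)
    have w2: "w x \<in> annulus \<delta>" if "norm x < 1" for x
      using norm_aniso_shift(2)[OF r that] by (simp add: annulus_def w_def e_def \<delta>_def)
    have fU: "holomorphic_vec (\<lambda>x. f (U x)) (ball 0 1)"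
      using holomorphic_vec_affine[OF f lin Uc, of "ball 0 1" 0] by (simp add: nU)
    have "holomorphic_vec (\<lambda>x. f (U (w x))) (ball 0 2)"
      unfolding w_def using w1
      by (intro holomorphic_vec_affine[OF fU linear_aniso aniso_scaleC]) (simp add: w_def)
    note C0(2)[OF this]
    moreover have "U (w 0) = z"
      using Uz linear_0[OF linear_aniso, of k \<delta>] by (simp add: w_def)
    ultimately have "ennreal (norm (f z) powr p) \<le> ennreal C0 * (\<integral>\<^sup>+x\<in>ball 0 1. ennreal (norm (f (U (w x))) powr p) \<partial>lborel)"
      by simp
    also have "(\<integral>\<^sup>+x\<in>ball 0 1. ennreal (norm (f (U (w x))) powr p) \<partial>lborel)
      \<le> ennreal (1 / (c4 * \<kappa>) * \<delta> powr - (real CARD('n) + 1 + \<alpha>)) * bergman_int \<alpha> p f (annulus \<delta>)"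
    proof -
      define H where "H v = ennreal (norm (f (U v)) powr p * weight \<alpha> v) * indicator (annulus \<delta> \<inter> ball 0 1) v" for v
      have H[measurable]: "H \<in> borel_measurable borel"
        unfolding H_def by (rule bergman_int_measurable[OF fU p]) measurable
      have intH: "(\<integral>\<^sup>+v. H v \<partial>lborel) = bergman_int \<alpha> p f (annulus \<delta>)"
        using bergman_int_unitary[OF f p annulus_borel U, of \<delta> \<alpha>]
        by (simp add: H_def bergman_int_def annulus_def nU)
      define J where "J = c4 * \<delta> ^ (CARD('n) + 1)"
      have J: "0 < J" using c4 \<delta> by (simp add: J_def)
      have [measurable]: "w \<in> borel_measurable borel"
        unfolding w_def using linear_aniso[of k \<delta>]
        by (intro borel_measurable_continuous_onI continuous_intros linear_continuous_on) (simp add: linear_conv_bounded_linear)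
      have "(\<integral>\<^sup>+x\<in>ball 0 1. ennreal (norm (f (U (w x))) powr p) \<partial>lborel)
          \<le> (\<integral>\<^sup>+x. ennreal (1 / (\<kappa> * \<delta> powr \<alpha>)) * H (w x) \<partial>lborel)"
      proof (rule nn_integral_mono)
        fix x
        show "ennreal (norm (f (U (w x))) powr p) * indicator (ball 0 1) x \<le> ennreal (1 / (\<kappa> * \<delta> powr \<alpha>)) * H (w x)"
        proof (cases "norm x < 1")
          case True
          have "\<kappa> * \<delta> powr \<alpha> \<le> weight \<alpha> (w x)"
            using weight_annulus[OF \<delta>, of "1 - (norm (w x))\<^sup>2" \<alpha>] w2[OF True] by (simp add: annulus_def \<kappa>_def)
          then have "1 \<le> 1 / (\<kappa> * \<delta> powr \<alpha>) * weight \<alpha> (w x)"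
            using \<kappa> \<delta> by (simp add: field_simps)
          from mult_left_mono[OF this, of "norm (f (U (w x))) powr p"]
          have "norm (f (U (w x))) powr p \<le> 1 / (\<kappa> * \<delta> powr \<alpha>) * (norm (f (U (w x))) powr p * weight \<alpha> (w x))"
            by (simp add: mult_ac)
          then show ?thesis using True w1[of x] w2[OF True] \<kappa> \<delta>
            unfolding H_def by (simp add: ennreal_mult'[symmetric])
        qed simp
      qed
      also have "\<dots> = ennreal (1 / (\<kappa> * \<delta> powr \<alpha>)) * (\<integral>\<^sup>+x. H (w x) \<partial>lborel)"
        by (rule nn_integral_cmult) measurable
      also have "(\<integral>\<^sup>+x. H (w x) \<partial>lborel) = ennreal (1 / J) * (\<integral>\<^sup>+v. H v \<partial>lborel)"
      proof -
        have "ennreal (1 / J) * (\<integral>\<^sup>+v. H v \<partial>lborel) = ennreal (1 / J) * (ennreal J * (\<integral>\<^sup>+x. H (w x) \<partial>lborel))"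
          using nn_integral_aniso[OF \<delta> H, of "r *\<^sub>R e" k] by (simp only: w_def J_def c4_def)
        also have "\<dots> = (\<integral>\<^sup>+x. H (w x) \<partial>lborel)"
          using J by (simp add: mult.assoc[symmetric] ennreal_mult[symmetric])
        finally show ?thesis by simp
      qed
      also have "ennreal (1 / (\<kappa> * \<delta> powr \<alpha>)) * (ennreal (1 / J) * (\<integral>\<^sup>+v. H v \<partial>lborel))
        = ennreal (1 / (\<kappa> * \<delta> powr \<alpha>) * (1 / J)) * (\<integral>\<^sup>+v. H v \<partial>lborel)"
        using \<kappa> J by (simp add: ennreal_mult mult.assoc del: times_divide_eq_right times_divide_eq_left mult_1_right)
      also have "1 / (\<kappa> * \<delta> powr \<alpha>) * (1 / J) = 1 / (c4 * \<kappa>) * \<delta> powr - (real CARD('n) + 1 + \<alpha>)"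
      proof -
        have "\<delta> powr - (real CARD('n) + 1 + \<alpha>) = 1 / (\<delta> powr real (CARD('n) + 1) * \<delta> powr \<alpha>)"
          unfolding powr_minus powr_add[symmetric] by (simp add: divide_inverse add_ac)
        then show ?thesis using \<delta> by (simp only: powr_realpow[OF \<delta>]) (simp add: J_def field_simps)
      qed
      finally show ?thesis by (simp only: intH)
    qed
    also have "ennreal C0 * (ennreal (1 / (c4 * \<kappa>) * \<delta> powr - (real CARD('n) + 1 + \<alpha>)) * bergman_int \<alpha> p f (annulus \<delta>))
       = ennreal (C0 * (1 / (c4 * \<kappa>) * \<delta> powr - (real CARD('n) + 1 + \<alpha>))) * bergman_int \<alpha> p f (annulus \<delta>)"
      using C0(1) c4 \<kappa> by (simp add: ennreal_mult'[of C0] mult.assoc del: times_divide_eq_right times_divide_eq_left)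
    also have "C0 * (1 / (c4 * \<kappa>) * \<delta> powr - (real CARD('n) + 1 + \<alpha>)) = C * \<delta> powr - (real CARD('n) + 1 + \<alpha>)"
      by (simp add: C_def)
    finally show "ennreal (norm (f z) powr p)
      \<le> ennreal (C * (1 - norm z) powr - (real CARD('n) + 1 + \<alpha>)) * bergman_int \<alpha> p f (annulus (1 - norm z))"
      by (simp add: \<delta>_def r_def mult_left_mono)
  qed (rule C)
qed

definition vol_const :: "'n::finite itself \<Rightarrow> real \<Rightarrow> real"
  where "vol_const _ \<alpha> = weight_const TYPE('n) \<alpha> / measure lborel (ball 0 1 :: (complex ^ 'n) set)"

lemma weight_const_pos: "-1 < \<alpha> \<Longrightarrow> 0 < weight_const TYPE('n) \<alpha>"
  by (simp add: weight_const_def)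

lemma vol_const_pos: "-1 < \<alpha> \<Longrightarrow> 0 < vol_const TYPE('n::finite) \<alpha>"
  by (simp add: vol_const_def weight_const_pos content_ball_pos)

lemma sets_ball_volume: "sets (ball_volume :: (complex ^ 'n) measure) = sets (restrict_space borel (ball 0 1))"
  unfolding ball_volume_def by (intro sets_restrict_space_cong) simp

lemma holomorphic_vec_ball_volume_measurable:
  assumes "holomorphic_vec f (ball 0 1)"
  shows "f \<in> borel_measurable ball_volume"
proof -
  have "f \<in> borel_measurable (restrict_space borel (ball 0 1))"
    by (rule borel_measurable_continuous_on_restrict[OF holomorphic_vec_continuous_on[OF assms]])
  then show ?thesis
    using measurable_cong_sets[OF sets_ball_volume refl] by blast
qed

lemma nn_integral_weighted_volume:
  fixes f :: "complex ^ 'n \<Rightarrow> complex"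
  assumes \<alpha>: "-1 < \<alpha>" and p: "0 < p" and f: "holomorphic_vec f (ball 0 1)"
  shows "(\<integral>\<^sup>+z. ennreal (norm (f z) powr p) \<partial>weighted_volume \<alpha>) = ennreal (vol_const TYPE('n) \<alpha>) * bergman_int \<alpha> p f UNIV"
proof -
  let ?B = "ball 0 1 :: (complex ^ 'n) set"
  define c where "c = weight_const TYPE('n) \<alpha>"
  have c: "0 < c" using weight_const_pos[OF \<alpha>] by (simp add: c_def)
  define V where "V = measure lborel ?B"
  have eV: "emeasure lborel ?B = ennreal V"
    unfolding V_def by (rule emeasure_ball_measure)
  have V: "0 < V" unfolding V_def by (simp add: content_ball_pos)
  note [measurable] = holomorphic_vec_ball_volume_measurable[OF f]
  have [measurable]: "(\<lambda>z :: complex ^ 'n. ennreal (c * weight \<alpha> z)) \<in> borel_measurable ball_volume"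
    unfolding ball_volume_def by (rule measurable_restrict_space1) measurable
  have m: "(\<lambda>z. ennreal (norm (f z) powr p * weight \<alpha> z) * indicator ?B z) \<in> borel_measurable borel"
    using bergman_int_measurable[OF f p, of UNIV \<alpha>] by simp
  have "(\<integral>\<^sup>+z. ennreal (norm (f z) powr p) \<partial>weighted_volume \<alpha>)
      = (\<integral>\<^sup>+z. ennreal (c * weight \<alpha> z) * ennreal (norm (f z) powr p) \<partial>ball_volume)"
    unfolding weighted_volume_def c_def[symmetric] by (rule nn_integral_density) measurable
  also have "\<dots> = (\<integral>\<^sup>+z. ennreal (c * weight \<alpha> z) * ennreal (norm (f z) powr p) * indicator ?B z \<partial>uniform_measure lborel ?B)"
    unfolding ball_volume_def by (rule nn_integral_restrict_space) simp
  also have "\<dots> = (\<integral>\<^sup>+z. ennreal c * (ennreal (norm (f z) powr p * weight \<alpha> z) * indicator ?B z) \<partial>uniform_measure lborel ?B)"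
    using c by (intro nn_integral_cong) (simp add: ennreal_mult mult_ac)
  also have "\<dots> = ennreal c * (\<integral>\<^sup>+z. (ennreal (norm (f z) powr p * weight \<alpha> z) * indicator ?B z) \<partial>uniform_measure lborel ?B)"
    using m by (intro nn_integral_cmult) simp
  also have "(\<integral>\<^sup>+z. (ennreal (norm (f z) powr p * weight \<alpha> z) * indicator ?B z) \<partial>uniform_measure lborel ?B)
     = (\<integral>\<^sup>+z. (ennreal (norm (f z) powr p * weight \<alpha> z) * indicator ?B z) * indicator ?B z \<partial>lborel) / emeasure lborel ?B"
    using m by (intro nn_integral_uniform_measure) simp_all
  also have "\<dots> = bergman_int \<alpha> p f UNIV / ennreal V"
    unfolding eV bergman_int_def by (intro arg_cong2[where f="(/)"] nn_integral_cong) (auto simp: indicator_def)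
  also have "ennreal c * (bergman_int \<alpha> p f UNIV / ennreal V) = ennreal (c / V) * bergman_int \<alpha> p f UNIV"
    using V c by (simp only: divide_ennreal[OF less_imp_le[OF c] V, symmetric] ennreal_times_divide
        mult.commute[of _ "bergman_int \<alpha> p f UNIV"])
  finally show ?thesis by (simp add: vol_const_def c_def V_def)
qed

lemma bergman_spaceI:
  fixes f :: "complex ^ 'n \<Rightarrow> complex"
  assumes \<alpha>: "-1 < \<alpha>" and p: "0 < p" and f: "holomorphic_vec f (ball 0 1)"
    and fin: "bergman_int \<alpha> p f UNIV < \<infinity>"
  shows "f \<in> bergman_space p \<alpha>"
proof -
  have "f \<in> borel_measurable (weighted_volume \<alpha>)"
    using holomorphic_vec_ball_volume_measurable[OF f] by (simp add: weighted_volume_def)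
  then have "(\<lambda>z. norm (f z) powr p) \<in> borel_measurable (weighted_volume \<alpha>)"
    by measurable
  then have "integrable (weighted_volume \<alpha>) (\<lambda>z. norm (f z) powr p)"
    using fin by (intro integrableI_nonneg) (auto simp: nn_integral_weighted_volume[OF \<alpha> p f] ennreal_mult_less_top)
  then show ?thesis using f by (simp add: bergman_space_def)
qed

lemma bergman_norm_nonneg: "0 \<le> bergman_norm p \<alpha> f"
  by (simp add: bergman_norm_def)

lemma bergman_norm_powr:
  fixes f :: "complex ^ 'n \<Rightarrow> complex"
  assumes \<alpha>: "-1 < \<alpha>" and p: "0 < p" and f: "f \<in> bergman_space p \<alpha>"
  shows "ennreal (bergman_norm p \<alpha> f powr p) = ennreal (vol_const TYPE('n) \<alpha>) * bergman_int \<alpha> p f UNIV"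
proof -
  have h: "holomorphic_vec f (ball 0 1)" and i: "integrable (weighted_volume \<alpha>) (\<lambda>z. norm (f z) powr p)"
    using f by (auto simp: bergman_space_def)
  have "bergman_norm p \<alpha> f powr p = (LINT z|weighted_volume \<alpha>. norm (f z) powr p)"
    using p by (simp add: bergman_norm_def powr_powr)
  also have "ennreal \<dots> = (\<integral>\<^sup>+z. ennreal (norm (f z) powr p) \<partial>weighted_volume \<alpha>)"
    by (rule nn_integral_eq_integral[symmetric, OF i]) simp
  finally show ?thesis by (simp only: nn_integral_weighted_volume[OF \<alpha> p h])
qed

lemma delta_pos: "0 < delta m"
  by (simp add: delta_def)

lemma delta_Suc: "delta (Suc m) = delta m / 2"
  by (simp add: delta_def)

lemma delta_le_1: "delta m \<le> 1"
  by (simp add: delta_def)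

lemma delta_antimono: "k \<le> m \<Longrightarrow> delta m \<le> delta k"
  unfolding delta_def by (intro divide_left_mono power_increasing) auto

lemma radius_eq: "radius m = 1 - delta m"
  by (simp add: radius_def delta_def)

lemma radius_nonneg: "0 \<le> radius m"
  by (simp add: radius_eq delta_le_1)

lemma delta_tendsto_0: "delta \<longlonglongrightarrow> 0"
proof -
  have "delta = (\<lambda>m. (1 / 2) ^ m)" by (auto simp: delta_def power_divide)
  show ?thesis unfolding \<open>delta = _\<close> by (rule LIMSEQ_power_zero) simp
qed

lemma dyadic_exists:
  assumes "0 < x" "x \<le> 1"
  obtains m where "delta (Suc m) < x" "x \<le> delta m"
proof -
  have ex: "\<exists>m. delta m < x"
    using order_tendstoD(2)[OF delta_tendsto_0 assms(1)] by (auto simp: eventually_sequentially)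
  define m where "m = (LEAST m. delta m < x)"
  have m: "delta m < x" unfolding m_def using ex by (rule LeastI_ex)
  have "m \<noteq> 0" using m assms by (cases m) (auto simp: delta_def)
  then obtain k where k: "m = Suc k" by (cases m) auto
  have "\<not> delta k < x" using not_less_Least[of k "\<lambda>m. delta m < x"] k unfolding m_def by simp
  then show ?thesis using that[of k] m k by simp
qed

lemma dyadic_overlap:
  assumes "0 < x"
  shows "(\<Sum>m. indicator {x. delta m / 4 \<le> x \<and> x \<le> 3 * delta m} x :: ennreal) \<le> 4"
proof (cases "\<exists>m. delta m / 4 \<le> x \<and> x \<le> 3 * delta m")
  case False
  then have "(\<lambda>m. indicator {x. delta m / 4 \<le> x \<and> x \<le> 3 * delta m} x :: ennreal) = (\<lambda>_. 0)"
    by (auto simp: indicator_def)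
  then show ?thesis by simp
next
  case True
  define S where "S = {m. delta m / 4 \<le> x \<and> x \<le> 3 * delta m}"
  define a where "a = (LEAST m. m \<in> S)"
  have ex: "\<exists>m. m \<in> S" using True by (simp add: S_def)
  have aS: "a \<in> S" unfolding a_def using ex by (rule LeastI_ex)
  have sub: "S \<subseteq> {a..<a + 4}"
  proof
    fix m assume m: "m \<in> S"
    have am: "a \<le> m" unfolding a_def using m by (rule Least_le)
    have "delta a \<le> 12 * delta m" using aS m by (simp add: S_def)
    then have "2 ^ m \<le> (12 :: real) * 2 ^ a" by (simp add: delta_def field_simps)
    also have "(2 :: real) ^ m = 2 ^ (m - a) * 2 ^ a" using am by (simp flip: power_add)
    finally have "(2 :: real) ^ (m - a) < 2 ^ 4" by simp
    then have "m - a < 4" by (rule power_less_imp_less_exp[rotated]) simp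
    then show "m \<in> {a..<a + 4}" using am by simp
  qed
  have "(\<Sum>m. indicator {x. delta m / 4 \<le> x \<and> x \<le> 3 * delta m} x :: ennreal) = (\<Sum>m. indicator S m)"
    by (simp add: S_def indicator_def)
  also have "\<dots> = (\<Sum>m\<in>{a..<a + 4}. indicator S m)"
    using sub by (intro suminf_finite) (auto simp: indicator_def subset_iff)
  also have "\<dots> \<le> (\<Sum>m\<in>{a..<a + 4}. 1)"
    by (intro sum_mono) (simp add: indicator_def)
  finally show ?thesis by simp
qed

lemma bergman_int_mono: "A \<inter> ball 0 1 \<subseteq> B \<Longrightarrow> bergman_int \<alpha> p f A \<le> bergman_int \<alpha> p f B"
  unfolding bergman_int_def by (intro nn_integral_mono) (auto simp: indicator_def)

definition dyadic_annulus :: "nat \<Rightarrow> (complex ^ 'n) set"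
  where "dyadic_annulus m = {w. delta m / 4 \<le> 1 - (norm w)\<^sup>2 \<and> 1 - (norm w)\<^sup>2 \<le> 3 * delta m}"

lemma dyadic_annulus_borel: "dyadic_annulus m \<in> sets borel"
  unfolding dyadic_annulus_def by measurable

lemma sum_dyadic_annulus:
  assumes f: "holomorphic_vec f (ball 0 1)" and p: "0 < p"
  shows "(\<Sum>m. bergman_int \<alpha> p f (dyadic_annulus m)) \<le> 4 * bergman_int \<alpha> p f UNIV"
proof -
  let ?g = "\<lambda>w. ennreal (norm (f w) powr p * weight \<alpha> w)"
  have "(\<Sum>m. bergman_int \<alpha> p f (dyadic_annulus m))
    = (\<integral>\<^sup>+w. (\<Sum>m. ?g w * indicator (dyadic_annulus m \<inter> ball 0 1) w) \<partial>lborel)"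
    unfolding bergman_int_def
    by (intro nn_integral_suminf[symmetric])
      (simp add: bergman_int_measurable[OF f p] dyadic_annulus_borel)
  also have "\<dots> \<le> (\<integral>\<^sup>+w. 4 * (?g w * indicator (UNIV \<inter> ball 0 1) w) \<partial>lborel)"
  proof (rule nn_integral_mono)
    fix w :: "complex ^ 'a"
    show "(\<Sum>m. ?g w * indicator (dyadic_annulus m \<inter> ball 0 1) w) \<le> 4 * (?g w * indicator (UNIV \<inter> ball 0 1) w)"
    proof (cases "norm w < 1")
      case True
      then have x: "0 < 1 - (norm w)\<^sup>2" by (simp add: abs_square_less_1)
      have "(\<Sum>m. ?g w * indicator (dyadic_annulus m \<inter> ball 0 1) w)
        = ?g w * (\<Sum>m. indicator {x. delta m / 4 \<le> x \<and> x \<le> 3 * delta m} (1 - (norm w)\<^sup>2))"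
        using True by (subst ennreal_suminf_cmult[symmetric]) (simp add: indicator_def dyadic_annulus_def)
      also have "\<dots> \<le> ?g w * 4" by (intro mult_left_mono dyadic_overlap x) simp
      finally show ?thesis using True by (simp add: mult.commute)
    qed simp
  qed
  also have "\<dots> = 4 * bergman_int \<alpha> p f UNIV"
    unfolding bergman_int_def by (rule nn_integral_cmult) (use bergman_int_measurable[OF f p, of UNIV \<alpha>] in simp)
  finally show ?thesis .
qed

lemma bergman_dyadic:
  assumes \<alpha>: "-1 < \<alpha>" and p: "0 < p"
  shows "\<exists>C>0. \<forall>f \<in> bergman_space p \<alpha> :: (complex ^ 'n \<Rightarrow> complex) set.
    \<exists>\<phi>. (\<forall>m. 0 \<le> \<phi> m) \<and> summable (\<lambda>m. \<phi> m powr p) \<and> (\<Sum>m. \<phi> m powr p) \<le> bergman_norm p \<alpha> f powr p \<and>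
      (\<forall>m z. delta (Suc m) < 1 - norm z \<and> 1 - norm z \<le> delta m \<longrightarrow>
         norm (f z) \<le> C * delta m powr - ((real CARD('n) + 1 + \<alpha>) / p) * \<phi> m)"
proof -
  define d where "d = real CARD('n) + 1 + \<alpha>"
  have d: "0 < d" using \<alpha> by (simp add: d_def)
  obtain C0 where C0: "0 < C0" "\<And>(f :: complex ^ 'n \<Rightarrow> complex) z. holomorphic_vec f (ball 0 1) \<Longrightarrow> norm z < 1 \<Longrightarrow>
    ennreal (norm (f z) powr p)
      \<le> ennreal (C0 * (1 - norm z) powr - d) * bergman_int \<alpha> p f (annulus (1 - norm z))"
    using bergman_pointwise[OF p, where 'n='n and \<alpha>=\<alpha>] unfolding d_def by blast
  define K where "K = vol_const TYPE('n) \<alpha>"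
  have K: "0 < K" using vol_const_pos[OF \<alpha>] by (simp add: K_def)
  define C1 where "C1 = C0 * 2 powr d * 4 / K"
  have C1: "0 < C1" using C0 K by (simp add: C1_def)
  show ?thesis
  proof (intro exI[of _ "C1 powr (1 / p)"] conjI ballI)
    fix f :: "complex ^ 'n \<Rightarrow> complex" assume fA: "f \<in> bergman_space p \<alpha>"
    then have f: "holomorphic_vec f (ball 0 1)" by (simp add: bergman_space_def)
    define N where "N = bergman_norm p \<alpha> f"
    have N: "ennreal (N powr p) = ennreal K * bergman_int \<alpha> p f UNIV"
      using bergman_norm_powr[OF \<alpha> p fA] by (simp add: N_def K_def)
    have fin: "bergman_int \<alpha> p f UNIV < \<infinity>"
    proof (rule ccontr)
      assume "\<not> ?thesis"
      then have "bergman_int \<alpha> p f UNIV = top" by (simp add: not_less top_unique)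
      then show False using N K by (simp add: ennreal_mult_top)
    qed
    define F where "F m = enn2real (bergman_int \<alpha> p f (dyadic_annulus m))" for m
    have F: "bergman_int \<alpha> p f (dyadic_annulus m) = ennreal (F m)" "0 \<le> F m" for m
    proof -
      have "bergman_int \<alpha> p f (dyadic_annulus m) < \<infinity>"
        using bergman_int_mono[of "dyadic_annulus m" UNIV \<alpha> p f] fin by (simp add: le_less_trans)
      then show "bergman_int \<alpha> p f (dyadic_annulus m) = ennreal (F m)" "0 \<le> F m"
        by (simp_all add: F_def)
    qed
    define \<phi> where "\<phi> m = (K / 4 * F m) powr (1 / p)" for m
    have \<phi>0: "0 \<le> \<phi> m" for m by (simp add: \<phi>_def)
    have \<phi>p: "\<phi> m powr p = K / 4 * F m" for m
      using p K F(2) by (simp add: \<phi>_def powr_powr)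
    have "(\<Sum>m. ennreal (\<phi> m powr p)) = ennreal (K / 4) * (\<Sum>m. ennreal (F m))"
    proof -
      have "(\<Sum>m. ennreal (\<phi> m powr p)) = (\<Sum>m. ennreal (K / 4) * ennreal (F m))"
        using K F(2) unfolding \<phi>p by (subst ennreal_mult) auto
      then show ?thesis by (simp only: ennreal_suminf_cmult)
    qed
    also have "\<dots> \<le> ennreal (K / 4) * (4 * bergman_int \<alpha> p f UNIV)"
      using sum_dyadic_annulus[OF f p, of \<alpha>] unfolding F(1) by (intro mult_left_mono) auto
    also have "\<dots> = ennreal (N powr p)"
    proof -
      have "ennreal (K / 4) * 4 = ennreal K" using K by (simp add: ennreal_mult[symmetric] flip: ennreal_numeral)
      then show ?thesis unfolding N by (simp add: mult.assoc[symmetric])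
    qed
    finally have le: "(\<Sum>m. ennreal (\<phi> m powr p)) \<le> ennreal (N powr p)" .
    then have sm: "summable (\<lambda>m. \<phi> m powr p)"
      by (intro summable_suminf_not_top) (auto simp: top_unique)
    have "ennreal (\<Sum>m. \<phi> m powr p) \<le> ennreal (N powr p)"
      using le sm by (simp add: suminf_ennreal2)
    then have le': "(\<Sum>m. \<phi> m powr p) \<le> N powr p" by simp
    have pt: "norm (f z) \<le> C1 powr (1 / p) * delta m powr - (d / p) * \<phi> m"
      if z: "delta (Suc m) < 1 - norm z" "1 - norm z \<le> delta m" for m z
    proof -
      have z1: "norm z < 1" using z(1) delta_pos[of "Suc m"] by linarith
      have sub: "annulus (1 - norm z) \<inter> ball 0 1 \<subseteq> dyadic_annulus m"
        using z by (auto simp: annulus_def dyadic_annulus_def delta_Suc)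
      have "ennreal (norm (f z) powr p) \<le> ennreal (C0 * (1 - norm z) powr - d) * bergman_int \<alpha> p f (annulus (1 - norm z))"
        by (rule C0(2)[OF f z1])
      also have "\<dots> \<le> ennreal (C0 * (delta m / 2) powr - d) * bergman_int \<alpha> p f (dyadic_annulus m)"
        using z d C0(1) delta_pos[of m]
        by (intro mult_mono ennreal_leI bergman_int_mono sub mult_left_mono powr_mono2') (auto simp: delta_Suc)
      also have "\<dots> = ennreal (C0 * (delta m / 2) powr - d * F m)"
        using C0(1) F by (simp add: ennreal_mult)
      finally have "norm (f z) powr p \<le> C0 * (delta m / 2) powr - d * F m"
        using C0(1) F by simp
      also have "\<dots> = C1 * delta m powr - d * \<phi> m powr p"
        using K delta_pos[of m] by (simp add: \<phi>p C1_def powr_divide powr_minus field_simps)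
      finally have "(norm (f z) powr p) powr (1 / p) \<le> (C1 * delta m powr - d * \<phi> m powr p) powr (1 / p)"
        using p by (intro powr_mono2) auto
      also have "\<dots> = C1 powr (1 / p) * delta m powr - (d / p) * \<phi> m"
        using p C1 \<phi>0 by (simp add: powr_mult powr_powr)
      finally show ?thesis using p by (simp add: powr_powr)
    qed
    show "\<exists>\<phi>. (\<forall>m. 0 \<le> \<phi> m) \<and> summable (\<lambda>m. \<phi> m powr p) \<and> (\<Sum>m. \<phi> m powr p) \<le> bergman_norm p \<alpha> f powr p \<and>
      (\<forall>m z. delta (Suc m) < 1 - norm z \<and> 1 - norm z \<le> delta m \<longrightarrow>
         norm (f z) \<le> C1 powr (1 / p) * delta m powr - ((real CARD('n) + 1 + \<alpha>) / p) * \<phi> m)"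
      using sm le' pt unfolding d_def N_def by (intro exI[of _ \<phi>]) (auto simp: \<phi>_def)
  qed (use C1 in simp)
qed

abbreviation (input) unit_borel :: "real measure \<Rightarrow> bool"
  where "unit_borel \<mu> \<equiv> sets \<mu> = sets (restrict_space borel {0..<1})"

abbreviation (input) cesaro_abs ::
    "real measure \<Rightarrow> real \<Rightarrow> complex ^ 'n \<Rightarrow> (complex ^ 'n \<Rightarrow> complex) \<Rightarrow> complex ^ 'n \<Rightarrow> ennreal"
  where "cesaro_abs \<mu> \<beta> \<xi> f z \<equiv> \<integral>\<^sup>+t. ennreal (norm (cesaro_integrand \<beta> \<xi> f z t)) \<partial>\<mu>"

abbreviation (input) bergman_bounded :: "real measure \<Rightarrow> real \<Rightarrow> complex ^ 'n \<Rightarrow> real \<Rightarrow> real \<Rightarrow> bool"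
  where "bergman_bounded \<mu> \<beta> \<xi> p \<alpha> \<equiv>
    cesaro_bounded \<mu> \<beta> \<xi> (bergman_space p \<alpha>) (bergman_norm p \<alpha>) H_infty H_infty_norm"

abbreviation (input) tail_ratio :: "real measure \<Rightarrow> real \<Rightarrow> nat \<Rightarrow> real"
  where "tail_ratio \<mu> g m \<equiv> enn2real (tail \<mu> (radius m)) / delta m powr g"

lemma norm_cesaro_integrand:
  "norm (cesaro_integrand \<beta> \<xi> f z t) = norm (f (t *\<^sub>R z)) / norm (1 - of_real t * hinner z \<xi>) powr \<beta>"
  by (simp add: cesaro_integrand_def norm_divide norm_powr_real_powr')

lemma cesaro_kernel_lower:
  assumes "norm \<xi> = 1" "0 \<le> t"
  shows "1 - t * norm z \<le> norm (1 - of_real t * hinner z \<xi>)"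
proof -
  have "1 - norm (of_real t * hinner z \<xi>) \<le> norm (1 - of_real t * hinner z \<xi>)"
    using norm_triangle_ineq2[of 1 "of_real t * hinner z \<xi>"] by simp
  moreover have "norm (of_real t * hinner z \<xi>) \<le> t * norm z"
    using cmod_hinner_le[of z \<xi>] assms by (simp add: norm_mult mult_left_mono)
  ultimately show ?thesis by linarith
qed

lemma space_eq_unit:
  assumes "unit_borel \<mu>"
  shows "space \<mu> = {0..<1}"
  using sets_eq_imp_space_eq[OF assms] by (simp add: space_restrict_space)

lemma tail_sets:
  assumes "unit_borel \<mu>" "0 \<le> r"
  shows "{r..<1} \<in> sets \<mu>"
  unfolding assms(1) using assms(2) by (auto simp: sets_restrict_space_iff)

lemma ennreal_le_suminf: "f m \<le> (\<Sum>m. f m :: ennreal)"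
  using sum_le_suminf[OF summableI, of "{m}" f] by simp

lemma cesaro_dyadic:
  fixes \<xi> :: "complex ^ 'n"
  assumes \<alpha>: "-1 < \<alpha>" and p: "0 < p" and \<beta>: "0 < \<beta>" and \<xi>: "norm \<xi> = 1"
    and \<mu>: "unit_borel \<mu>"
  shows "\<exists>C>0. \<forall>f \<in> bergman_space p \<alpha>. \<exists>\<phi>. (\<forall>m. 0 \<le> \<phi> m) \<and> summable (\<lambda>m. \<phi> m powr p) \<and> (\<Sum>m. \<phi> m powr p) \<le> bergman_norm p \<alpha> f powr p \<and>
      (\<forall>z\<in>ball 0 1. cesaro_abs \<mu> \<beta> \<xi> f z
        \<le> (\<Sum>m. ennreal (C * delta m powr - (\<beta> + (real CARD('n) + 1 + \<alpha>) / p) * \<phi> m) * tail \<mu> (radius m)))"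
proof -
  let ?s = "(real CARD('n) + 1 + \<alpha>) / p"
  obtain C0 where C0: "0 < C0" "\<forall>f \<in> bergman_space p \<alpha> :: (complex ^ 'n \<Rightarrow> complex) set.
    \<exists>\<phi>. (\<forall>m. 0 \<le> \<phi> m) \<and> summable (\<lambda>m. \<phi> m powr p) \<and> (\<Sum>m. \<phi> m powr p) \<le> bergman_norm p \<alpha> f powr p \<and>
      (\<forall>m z. delta (Suc m) < 1 - norm z \<and> 1 - norm z \<le> delta m \<longrightarrow>
         norm (f z) \<le> C0 * delta m powr - ?s * \<phi> m)"
    using bergman_dyadic[OF \<alpha> p, where 'n='n] by (elim exE conjE) (rule that)
  define C where "C = C0 * 2 powr \<beta>"
  have C: "0 < C" using C0(1) by (simp add: C_def)
  show ?thesis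
  proof (intro exI[of _ C] conjI ballI)
    fix f :: "complex ^ 'n \<Rightarrow> complex" assume f: "f \<in> bergman_space p \<alpha>"
    obtain \<phi> where \<phi>: "\<And>m. 0 \<le> \<phi> m" "summable (\<lambda>m. \<phi> m powr p)" "(\<Sum>m. \<phi> m powr p) \<le> bergman_norm p \<alpha> f powr p"
      and pt: "\<And>m z. delta (Suc m) < 1 - norm z \<Longrightarrow> 1 - norm z \<le> delta m \<Longrightarrow> norm (f z) \<le> C0 * delta m powr - ?s * \<phi> m"
      using bspec[OF C0(2) f] by (elim exE conjE) blast
    have "cesaro_abs \<mu> \<beta> \<xi> f z
        \<le> (\<Sum>m. ennreal (C * delta m powr - (\<beta> + ?s) * \<phi> m) * tail \<mu> (radius m))"
      if z: "z \<in> ball 0 1" for z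
    proof -
      have "cesaro_abs \<mu> \<beta> \<xi> f z
        \<le> (\<integral>\<^sup>+t. (\<Sum>m. ennreal (C * delta m powr - (\<beta> + ?s) * \<phi> m) * indicator {radius m..<1} t) \<partial>\<mu>)"
      proof (rule nn_integral_mono)
        fix t assume "t \<in> space \<mu>"
        then have t: "0 \<le> t" "t < 1" by (auto simp: space_eq_unit[OF \<mu>])
        define x where "x = 1 - t * norm z"
        have tz: "t * norm z \<le> t" "0 \<le> t * norm z" using t z by (auto simp: mult_left_le)
        then have x: "0 < x" "x \<le> 1" "1 - t \<le> x" using t by (auto simp: x_def)
        obtain m where m: "delta (Suc m) < x" "x \<le> delta m" using dyadic_exists[OF x(1,2)] by blast
        have "norm (f (t *\<^sub>R z)) \<le> C0 * delta m powr - ?s * \<phi> m"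
          using m t by (intro pt) (auto simp: x_def)
        moreover have "delta m powr \<beta> / 2 powr \<beta> \<le> norm (1 - of_real t * hinner z \<xi>) powr \<beta>"
        proof -
          have "delta m / 2 \<le> norm (1 - of_real t * hinner z \<xi>)"
            using cesaro_kernel_lower[OF \<xi> t(1), of z] m by (simp add: x_def delta_Suc)
          then have "(delta m / 2) powr \<beta> \<le> norm (1 - of_real t * hinner z \<xi>) powr \<beta>"
            using \<beta> delta_pos[of m] by (intro powr_mono2) auto
          then show ?thesis using delta_pos[of m] by (simp add: powr_divide)
        qed
        ultimately have "norm (cesaro_integrand \<beta> \<xi> f z t) \<le> (C0 * delta m powr - ?s * \<phi> m) / (delta m powr \<beta> / 2 powr \<beta>)"
          unfolding norm_cesaro_integrand using delta_pos[of m] C0(1) \<phi>(1)[of m] by (intro frac_le) auto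
        also have "\<dots> = C * delta m powr - (\<beta> + ?s) * \<phi> m"
        proof -
          have "delta m powr - (\<beta> + ?s) = delta m powr - ?s / delta m powr \<beta>"
            unfolding powr_diff[symmetric] by (rule arg_cong[where f="(powr) (delta m)"]) simp
          then show ?thesis by (simp add: C_def)
        qed
        finally have le: "norm (cesaro_integrand \<beta> \<xi> f z t) \<le> C * delta m powr - (\<beta> + ?s) * \<phi> m" .
        have "t \<in> {radius m..<1}" using x m t by (auto simp: radius_eq)
        then have "ennreal (norm (cesaro_integrand \<beta> \<xi> f z t)) \<le> ennreal (C * delta m powr - (\<beta> + ?s) * \<phi> m) * indicator {radius m..<1} t"
          using le by (simp add: ennreal_leI)
        also have "\<dots> \<le> (\<Sum>m. ennreal (C * delta m powr - (\<beta> + ?s) * \<phi> m) * indicator {radius m..<1} t)"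
          by (rule ennreal_le_suminf)
        finally show "ennreal (norm (cesaro_integrand \<beta> \<xi> f z t)) \<le> (\<Sum>m. ennreal (C * delta m powr - (\<beta> + ?s) * \<phi> m) * indicator {radius m..<1} t)" .
      qed
      also have "\<dots> = (\<Sum>m. \<integral>\<^sup>+t. ennreal (C * delta m powr - (\<beta> + ?s) * \<phi> m) * indicator {radius m..<1} t \<partial>\<mu>)"
      proof (intro nn_integral_suminf)
        fix m
        have [measurable]: "{radius m..<1} \<in> sets \<mu>" by (rule tail_sets[OF \<mu> radius_nonneg])
        show "(\<lambda>t. ennreal (C * delta m powr - (\<beta> + ?s) * \<phi> m) * indicator {radius m..<1} t) \<in> borel_measurable \<mu>"
          by measurable
      qed
      also have "\<dots> = (\<Sum>m. ennreal (C * delta m powr - (\<beta> + ?s) * \<phi> m) * tail \<mu> (radius m))"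
        unfolding tail_def
        by (simp only: nn_integral_cmult_indicator[OF tail_sets[OF \<mu> radius_nonneg]])
      finally show ?thesis .
    qed
    then show "\<exists>\<phi>. (\<forall>m. 0 \<le> \<phi> m) \<and> summable (\<lambda>m. \<phi> m powr p) \<and> (\<Sum>m. \<phi> m powr p) \<le> bergman_norm p \<alpha> f powr p \<and>
      (\<forall>z\<in>ball 0 1. cesaro_abs \<mu> \<beta> \<xi> f z
        \<le> (\<Sum>m. ennreal (C * delta m powr - (\<beta> + (real CARD('n) + 1 + \<alpha>) / p) * \<phi> m) * tail \<mu> (radius m)))"
      using \<phi> by (intro exI[of _ \<phi>]) blast
  qed (rule C)
qed

section \<open>Holomorphic dependence of integrals on parameters\<close>

lemma holomorphic_second_order:
  assumes f: "f holomorphic_on ball 0 R" and R: "2 < R" and M: "\<And>c. c \<in> ball 0 R \<Longrightarrow> norm (f c) \<le> M"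
  shows "norm (f 1 - f 0 - deriv f 0) \<le> 8 * M / R\<^sup>2"
proof -
  have B: "norm ((deriv ^^ 2) f c) \<le> 8 * M / R\<^sup>2" if c: "c \<in> cball 0 1" for c
  proof -
    have sub: "cball c (R / 2) \<subseteq> ball 0 R"
    proof
      fix x assume "x \<in> cball c (R / 2)"
      then have "norm x \<le> norm c + R / 2"
        using norm_triangle_ineq2[of x c] by (simp add: dist_norm norm_minus_commute)
      then show "x \<in> ball 0 R" using c R by simp
    qed
    have "norm ((deriv ^^ 2) f c) \<le> fact 2 * M / (R / 2) ^ 2"
    proof (rule Cauchy_inequality)
      show "f holomorphic_on ball c (R / 2)"
        by (rule holomorphic_on_subset[OF f]) (use sub in auto)
      show "continuous_on (cball c (R / 2)) f"
        by (rule continuous_on_subset[OF holomorphic_on_imp_continuous_on[OF f] sub])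
      show "norm (f x) \<le> M" if "norm (c - x) = R / 2" for x
        using that sub by (intro M) (auto simp: dist_norm)
    qed (use R in simp)
    also have "fact 2 * M / (R / 2) ^ 2 = 8 * M / R\<^sup>2" by (simp add: power_divide fact_numeral)
    finally show ?thesis .
  qed
  have "norm ((deriv ^^ 0) f 1 - (\<Sum>i\<le>1. (deriv ^^ i) f 0 * (1 - 0) ^ i / fact i)) \<le> 8 * M / R\<^sup>2 * norm (1 - 0 :: complex) ^ Suc 1 / fact 1"
  proof (rule complex_Taylor)
    show "convex (cball 0 1 :: complex set)" by simp
    fix i :: nat and x :: complex assume "x \<in> cball 0 1"
    then have "x \<in> ball 0 R" using R by simp
    then show "((deriv ^^ i) f has_field_derivative (deriv ^^ Suc i) f x) (at x within cball 0 1)"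
      using holomorphic_derivI[OF holomorphic_higher_deriv[OF f open_ball] open_ball, of x i]
      by simp
  next
    show "norm ((deriv ^^ Suc 1) f x) \<le> 8 * M / R\<^sup>2" if "x \<in> cball 0 1" for x
      using B[OF that] by (simp add: numeral_2_eq_2)
  qed auto
  then show ?thesis by (simp add: diff_diff_eq)
qed

lemma holomorphic_vec_second_order:
  assumes h: "holomorphic_vec h (ball z e)" and M: "\<And>w. w \<in> ball z e \<Longrightarrow> norm (h w) \<le> M"
    and D: "(h has_derivative D) (at z)" "\<And>c v. D (c *s v) = c * D v" and v: "norm v < e / 2"
  shows "norm (h (z + v) - h z - D v) \<le> 8 * M / e\<^sup>2 * (norm v)\<^sup>2"
proof (cases "v = 0")
  case True
  then show ?thesis using D(2)[of 0 v] by simp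
next
  case False
  have e: "0 < e" using v norm_ge_zero[of v] by linarith
  define R where "R = e / norm v"
  have R: "2 < R" using v False by (simp add: R_def field_simps)
  have sub: "z + c *s v \<in> ball z e" if "c \<in> ball 0 R" for c
    using that False by (simp add: dist_norm norm_scaleC_vec R_def field_simps)
  let ?f = "\<lambda>c. h (z + c *s v)"
  have "norm (?f 1 - ?f 0 - deriv ?f 0) \<le> 8 * M / R\<^sup>2"
  proof (rule holomorphic_second_order[OF _ R])
    show "?f holomorphic_on ball 0 R"
      by (rule holomorphic_on_line[OF h open_ball sub])
  qed (use M sub in blast)
  moreover have "deriv ?f 0 = D v"
    by (rule DERIV_imp_deriv, rule holomorphic_vec_line) (use D in auto)
  ultimately show ?thesis by (simp add: R_def power_divide)
qed

lemma holomorphic_vec_integral: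
  fixes h :: "complex ^ 'n \<Rightarrow> 'a \<Rightarrow> complex"
  assumes \<mu>: "finite_measure \<mu>"
    and hol: "\<And>t. t \<in> space \<mu> \<Longrightarrow> holomorphic_vec (\<lambda>z. h z t) S"
    and meas: "\<And>z. z \<in> S \<Longrightarrow> h z \<in> borel_measurable \<mu>"
    and bdd: "\<And>z. z \<in> S \<Longrightarrow> \<exists>e>0. \<exists>M. ball z e \<subseteq> S \<and> (\<forall>w\<in>ball z e. \<forall>t\<in>space \<mu>. norm (h w t) \<le> M)"
  shows "holomorphic_vec (\<lambda>z. LINT t|\<mu>. h z t) S"
  unfolding holomorphic_vec_def
proof
  interpret finite_measure \<mu> by (rule \<mu>)
  fix z assume z: "z \<in> S"
  obtain e M where e: "0 < e" "ball z e \<subseteq> S" and M: "\<And>w t. w \<in> ball z e \<Longrightarrow> t \<in> space \<mu> \<Longrightarrow> norm (h w t) \<le> M"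
    using bdd[OF z] by blast
  have "\<exists>D. \<forall>t\<in>space \<mu>. ((\<lambda>z. h z t) has_derivative D t) (at z) \<and> (\<forall>c v. D t (c *s v) = c * D t v)"
    using hol z unfolding holomorphic_vec_def by (intro bchoice) blast
  then obtain D where D: "\<And>t. t \<in> space \<mu> \<Longrightarrow> ((\<lambda>z. h z t) has_derivative D t) (at z)"
      "\<And>t c v. t \<in> space \<mu> \<Longrightarrow> D t (c *s v) = c * D t v"
    by blast
  have Dlin: "D t (u + v) = D t u + D t v" "D t (r *\<^sub>R v) = r *\<^sub>R D t v" if "t \<in> space \<mu>" for t u v r
    using has_derivative_bounded_linear[OF D(1)[OF that]]
    by (auto simp: linear_simps)
  define K where "K = 8 * M / e\<^sup>2"
  have rem: "norm (h (z + v) t - h z t - D t v) \<le> K * (norm v)\<^sup>2" if "norm v < e / 2" "t \<in> space \<mu>" for v t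
    unfolding K_def
    by (rule holomorphic_vec_second_order[OF holomorphic_vec_subset[OF hol[OF that(2)] e(2)] M D that(1)])
      (use that in auto)
  have inball: "z + v \<in> ball z e" if "norm v < e / 2" for v
    using that e by (simp add: dist_norm)
  have small: "norm (D t v) \<le> 2 * M + K * (norm v)\<^sup>2" if "norm v < e / 2" "t \<in> space \<mu>" for v t
  proof -
    have "norm (D t v) \<le> norm (h (z + v) t) + norm (h z t) + norm (h (z + v) t - h z t - D t v)"
      using norm_triangle_ineq4[of "h (z + v) t - h z t" "h (z + v) t - h z t - D t v"]
        norm_triangle_ineq4[of "h (z + v) t" "h z t"] by simp
    then show ?thesis using rem[OF that] M[OF inball[OF that(1)] that(2)] M[of z t] e that(2) by simp
  qed
  have Dmeas: "(\<lambda>t. D t v) \<in> borel_measurable \<mu>" for v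
  proof -
    obtain k0 :: nat where k0: "norm v / (e / 2) < real k0"
      using reals_Archimedean2 by blast
    define r where "r k = real (Suc (k0 + k))" for k
    have r: "0 < r k" "norm (v /\<^sub>R r k) < e / 2" for k
    proof -
      show r0: "0 < r k" by (simp add: r_def)
      have "norm v / (e / 2) < r k" using k0 by (simp add: r_def)
      then show "norm (v /\<^sub>R r k) < e / 2" using r0 e by (simp add: field_simps)
    qed
    have rinf: "(\<lambda>k. inverse (r k)) \<longlonglongrightarrow> 0"
      unfolding r_def using LIMSEQ_ignore_initial_segment[OF LIMSEQ_inverse_real_of_nat, of k0] by (simp add: add.commute)
    show ?thesis
    proof (rule borel_measurable_LIMSEQ_metric)
      show "(\<lambda>t. r k *\<^sub>R (h (z + v /\<^sub>R r k) t - h z t)) \<in> borel_measurable \<mu>" for k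
        using meas[OF z] meas[OF subsetD[OF e(2) inball[OF r(2)[of k]]]] by (intro borel_measurable_scaleR borel_measurable_diff) auto
      fix t assume t: "t \<in> space \<mu>"
      have bnd: "norm (r k *\<^sub>R (h (z + v /\<^sub>R r k) t - h z t) - D t v) \<le> K * (norm v)\<^sup>2 * inverse (r k)" for k
      proof -
        have "r k *\<^sub>R (h (z + v /\<^sub>R r k) t - h z t) - D t v = r k *\<^sub>R (h (z + v /\<^sub>R r k) t - h z t - D t (v /\<^sub>R r k))"
          using r(1)[of k] by (simp add: Dlin[OF t] scaleR_diff_right)
        also have "norm \<dots> \<le> r k * (K * (norm (v /\<^sub>R r k))\<^sup>2)"
          using mult_left_mono[OF rem[OF r(2) t], of "r k" k] r(1)[of k] by simp
        also have "\<dots> = K * (norm v)\<^sup>2 * inverse (r k)"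
          using r(1)[of k] by (simp add: power_mult_distrib power2_eq_square field_simps)
        finally show ?thesis .
      qed
      have lim: "(\<lambda>k. K * (norm v)\<^sup>2 * inverse (r k)) \<longlonglongrightarrow> 0"
        using tendsto_mult_right_zero[OF rinf] by blast
      have "(\<lambda>k. r k *\<^sub>R (h (z + v /\<^sub>R r k) t - h z t) - D t v) \<longlonglongrightarrow> 0"
        by (rule Lim_null_comparison[OF always_eventually[OF allI[OF bnd]] lim])
      then show "(\<lambda>k. r k *\<^sub>R (h (z + v /\<^sub>R r k) t - h z t)) \<longlonglongrightarrow> D t v"
        by (simp add: LIM_zero_iff)
    qed
  qed
  have hint: "integrable \<mu> (h w)" if "w \<in> ball z e" for w
    using that e meas M by (intro integrable_const_bound[where B=M]) auto
  have Dint: "integrable \<mu> (\<lambda>t. D t v)" for v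
  proof -
    obtain r where r: "0 < r" "norm (r *\<^sub>R v) < e / 2"
    proof
      show "0 < e / 4 / (norm v + 1)" using e by (simp add: add_nonneg_pos)
      have "norm v / (norm v + 1) \<le> 1" by (simp add: divide_le_eq_1 add_nonneg_pos)
      then have "e / 4 * (norm v / (norm v + 1)) \<le> e / 4 * 1" using e by (intro mult_left_mono) auto
      also have "e / 4 * 1 < e / 2" using e by simp
      also have "e / 4 * (norm v / (norm v + 1)) = norm ((e / 4 / (norm v + 1)) *\<^sub>R v)"
        using e by (simp add: abs_of_pos add_nonneg_pos)
      finally show "norm ((e / 4 / (norm v + 1)) *\<^sub>R v) < e / 2" .
    qed
    have "integrable \<mu> (\<lambda>t. D t (r *\<^sub>R v))"
      using small[OF r(2)] Dmeas by (intro integrable_const_bound[where B="2 * M + K * (norm (r *\<^sub>R v))\<^sup>2"]) auto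
    then have "integrable \<mu> (\<lambda>t. (1 / r) *\<^sub>R D t (r *\<^sub>R v))" by (rule integrable_scaleR_right)
    then show ?thesis
      by (rule Bochner_Integration.integrable_cong[THEN iffD1, rotated 2]) (use r in \<open>auto simp: Dlin\<close>)
  qed
  define L where "L v = (LINT t|\<mu>. D t v)" for v
  have L1: "L (u + v) = L u + L v" for u v
  proof -
    have "L (u + v) = (LINT t|\<mu>. D t u + D t v)"
      unfolding L_def by (rule Bochner_Integration.integral_cong) (simp_all add: Dlin)
    then show ?thesis using Dint by (simp add: L_def)
  qed
  have L2: "L (c *s v) = c * L v" for c v
  proof -
    have "L (c *s v) = (LINT t|\<mu>. c * D t v)"
      unfolding L_def by (rule Bochner_Integration.integral_cong) (simp_all add: D(2))
    then show ?thesis by (simp add: L_def)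
  qed
  have "linear L"
    by (rule linearI) (simp_all add: L1 scaleR_eq_scaleC_vec L2 scaleR_conv_of_real)
  then have Lb: "bounded_linear L" by (simp add: linear_conv_bounded_linear)
  define K' where "K' = K * measure \<mu> (space \<mu>)"
  have "((\<lambda>z. LINT t|\<mu>. h z t) has_derivative L) (at z)"
  proof (rule has_derivativeI_sandwich[where e="e / 2" and H="\<lambda>y. K' * norm (y - z)"])
    fix y assume y: "y \<noteq> z" "dist y z < e / 2"
    have n: "norm (y - z) < e / 2" using y by (simp add: dist_norm)
    have zy: "y \<in> ball z e" "z \<in> ball z e" using y e by (auto simp: dist_commute)
    have "(LINT t|\<mu>. h y t) - (LINT t|\<mu>. h z t) - L (y - z) = (LINT t|\<mu>. h y t - h z t - D t (y - z))"
      using hint[OF zy(1)] hint[OF zy(2)] Dint by (simp add: L_def)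
    also have "norm \<dots> \<le> (LINT t|\<mu>. K * (norm (y - z))\<^sup>2)"
      using hint[OF zy(1)] hint[OF zy(2)] Dint[of "y - z"] rem[OF n]
      by (intro order_trans[OF integral_norm_bound] integral_mono) auto
    also have "\<dots> = K' * norm (y - z) * norm (y - z)" by (simp add: K'_def power2_eq_square)
    finally show "norm ((LINT t|\<mu>. h y t) - (LINT t|\<mu>. h z t) - L (y - z)) / norm (y - z) \<le> K' * norm (y - z)"
      using y by (simp add: divide_le_eq)
  next
    have "((\<lambda>y. K' * norm (y - z)) \<longlongrightarrow> K' * norm (z - z)) (at z)"
      by (intro tendsto_intros)
    then show "((\<lambda>y. K' * norm (y - z)) \<longlongrightarrow> 0) (at z)" by simp
  qed (use e Lb in auto)
  then show "\<exists>f'. ((\<lambda>z. LINT t|\<mu>. h z t) has_derivative f') (at z) \<and> (\<forall>c v. f' (c *s v) = c * f' v)"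
    using L2 by blast
qed

lemma holomorphic_vec_mult:
  assumes "holomorphic_vec f S" "holomorphic_vec g S"
  shows "holomorphic_vec (\<lambda>z. f z * g z) S"
  unfolding holomorphic_vec_def
proof
  fix z assume "z \<in> S"
  with assms obtain f' g' where f': "(f has_derivative f') (at z)" "\<And>c v. f' (c *s v) = c * f' v"
    and g': "(g has_derivative g') (at z)" "\<And>c v. g' (c *s v) = c * g' v"
    unfolding holomorphic_vec_def by metis
  show "\<exists>h. ((\<lambda>z. f z * g z) has_derivative h) (at z) \<and> (\<forall>c v. h (c *s v) = c * h v)"
    by (intro exI conjI, rule has_derivative_mult[OF f'(1) g'(1)]) (simp add: f' g' algebra_simps)
qed

lemma holomorphic_vec_add:
  assumes "holomorphic_vec f S" "holomorphic_vec g S"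
  shows "holomorphic_vec (\<lambda>z. f z + g z) S"
  unfolding holomorphic_vec_def
proof
  fix z assume "z \<in> S"
  with assms obtain f' g' where f': "(f has_derivative f') (at z)" "\<And>c v. f' (c *s v) = c * f' v"
    and g': "(g has_derivative g') (at z)" "\<And>c v. g' (c *s v) = c * g' v"
    unfolding holomorphic_vec_def by metis
  show "\<exists>h. ((\<lambda>z. f z + g z) has_derivative h) (at z) \<and> (\<forall>c v. h (c *s v) = c * h v)"
    by (intro exI conjI, rule has_derivative_add[OF f'(1) g'(1)]) (simp add: f' g' algebra_simps)
qed

lemma holomorphic_vec_const: "holomorphic_vec (\<lambda>z. c) S"
  unfolding holomorphic_vec_def by (auto intro!: exI[of _ "\<lambda>v. 0"])

lemma holomorphic_vec_sum:
  "(\<And>i. i \<in> I \<Longrightarrow> holomorphic_vec (f i) S) \<Longrightarrow> holomorphic_vec (\<lambda>z. \<Sum>i\<in>I. f i z) S"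
  by (induction I rule: infinite_finite_induct) (auto intro: holomorphic_vec_add holomorphic_vec_const)

lemma holomorphic_vec_kernel:
  fixes \<xi> :: "complex ^ 'n"
  assumes g: "g holomorphic_on {u. 0 < Re u}" and \<xi>: "norm \<xi> = 1" and t: "0 \<le> t" "t \<le> 1"
  shows "holomorphic_vec (\<lambda>z. g (1 - of_real t * hinner z \<xi>)) (ball 0 1)"
  unfolding holomorphic_vec_def
proof
  fix z :: "complex ^ 'n" assume z: "z \<in> ball 0 1"
  define a where "a z = 1 - of_real t * hinner z \<xi>" for z
  have "linear (\<lambda>v. - of_real t * hinner v \<xi>)"
    by (rule linearI) (simp_all add: hinner_add_left hinner_scaleR_left scaleR_conv_of_real[where x="a::complex" for a] ring_distribs mult_ac)
  then have "((\<lambda>v. - of_real t * hinner v \<xi>) has_derivative (\<lambda>v. - of_real t * hinner v \<xi>)) (at z)"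
    by (intro bounded_linear_imp_has_derivative) (simp add: linear_conv_bounded_linear)
  then have "((\<lambda>z. 1 + (- of_real t * hinner z \<xi>)) has_derivative (\<lambda>v. - of_real t * hinner v \<xi>)) (at z)"
    using has_derivative_add[OF has_derivative_const] by fastforce
  then have a: "(a has_derivative (\<lambda>v. - of_real t * hinner v \<xi>)) (at z)"
    by (simp add: a_def[abs_def])
  have "Re (of_real t * hinner z \<xi>) \<le> norm (of_real t * hinner z \<xi>)" by (rule complex_Re_le_cmod)
  also have "\<dots> \<le> 1 * norm z"
    unfolding norm_mult using cmod_hinner_le[of z \<xi>] \<xi> t by (intro mult_mono) auto
  finally have Re: "0 < Re (a z)" using z by (simp add: a_def)
  have "open {u. 0 < Re u}" by (simp add: open_halfspace_Re_gt)
  from holomorphic_derivI[OF g this, of "a z"] Re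
  have "(g has_derivative (*) (deriv g (a z))) (at (a z))"
    by (simp add: has_field_derivative_def)
  from has_derivative_compose[OF a this]
  show "\<exists>f'. ((\<lambda>z. g (1 - of_real t * hinner z \<xi>)) has_derivative f') (at z) \<and> (\<forall>c v. f' (c *s v) = c * f' v)"
    unfolding a_def by (intro exI conjI, assumption) (simp add: hinner_scaleC_left)
qed

lemma inverse_powr_holomorphic:
  "(\<lambda>u. 1 / u powr of_real b) holomorphic_on {u. 0 < Re u}"
  by (intro holomorphic_intros) (auto simp: complex_nonpos_Reals_iff)

lemma holomorphic_vec_cesaro_integrand:
  fixes \<xi> :: "complex ^ 'n"
  assumes f: "holomorphic_vec f (ball 0 1)" and \<xi>: "norm \<xi> = 1" and t: "0 \<le> t" "t < 1"
  shows "holomorphic_vec (\<lambda>z. cesaro_integrand \<beta> \<xi> f z t) (ball 0 1)"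
proof -
  have "holomorphic_vec (\<lambda>z. f (0 + t *\<^sub>R z)) (ball 0 1)"
  proof (rule holomorphic_vec_affine[OF f])
    show "0 + t *\<^sub>R x \<in> ball 0 1" if "x \<in> ball 0 1" for x :: "complex ^ 'n"
      using that t mult_left_le_one_le[of "norm x" t] by simp
  qed (simp_all add: linear_iff scaleR_add_right vec_eq_iff)
  from holomorphic_vec_mult[OF this holomorphic_vec_kernel[OF inverse_powr_holomorphic \<xi>, of t \<beta>]] t
  show ?thesis by (simp add: cesaro_integrand_def)
qed

lemma cesaro_integrand_measurable:
  fixes \<xi> :: "complex ^ 'n"
  assumes f: "holomorphic_vec f (ball 0 1)" and \<xi>: "norm \<xi> = 1" and z: "norm z < 1"
    and \<mu>: "unit_borel \<mu>"
  shows "cesaro_integrand \<beta> \<xi> f z \<in> borel_measurable \<mu>"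
proof -
  have Re: "0 < Re (1 - of_real t * hinner z \<xi>)" if "t \<in> {0..<1}" for t
  proof -
    have "Re (of_real t * hinner z \<xi>) \<le> norm (of_real t * hinner z \<xi>)" by (rule complex_Re_le_cmod)
    also have "\<dots> \<le> 1 * norm z"
      unfolding norm_mult using cmod_hinner_le[of z \<xi>] \<xi> that by (intro mult_mono) auto
    finally show ?thesis using z by simp
  qed
  have "continuous_on {0..<1} (cesaro_integrand \<beta> \<xi> f z)"
    unfolding cesaro_integrand_def[abs_def]
  proof (intro continuous_on_divide)
    show "continuous_on {0..<1} (\<lambda>t. f (t *\<^sub>R z))"
    proof (rule continuous_on_compose2[OF holomorphic_vec_continuous_on[OF f]])
      show "(\<lambda>t. t *\<^sub>R z) ` {0..<1} \<subseteq> ball 0 1"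
        using z by (auto intro!: le_less_trans[OF mult_left_le_one_le[OF norm_ge_zero]])
    qed (intro continuous_intros)
    show "continuous_on {0..<1} (\<lambda>t. (1 - of_real t * hinner z \<xi>) powr of_real \<beta>)"
    proof (intro continuous_on_powr_complex continuous_intros)
      show "{0..<1} \<subseteq> {t. 0 \<le> Re (1 - of_real t * hinner z \<xi>) \<or> Im (1 - of_real t * hinner z \<xi>) \<noteq> 0}"
        by (intro subsetI CollectI disjI1 less_imp_le Re)
      show "0 < Re (complex_of_real \<beta>)" if "t \<in> {0..<1}" "1 - of_real t * hinner z \<xi> = 0" for t
        using Re[OF that(1)] unfolding that(2) by simp
    qed
    show "\<forall>t\<in>{0..<1}. (1 - of_real t * hinner z \<xi>) powr of_real \<beta> \<noteq> 0"
      using Re by fastforce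
  qed
  then have "cesaro_integrand \<beta> \<xi> f z \<in> borel_measurable (restrict_space borel {0..<1})"
    by (rule borel_measurable_continuous_on_restrict)
  then show ?thesis using measurable_cong_sets[OF \<mu> refl] by blast
qed

lemma cesaro_holomorphic:
  fixes \<xi> :: "complex ^ 'n"
  assumes fin: "finite_measure \<mu>" and \<mu>: "unit_borel \<mu>"
    and f: "holomorphic_vec f (ball 0 1)" and \<xi>: "norm \<xi> = 1" and \<beta>: "0 < \<beta>"
  shows "holomorphic_vec (cesaro \<mu> \<beta> \<xi> f) (ball 0 1)"
  unfolding cesaro_def[abs_def]
proof (rule holomorphic_vec_integral[OF fin])
  show "holomorphic_vec (\<lambda>z. cesaro_integrand \<beta> \<xi> f z t) (ball 0 1)" if "t \<in> space \<mu>" for t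
    using that by (intro holomorphic_vec_cesaro_integrand f \<xi>) (auto simp: space_eq_unit[OF \<mu>])
  show "cesaro_integrand \<beta> \<xi> f z \<in> borel_measurable \<mu>" if "z \<in> ball 0 1" for z
    using that by (intro cesaro_integrand_measurable f \<xi> \<mu>) auto
  fix z :: "complex ^ 'n" assume z: "z \<in> ball 0 1"
  define e where "e = (1 - norm z) / 2"
  define r where "r = 1 - e"
  have e: "0 < e" "r < 1" using z by (auto simp: e_def r_def)
  have sub: "norm w \<le> r" if "w \<in> ball z e" for w
    using that norm_triangle_ineq2[of w z] by (simp add: dist_norm norm_minus_commute r_def e_def field_simps)
  have "continuous_on (cball 0 r) f"
    using e by (intro continuous_on_subset[OF holomorphic_vec_continuous_on[OF f]]) auto
  then have "bounded (f ` cball 0 r)"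
    by (intro compact_imp_bounded compact_continuous_image) auto
  then obtain M where "\<forall>w\<in>cball 0 r. norm (f w) \<le> M"
    by (auto simp: bounded_iff)
  then have M: "norm (f w) \<le> M" if "norm w \<le> r" for w
    using that by auto
  have "norm (cesaro_integrand \<beta> \<xi> f w t) \<le> M / e powr \<beta>" if w: "w \<in> ball z e" and t: "t \<in> space \<mu>" for w t
  proof -
    have t: "0 \<le> t" "t < 1" using t by (auto simp: space_eq_unit[OF \<mu>])
    have tw: "t * norm w \<le> norm w" using t by (simp add: mult_left_le_one_le)
    have fM: "norm (f (t *\<^sub>R w)) \<le> M" using tw sub[OF w] t by (intro M) auto
    have "0 \<le> M" by (rule order_trans[OF norm_ge_zero fM])
    moreover have "e \<le> norm (1 - of_real t * hinner w \<xi>)"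
      using cesaro_kernel_lower[OF \<xi> t(1), of w] tw sub[OF w] by (simp add: r_def)
    then have "e powr \<beta> \<le> norm (1 - of_real t * hinner w \<xi>) powr \<beta>"
      using e \<beta> by (intro powr_mono2) auto
    ultimately show ?thesis
      unfolding norm_cesaro_integrand using e fM by (intro frac_le) auto
  qed
  moreover have "ball z e \<subseteq> ball 0 1" using sub e by force
  ultimately show "\<exists>e>0. \<exists>M. ball z e \<subseteq> ball 0 1 \<and> (\<forall>w\<in>ball z e. \<forall>t\<in>space \<mu>. norm (cesaro_integrand \<beta> \<xi> f w t) \<le> M)"
    using e by blast
qed

lemma cesaro_H_infty:
  fixes \<xi> :: "complex ^ 'n"
  assumes fin: "finite_measure \<mu>" and \<mu>: "unit_borel \<mu>"
    and f: "holomorphic_vec f (ball 0 1)" and \<xi>: "norm \<xi> = 1" and \<beta>: "0 < \<beta>"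
    and B: "\<And>z. z \<in> ball 0 1 \<Longrightarrow> cesaro_abs \<mu> \<beta> \<xi> f z \<le> ennreal B" and B0: "0 \<le> B"
  shows "(\<forall>z\<in>ball 0 1. integrable \<mu> (cesaro_integrand \<beta> \<xi> f z)) \<and> cesaro \<mu> \<beta> \<xi> f \<in> H_infty
    \<and> H_infty_norm (cesaro \<mu> \<beta> \<xi> f) \<le> B"
proof -
  have int: "integrable \<mu> (cesaro_integrand \<beta> \<xi> f z)" if "z \<in> ball 0 1" for z
    using that cesaro_integrand_measurable[OF f \<xi> _ \<mu>, of z \<beta>] B[OF that]
    by (intro integrableI_bounded) (auto simp: le_less_trans[OF _ ennreal_less_top])
  have le: "norm (cesaro \<mu> \<beta> \<xi> f z) \<le> B" if "z \<in> ball 0 1" for z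
  proof -
    have "ennreal (norm (cesaro \<mu> \<beta> \<xi> f z)) \<le> cesaro_abs \<mu> \<beta> \<xi> f z"
      unfolding cesaro_def by (rule integral_norm_bound_ennreal[OF int[OF that]])
    also have "\<dots> \<le> ennreal B" by (rule B[OF that])
    finally show ?thesis using B0 by simp
  qed
  then have "bounded (cesaro \<mu> \<beta> \<xi> f ` ball 0 1)" by (auto intro!: boundedI simp del: mem_ball)
  moreover have "H_infty_norm (cesaro \<mu> \<beta> \<xi> f) \<le> B"
    unfolding H_infty_norm_def using le by (intro cSUP_least) auto
  ultimately show ?thesis
    using int cesaro_holomorphic[OF fin \<mu> f \<xi> \<beta>] by (simp add: H_infty_def)
qed

section \<open>Sufficiency\<close>

lemma sum_le_of_powr_sum:
  fixes p N :: real
  assumes p: "0 < p" "p \<le> 1" and N: "0 \<le> N" and \<phi>: "\<And>m. 0 \<le> \<phi> m"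
    and s: "summable (\<lambda>m. \<phi> m powr p)" and le: "(\<Sum>m. \<phi> m powr p) \<le> N powr p"
  shows "summable \<phi> \<and> (\<Sum>m. \<phi> m) \<le> N"
proof -
  have "\<phi> m powr p \<le> N powr p" for m
    using sum_le_suminf[OF s, of "{m}"] le by simp
  then have "(\<phi> m powr p) powr (1 / p) \<le> (N powr p) powr (1 / p)" for m
    using p by (intro powr_mono2[where a="1 / p"]) simp_all
  then have \<phi>N: "\<phi> m \<le> N" for m using p \<phi> N by (simp add: powr_powr)
  have a: "\<phi> m \<le> N powr (1 - p) * \<phi> m powr p" for m
    by (rule le_powr_product[OF \<phi> \<phi>N p])
  have s2: "summable (\<lambda>m. N powr (1 - p) * \<phi> m powr p)" using s by (rule summable_mult)
  have s1: "summable \<phi>"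
    by (rule summable_comparison_test'[OF s2, of 0]) (use a \<phi> in auto)
  have "(\<Sum>m. \<phi> m) \<le> (\<Sum>m. N powr (1 - p) * \<phi> m powr p)"
    by (rule suminf_le[OF a s1 s2])
  also have "\<dots> = N powr (1 - p) * (\<Sum>m. \<phi> m powr p)" by (rule suminf_mult[OF s])
  also have "\<dots> \<le> N powr (1 - p) * N powr p" by (intro mult_left_mono le) simp
  also have "\<dots> = N" using N by (cases "N = 0") (simp_all flip: powr_add)
  finally show ?thesis using s1 by simp
qed

lemma sum_mult_le_of_powr_sum:
  fixes p q N :: real
  assumes p: "1 < p" "1 / p + 1 / q = 1" and N: "0 \<le> N" and \<phi>: "\<And>m. 0 \<le> \<phi> m" and a: "\<And>m. 0 \<le> a m"
    and s: "summable (\<lambda>m. \<phi> m powr p)" and le: "(\<Sum>m. \<phi> m powr p) \<le> N powr p"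
    and sa: "summable (\<lambda>m. a m powr q)"
  shows "summable (\<lambda>m. a m * \<phi> m) \<and> (\<Sum>m. a m * \<phi> m) \<le> ((\<Sum>m. a m powr q) + 1) * N"
proof (cases "N = 0")
  case True
  have "\<phi> m powr p \<le> 0" for m
    using order_trans[OF sum_le_suminf[OF s, of "{m}"] le] True by simp
  then have "\<phi> m = 0" for m using powr_ge_zero[of "\<phi> m" p] by (metis antisym powr_eq_0_iff)
  then show ?thesis using True by simp
next
  case False
  have q: "1 < q"
  proof -
    have "0 < 1 / p" "1 / p < 1" using p(1) by auto
    then have "0 < 1 / q" "1 / q < 1" using p(2) by linarith+
    then show ?thesis by (simp add: divide_less_eq split: if_splits)
  qed
  have N0: "0 < N" using N False by simp
  have y: "a m * \<phi> m \<le> N * (a m powr q + \<phi> m powr p / N powr p)" for m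
  proof -
    have "\<phi> m / N * a m \<le> (\<phi> m / N) powr p / p + a m powr q / q"
      using p q \<phi> a N0 by (intro Youngs_inequality) auto
    also have "\<dots> \<le> (\<phi> m / N) powr p + a m powr q"
    proof (rule add_mono)
      show "(\<phi> m / N) powr p / p \<le> (\<phi> m / N) powr p" using p by (simp add: divide_le_eq mult_le_cancel_left1)
      show "a m powr q / q \<le> a m powr q" using q by (simp add: divide_le_eq mult_le_cancel_left1)
    qed
    finally have "N * (\<phi> m / N * a m) \<le> N * ((\<phi> m / N) powr p + a m powr q)"
      using N0 by (intro mult_left_mono) auto
    then show ?thesis using N0 \<phi> by (simp add: powr_divide mult_ac add_ac)
  qed
  have s2: "summable (\<lambda>m. N * (a m powr q + \<phi> m powr p / N powr p))"
    by (intro summable_mult summable_add sa summable_divide s)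
  have s1: "summable (\<lambda>m. a m * \<phi> m)"
    by (rule summable_comparison_test'[OF s2, of 0]) (use y \<phi> a in auto)
  have "(\<Sum>m. a m * \<phi> m) \<le> (\<Sum>m. N * (a m powr q + \<phi> m powr p / N powr p))"
    by (rule suminf_le[OF y s1 s2])
  also have "\<dots> = N * ((\<Sum>m. a m powr q) + (\<Sum>m. \<phi> m powr p) / N powr p)"
    using sa s by (simp add: suminf_mult suminf_add[symmetric] suminf_divide summable_add summable_divide)
  also have "\<dots> \<le> N * ((\<Sum>m. a m powr q) + 1)"
    using N0 le by (intro mult_left_mono add_left_mono) (auto simp: divide_le_eq_1)
  finally show ?thesis using s1 by (simp add: mult.commute)
qed

lemma cesaro_bounded_of_dyadic:
  fixes \<xi> :: "complex ^ 'n"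
  assumes \<alpha>: "-1 < \<alpha>" and p: "0 < p" and \<beta>: "0 < \<beta>" and \<xi>: "norm \<xi> = 1"
    and \<mu>: "unit_borel \<mu>" and fin: "finite_measure \<mu>"
    and g: "g = \<beta> + (real CARD('n) + 1 + \<alpha>) / p"
    and B0: "0 \<le> B" and B: "\<And>\<phi> N. (\<And>m. 0 \<le> \<phi> m) \<Longrightarrow> 0 \<le> N \<Longrightarrow> summable (\<lambda>m. \<phi> m powr p) \<Longrightarrow> (\<Sum>m. \<phi> m powr p) \<le> N powr p \<Longrightarrow>
       summable (\<lambda>m. tail_ratio \<mu> g m * \<phi> m) \<and>
       (\<Sum>m. tail_ratio \<mu> g m * \<phi> m) \<le> B * N"
  shows "bergman_bounded \<mu> \<beta> \<xi> p \<alpha>"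
proof -
  interpret finite_measure \<mu> by (rule fin)
  define a where "a m = tail_ratio \<mu> g m" for m
  have "\<exists>C>0. \<forall>f \<in> bergman_space p \<alpha>. \<exists>\<phi>. (\<forall>m. 0 \<le> \<phi> m) \<and> summable (\<lambda>m. \<phi> m powr p) \<and> (\<Sum>m. \<phi> m powr p) \<le> bergman_norm p \<alpha> f powr p \<and>
      (\<forall>z\<in>ball 0 1. cesaro_abs \<mu> \<beta> \<xi> f z
        \<le> (\<Sum>m. ennreal (C * delta m powr - g * \<phi> m) * tail \<mu> (radius m)))"
    using cesaro_dyadic[OF \<alpha> p \<beta> \<xi> \<mu>] unfolding g .
  then obtain C where C: "0 < C" "\<forall>f \<in> bergman_space p \<alpha>. \<exists>\<phi>. (\<forall>m. 0 \<le> \<phi> m) \<and> summable (\<lambda>m. \<phi> m powr p) \<and> (\<Sum>m. \<phi> m powr p) \<le> bergman_norm p \<alpha> f powr p \<and>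
      (\<forall>z\<in>ball 0 1. cesaro_abs \<mu> \<beta> \<xi> f z
        \<le> (\<Sum>m. ennreal (C * delta m powr - g * \<phi> m) * tail \<mu> (radius m)))"
    by (elim exE conjE) (rule that)
  have main: "(\<forall>z\<in>ball 0 1. integrable \<mu> (cesaro_integrand \<beta> \<xi> f z)) \<and> cesaro \<mu> \<beta> \<xi> f \<in> H_infty
    \<and> H_infty_norm (cesaro \<mu> \<beta> \<xi> f) \<le> C * B * bergman_norm p \<alpha> f" if f: "f \<in> bergman_space p \<alpha>" for f
  proof (rule cesaro_H_infty[OF fin \<mu> _ \<xi> \<beta>])
    show "holomorphic_vec f (ball 0 1)" using f by (simp add: bergman_space_def)
    show "0 \<le> C * B * bergman_norm p \<alpha> f" using C B0 bergman_norm_nonneg[of p \<alpha> f] by simp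
    fix z :: "complex ^ 'n" assume z: "z \<in> ball 0 1"
    obtain \<phi> where \<phi>: "\<And>m. 0 \<le> \<phi> m" "summable (\<lambda>m. \<phi> m powr p)" "(\<Sum>m. \<phi> m powr p) \<le> bergman_norm p \<alpha> f powr p"
      and le: "\<And>z. z \<in> ball 0 1 \<Longrightarrow> cesaro_abs \<mu> \<beta> \<xi> f z
        \<le> (\<Sum>m. ennreal (C * delta m powr - g * \<phi> m) * tail \<mu> (radius m))"
      using bspec[OF C(2) f] by (elim exE conjE) blast
    have sB: "summable (\<lambda>m. a m * \<phi> m)" "(\<Sum>m. a m * \<phi> m) \<le> B * bergman_norm p \<alpha> f"
      using B[OF \<phi>(1) bergman_norm_nonneg \<phi>(2,3)] unfolding a_def by auto
    have a0: "0 \<le> a m" for m by (simp add: a_def)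
    have t: "tail \<mu> (radius m) = ennreal (enn2real (tail \<mu> (radius m)))" for m
      by (simp add: tail_def emeasure_eq_measure)
    have "cesaro_abs \<mu> \<beta> \<xi> f z
        \<le> (\<Sum>m. ennreal (C * delta m powr - g * \<phi> m) * tail \<mu> (radius m))" by (rule le[OF z])
    also have "\<dots> = (\<Sum>m. ennreal (C * (a m * \<phi> m)))"
    proof (rule suminf_cong)
      fix m
      have "ennreal (C * delta m powr - g * \<phi> m) * tail \<mu> (radius m)
        = ennreal (C * delta m powr - g * \<phi> m * enn2real (tail \<mu> (radius m)))"
        using C(1) \<phi>(1)[of m] by (subst t) (simp add: ennreal_mult)
      then show "ennreal (C * delta m powr - g * \<phi> m) * tail \<mu> (radius m) = ennreal (C * (a m * \<phi> m))"
        by (simp add: a_def powr_minus field_simps)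
    qed
    also have "\<dots> = ennreal (C * (\<Sum>m. a m * \<phi> m))"
      using C(1) a0 \<phi>(1) sB(1) by (subst suminf_ennreal2) (auto simp: suminf_mult intro!: summable_mult mult_nonneg_nonneg)
    also have "\<dots> \<le> ennreal (C * B * bergman_norm p \<alpha> f)"
      using sB(2) C(1) by (simp add: mult.assoc ennreal_leI)
    finally show "cesaro_abs \<mu> \<beta> \<xi> f z \<le> ennreal (C * B * bergman_norm p \<alpha> f)" .
  qed
  then show ?thesis unfolding cesaro_bounded_def by blast
qed

lemma finite_measure_of_tail_0:
  assumes "unit_borel \<mu>" "tail \<mu> 0 < \<infinity>"
  shows "finite_measure \<mu>"
  using assms(2) by (intro finite_measureI) (simp add: tail_def space_eq_unit[OF assms(1)])

lemma cesaro_bounded_suff_le_1: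
  fixes \<xi> :: "complex ^ 'n"
  assumes \<alpha>: "-1 < \<alpha>" and p: "0 < p" "p \<le> 1" and \<beta>: "0 < \<beta>" and \<xi>: "norm \<xi> = 1"
    and \<mu>: "unit_borel \<mu>"
    and S: "(SUP r\<in>{0..<1}. tail \<mu> r / ennreal ((1 - r) powr (\<beta> + (real CARD('n) + 1 + \<alpha>) / p))) < \<infinity>"
  shows "bergman_bounded \<mu> \<beta> \<xi> p \<alpha>"
proof -
  let ?g = "\<beta> + (real CARD('n) + 1 + \<alpha>) / p"
  obtain s where s: "0 \<le> s" "(SUP r\<in>{0..<1}. tail \<mu> r / ennreal ((1 - r) powr ?g)) = ennreal s"
    using S by (cases "SUP r\<in>{0..<1}. tail \<mu> r / ennreal ((1 - r) powr ?g)") auto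
  have le: "tail \<mu> r \<le> ennreal (s * (1 - r) powr ?g)" if r: "0 \<le> r" "r < 1" for r
  proof -
    have "tail \<mu> r / ennreal ((1 - r) powr ?g) \<le> ennreal s"
      unfolding s(2)[symmetric] using r by (intro SUP_upper) auto
    then have "tail \<mu> r / ennreal ((1 - r) powr ?g) * ennreal ((1 - r) powr ?g) \<le> ennreal s * ennreal ((1 - r) powr ?g)"
      by (rule mult_right_mono) simp
    also have "tail \<mu> r / ennreal ((1 - r) powr ?g) * ennreal ((1 - r) powr ?g) = tail \<mu> r"
      using r by (intro ennreal_divide_times[THEN trans]) (simp add: ennreal_times_divide mult_divide_eq_ennreal)
    also have "ennreal s * ennreal ((1 - r) powr ?g) = ennreal (s * (1 - r) powr ?g)"
      using s(1) by (simp add: ennreal_mult)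
    finally show ?thesis .
  qed
  have fin: "finite_measure \<mu>"
    using le[of 0] by (intro finite_measure_of_tail_0[OF \<mu>]) (simp add: le_less_trans)
  have a: "tail_ratio \<mu> ?g m \<le> s" for m
  proof -
    have "tail \<mu> (radius m) \<le> ennreal (s * delta m powr ?g)"
      using le[of "radius m"] delta_pos[of m] radius_nonneg[of m] by (simp add: radius_eq)
    then have "enn2real (tail \<mu> (radius m)) \<le> s * delta m powr ?g"
      using s(1) by (simp add: enn2real_leI)
    then show ?thesis using delta_pos[of m] by (simp add: divide_le_eq)
  qed
  show ?thesis
  proof (rule cesaro_bounded_of_dyadic[OF \<alpha> p(1) \<beta> \<xi> \<mu> fin refl s(1)])
    fix \<phi> :: "nat \<Rightarrow> real" and N :: real
    assume \<phi>: "\<And>m. 0 \<le> \<phi> m" and N: "0 \<le> N" "summable (\<lambda>m. \<phi> m powr p)" "(\<Sum>m. \<phi> m powr p) \<le> N powr p"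
    have 1: "summable \<phi>" "(\<Sum>m. \<phi> m) \<le> N"
      using sum_le_of_powr_sum[OF p N(1) \<phi> N(2,3)] by auto
    have 2: "tail_ratio \<mu> ?g m * \<phi> m \<le> s * \<phi> m" for m
      by (intro mult_right_mono a \<phi>)
    have s2: "summable (\<lambda>m. s * \<phi> m)" using 1(1) by (rule summable_mult)
    have s1: "summable (\<lambda>m. tail_ratio \<mu> ?g m * \<phi> m)"
      by (rule summable_comparison_test'[OF s2, of 0]) (use 2 \<phi> in auto)
    have "(\<Sum>m. tail_ratio \<mu> ?g m * \<phi> m) \<le> (\<Sum>m. s * \<phi> m)"
      by (rule suminf_le[OF 2 s1 s2])
    also have "\<dots> \<le> s * N" using 1 s(1) by (simp add: suminf_mult mult_left_mono)
    finally show "summable (\<lambda>m. tail_ratio \<mu> ?g m * \<phi> m) \<and>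
      (\<Sum>m. tail_ratio \<mu> ?g m * \<phi> m) \<le> s * N" using s1 by simp
  qed
qed

lemma cesaro_bounded_suff_gt_1:
  fixes \<xi> :: "complex ^ 'n"
  assumes \<alpha>: "-1 < \<alpha>" and p: "1 < p" "1 / p + 1 / p' = 1" and \<beta>: "0 < \<beta>" and \<xi>: "norm \<xi> = 1"
    and \<mu>: "unit_borel \<mu>" and fin: "finite_measure \<mu>"
    and S: "(\<lambda>k. tail_ratio \<mu> (\<beta> + (real CARD('n) + 1 + \<alpha>) / p) (Suc k)) \<in> ell_p p'"
  shows "bergman_bounded \<mu> \<beta> \<xi> p \<alpha>"
proof -
  let ?g = "\<beta> + (real CARD('n) + 1 + \<alpha>) / p"
  let ?a = "\<lambda>m. tail_ratio \<mu> ?g m"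
  have "summable (\<lambda>m. ?a (Suc m) powr p')" using S by (simp add: ell_p_def)
  then have s: "summable (\<lambda>m. ?a m powr p')" by (subst (asm) summable_Suc_iff)
  show ?thesis
  proof (rule cesaro_bounded_of_dyadic[OF \<alpha> _ \<beta> \<xi> \<mu> fin refl])
    show "0 \<le> (\<Sum>m. ?a m powr p') + 1" using suminf_nonneg[OF s] by simp
    fix \<phi> :: "nat \<Rightarrow> real" and N :: real
    assume \<phi>: "\<And>m. 0 \<le> \<phi> m" and N: "0 \<le> N" "summable (\<lambda>m. \<phi> m powr p)" "(\<Sum>m. \<phi> m powr p) \<le> N powr p"
    show "summable (\<lambda>m. ?a m * \<phi> m) \<and> (\<Sum>m. ?a m * \<phi> m) \<le> ((\<Sum>m. ?a m powr p') + 1) * N"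
      by (rule sum_mult_le_of_powr_sum[OF p N(1) \<phi> _ N(2,3) s]) simp
  qed (use p in simp)
qed

lemma H_infty_norm_upper:
  assumes "f \<in> H_infty" "z \<in> ball 0 1"
  shows "norm (f z) \<le> H_infty_norm f"
proof -
  have "bdd_above ((\<lambda>z. norm (f z)) ` ball 0 1)"
    using assms unfolding H_infty_def bounded_iff bdd_above_def by auto
  then show ?thesis unfolding H_infty_norm_def by (intro cSUP_upper assms(2))
qed

lemma cesaro_bounded_H_infty_suff:
  fixes \<xi> :: "complex ^ 'n"
  assumes \<beta>: "0 < \<beta>" and \<xi>: "norm \<xi> = 1"
    and \<mu>: "unit_borel \<mu>"
    and I: "(\<integral>\<^sup>+ t. ennreal (1 / (1 - t) powr \<beta>) \<partial>\<mu>) < \<infinity>"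
  shows "cesaro_bounded \<mu> \<beta> \<xi> H_infty H_infty_norm H_infty H_infty_norm"
proof -
  obtain i where i: "0 \<le> i" "(\<integral>\<^sup>+ t. ennreal (1 / (1 - t) powr \<beta>) \<partial>\<mu>) = ennreal i"
    using I by (cases "\<integral>\<^sup>+ t. ennreal (1 / (1 - t) powr \<beta>) \<partial>\<mu>") auto
  have "emeasure \<mu> (space \<mu>) = (\<integral>\<^sup>+ t. 1 \<partial>\<mu>)" by simp
  also have "\<dots> \<le> (\<integral>\<^sup>+ t. ennreal (1 / (1 - t) powr \<beta>) \<partial>\<mu>)"
  proof (rule nn_integral_mono)
    fix t assume "t \<in> space \<mu>"
    then have t: "0 \<le> t" "t < 1" by (auto simp: space_eq_unit[OF \<mu>])
    then have "(1 - t) powr \<beta> \<le> 1" using \<beta> by (intro powr_le1) auto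
    then have "1 \<le> 1 / (1 - t) powr \<beta>" using t by (simp add: le_divide_eq)
    then show "1 \<le> ennreal (1 / (1 - t) powr \<beta>)" by (simp add: ennreal_ge_1)
  qed
  finally have fin: "finite_measure \<mu>" using I by (intro finite_measureI) auto
  have main: "(\<forall>z\<in>ball 0 1. integrable \<mu> (cesaro_integrand \<beta> \<xi> f z)) \<and> cesaro \<mu> \<beta> \<xi> f \<in> H_infty
    \<and> H_infty_norm (cesaro \<mu> \<beta> \<xi> f) \<le> i * H_infty_norm f" if f: "f \<in> H_infty" for f :: "complex ^ 'n \<Rightarrow> complex"
  proof -
    have fN: "norm (f z) \<le> H_infty_norm f" if "z \<in> ball 0 1" for z
      by (rule H_infty_norm_upper[OF f that])
    have N: "0 \<le> H_infty_norm f" by (rule order_trans[OF norm_ge_zero fN[of 0]]) simp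
    show ?thesis
    proof (rule cesaro_H_infty[OF fin \<mu> _ \<xi> \<beta>])
      show "holomorphic_vec f (ball 0 1)" using f by (simp add: H_infty_def)
      show "0 \<le> i * H_infty_norm f" using i N by simp
      fix z :: "complex ^ 'n" assume z: "z \<in> ball 0 1"
      have "cesaro_abs \<mu> \<beta> \<xi> f z \<le> (\<integral>\<^sup>+t. ennreal (H_infty_norm f) * ennreal (1 / (1 - t) powr \<beta>) \<partial>\<mu>)"
      proof (rule nn_integral_mono)
        fix t assume "t \<in> space \<mu>"
        then have t: "0 \<le> t" "t < 1" by (auto simp: space_eq_unit[OF \<mu>])
        have tz: "t * norm z \<le> t" using t z by (simp add: mult_left_le)
        then have "norm (f (t *\<^sub>R z)) \<le> H_infty_norm f" using t by (intro fN) simp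
        moreover have "(1 - t) powr \<beta> \<le> norm (1 - of_real t * hinner z \<xi>) powr \<beta>"
          using cesaro_kernel_lower[OF \<xi> t(1), of z] tz t \<beta> by (intro powr_mono2) auto
        ultimately have "norm (cesaro_integrand \<beta> \<xi> f z t) \<le> H_infty_norm f / (1 - t) powr \<beta>"
          unfolding norm_cesaro_integrand using N t by (intro frac_le) auto
        then show "ennreal (norm (cesaro_integrand \<beta> \<xi> f z t)) \<le> ennreal (H_infty_norm f) * ennreal (1 / (1 - t) powr \<beta>)"
          using N by (simp add: ennreal_mult[symmetric] ennreal_leI)
      qed
      also have "\<dots> = ennreal (H_infty_norm f) * ennreal i"
      proof -
        have "(\<lambda>t. ennreal (1 / (1 - t) powr \<beta>)) \<in> borel_measurable (restrict_space borel {0..<1})"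
          by (rule measurable_restrict_space1) measurable
        then have "(\<lambda>t. ennreal (1 / (1 - t) powr \<beta>)) \<in> borel_measurable \<mu>"
          using measurable_cong_sets[OF \<mu> refl] by blast
        then show ?thesis by (simp only: nn_integral_cmult i)
      qed
      finally show "cesaro_abs \<mu> \<beta> \<xi> f z \<le> ennreal (i * H_infty_norm f)"
        using N i by (simp add: ennreal_mult mult.commute)
    qed
  qed
  then show ?thesis unfolding cesaro_bounded_def by blast
qed

section \<open>Volumes of cones and of nonisotropic balls\<close>

definition cone_set :: "'a::real_vector set \<Rightarrow> bool"
  where "cone_set Q \<longleftrightarrow> (\<forall>x c. 0 < c \<longrightarrow> (c *\<^sub>R x \<in> Q \<longleftrightarrow> x \<in> Q))"

lemma nn_integral_lborel_scale:
  fixes H :: "'a::euclidean_space \<Rightarrow> ennreal"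
  assumes c: "0 < c" and [measurable]: "H \<in> borel_measurable borel"
  shows "(\<integral>\<^sup>+x. H x \<partial>lborel) = ennreal (c ^ DIM('a)) * (\<integral>\<^sup>+x. H (c *\<^sub>R x) \<partial>lborel)"
proof -
  have "(\<integral>\<^sup>+x. H x \<partial>lborel) = (\<integral>\<^sup>+x. H x \<partial>density (distr lborel borel (\<lambda>x. 0 + c *\<^sub>R x)) (\<lambda>_. ennreal (\<bar>c\<bar> ^ DIM('a))))"
    by (subst lborel_affine[of c "0::'a"]) (use c in simp_all)
  also have "\<dots> = ennreal (c ^ DIM('a)) * (\<integral>\<^sup>+x. H (c *\<^sub>R x) \<partial>lborel)"
    using c by (simp add: nn_integral_density nn_integral_cmult nn_integral_distr)
  finally show ?thesis .
qed

lemma emeasure_cone_ball: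
  fixes Q :: "'a::euclidean_space set"
  assumes Q: "cone_set Q" and [measurable]: "Q \<in> sets borel" and r: "0 < r"
  shows "emeasure lborel (Q \<inter> ball 0 r) = ennreal (r ^ DIM('a)) * emeasure lborel (Q \<inter> ball 0 1)"
proof -
  have [measurable]: "ball 0 r \<in> sets (borel :: 'a measure)" "ball 0 1 \<in> sets (borel :: 'a measure)" by simp_all
  have eq: "r *\<^sub>R x \<in> Q \<inter> ball 0 r \<longleftrightarrow> x \<in> Q \<inter> ball 0 1" for x
    using Q r unfolding cone_set_def by (auto simp: mult_less_cancel_left1)
  have "emeasure lborel (Q \<inter> ball 0 r) = (\<integral>\<^sup>+x. indicator (Q \<inter> ball 0 r) x \<partial>lborel)"
    by simp
  also have "\<dots> = ennreal (r ^ DIM('a)) * (\<integral>\<^sup>+x. indicator (Q \<inter> ball 0 r) (r *\<^sub>R x) \<partial>lborel)"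
    by (rule nn_integral_lborel_scale[OF r]) measurable
  also have "(\<integral>\<^sup>+x. indicator (Q \<inter> ball 0 r) (r *\<^sub>R x) \<partial>lborel) = (\<integral>\<^sup>+x. indicator (Q \<inter> ball 0 1) x \<partial>(lborel :: 'a measure))"
    by (intro nn_integral_cong) (simp add: indicator_def eq del: Int_iff)
  finally show ?thesis by simp
qed

lemma measure_cone_ball:
  fixes Q :: "'a::euclidean_space set"
  assumes Q: "cone_set Q" "Q \<in> sets borel" and r: "0 \<le> r"
  shows "measure lborel (Q \<inter> ball 0 r) = r ^ DIM('a) * measure lborel (Q \<inter> ball 0 1)"
proof (cases "r = 0")
  case False
  then show ?thesis using emeasure_cone_ball[OF Q, of r] r
    by (simp add: measure_def enn2real_mult)
qed simp

lemma lmeasurable_cone_ball: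
  fixes Q :: "'a::euclidean_space set"
  assumes "Q \<in> sets borel"
  shows "Q \<inter> ball 0 r \<in> fmeasurable lborel"
proof (rule fmeasurableI2)
  show "ball 0 r \<in> fmeasurable (lborel :: 'a measure)"
    by (rule fmeasurableI) (use emeasure_lborel_ball_finite[of "0::'a" r] in auto)
qed (use assms in auto)

lemma measure_cone_shell:
  fixes Q :: "'a::euclidean_space set"
  assumes Q: "cone_set Q" "Q \<in> sets borel" and r: "0 \<le> r" "r \<le> 1"
  shows "measure lborel (Q \<inter> ball 0 1 - ball 0 r) = (1 - r ^ DIM('a)) * measure lborel (Q \<inter> ball 0 1)"
proof -
  have "Q \<inter> ball 0 1 - ball 0 r = Q \<inter> ball 0 1 - Q \<inter> ball 0 r" by auto
  moreover have "Q \<inter> ball 0 r \<subseteq> Q \<inter> ball 0 1" using r by auto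
  then have "measure lborel (Q \<inter> ball 0 1 - Q \<inter> ball 0 r) = measure lborel (Q \<inter> ball 0 1) - measure lborel (Q \<inter> ball 0 r)"
    using lmeasurable_cone_ball[OF Q(2), of 1] lmeasurable_cone_ball[OF Q(2), of r]
    by (intro measurable_measure_Diff) (auto simp: fmeasurable_def)
  ultimately show ?thesis using measure_cone_ball[OF Q r(1)] by (simp add: algebra_simps)
qed

abbreviation (input) shell :: "real \<Rightarrow> (complex ^ 'n) set"
  where "shell t \<equiv> {w. 1 - (norm w)\<^sup>2 \<le> t}"

lemma measure_cone_thin_shell:
  fixes Q :: "(complex ^ 'n) set"
  assumes Q: "cone_set Q" "Q \<in> sets borel" and t: "0 < t" "t \<le> 1"
  shows "measure lborel (Q \<inter> ball 0 1 \<inter> shell t) \<le> real CARD('n) * t * measure lborel (Q \<inter> ball 0 1)"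
proof -
  have "Q \<inter> ball 0 1 \<inter> shell t = Q \<inter> ball 0 1 - ball 0 (sqrt (1 - t))"
  proof -
    have "1 - (norm w)\<^sup>2 \<le> t \<longleftrightarrow> \<not> norm w < sqrt (1 - t)" for w :: "complex ^ 'n"
    proof -
      have "norm w < sqrt (1 - t) \<longleftrightarrow> (norm w)\<^sup>2 < 1 - t"
        using real_sqrt_less_iff[of "(norm w)\<^sup>2" "1 - t"] by simp
      then show ?thesis by auto
    qed
    then show ?thesis
      by (intro set_eqI) (simp only: Int_iff Diff_iff mem_Collect_eq mem_ball_0)
  qed
  then have "measure lborel (Q \<inter> ball 0 1 \<inter> shell t) = (1 - sqrt (1 - t) ^ DIM(complex ^ 'n)) * measure lborel (Q \<inter> ball 0 1)"
    using measure_cone_shell[OF Q, of "sqrt (1 - t)"] t by simp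
  also have "sqrt (1 - t) ^ DIM(complex ^ 'n) = (1 - t) ^ CARD('n)"
    using t by (simp add: mult.commute[of _ 2] power_mult)
  also have "(1 - (1 - t) ^ CARD('n)) * measure lborel (Q \<inter> ball 0 1) \<le> real CARD('n) * t * measure lborel (Q \<inter> ball 0 1)"
    using Bernoulli_inequality[of "- t" "CARD('n)"] t by (intro mult_right_mono) auto
  finally show ?thesis .
qed

lemma delta_powr: "delta j powr a = (2 powr - a) ^ j"
proof -
  have "delta j = 2 powr - real j" by (simp add: delta_def powr_minus powr_realpow divide_inverse)
  then show ?thesis by (simp add: powr_powr powr_realpow[symmetric] mult.commute)
qed

lemma summable_delta_powr: "0 < a \<Longrightarrow> summable (\<lambda>j. delta j powr a)"
  unfolding delta_powr by (intro summable_geometric) (simp add: powr_less_one)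

definition weight_int :: "real \<Rightarrow> (complex ^ 'n) set \<Rightarrow> ennreal"
  where "weight_int \<alpha> A = (\<integral>\<^sup>+w. ennreal (weight \<alpha> w) * indicator (A \<inter> ball 0 1) w \<partial>lborel)"

lemma weight_int_mono: "A \<inter> ball 0 1 \<subseteq> B \<Longrightarrow> weight_int \<alpha> A \<le> weight_int \<alpha> B"
  unfolding weight_int_def by (intro nn_integral_mono) (auto simp: indicator_def)

lemma weight_int_cone:
  assumes \<alpha>: "-1 < \<alpha>"
  obtains C where "0 < C" "\<And>(Q :: (complex ^ 'n) set) t. cone_set Q \<Longrightarrow> Q \<in> sets borel \<Longrightarrow> 0 < t \<Longrightarrow> t \<le> 1 \<Longrightarrow>
    weight_int \<alpha> (Q \<inter> shell t) \<le> ennreal (C * t powr (1 + \<alpha>) * measure lborel (Q \<inter> ball 0 1))"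
proof -
  define c where "c = max 1 (2 powr - \<alpha>)"
  have c: "0 < c" by (simp add: c_def)
  define S where "S = (\<Sum>j. delta j powr (1 + \<alpha>))"
  have sS: "summable (\<lambda>j. delta j powr (1 + \<alpha>))" using \<alpha> by (intro summable_delta_powr) simp
  have S: "0 < S"
    unfolding S_def by (intro suminf_pos sS) (simp add: less_imp_neq[OF delta_pos, symmetric])
  define C where "C = c * real CARD('n) * S"
  have C: "0 < C" using c S by (simp add: C_def)
  show ?thesis
  proof (rule that[OF C])
    fix Q :: "(complex ^ 'n) set" and t :: real
    assume Q: "cone_set Q" "Q \<in> sets borel" and t: "0 < t" "t \<le> 1"
    define V where "V = measure lborel (Q \<inter> ball 0 1)"
    define A where "A j = Q \<inter> ball 0 1 \<inter> shell (t * delta j)" for j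
    have A_borel: "A j \<in> sets borel" for j
    proof -
      note [measurable] = Q(2)
      have [measurable]: "ball 0 1 \<in> sets (borel :: (complex ^ 'n) measure)" by simp
      show ?thesis unfolding A_def by measurable
    qed
    have td: "0 < t * delta j" "t * delta j \<le> 1" for j
      using t delta_pos[of j] delta_le_1[of j] by (auto simp: mult_le_one)
    have eA: "emeasure lborel (A j) \<le> ennreal (real CARD('n) * (t * delta j) * V)" for j
    proof -
      have "A j \<in> fmeasurable lborel"
        by (rule fmeasurableI2[OF lmeasurable_cone_ball[OF Q(2), of 1]]) (use A_borel in \<open>auto simp: A_def\<close>)
      then have "emeasure lborel (A j) = ennreal (measure lborel (A j))"
        by (intro emeasure_eq_ennreal_measure) (auto simp: fmeasurable_def)
      also have "\<dots> \<le> ennreal (real CARD('n) * (t * delta j) * V)"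
        using measure_cone_thin_shell[OF Q td] by (intro ennreal_leI) (simp add: A_def V_def)
      finally show ?thesis .
    qed
    have "weight_int \<alpha> (Q \<inter> shell t)
        \<le> (\<integral>\<^sup>+w. (\<Sum>j. ennreal (c * (t * delta j) powr \<alpha>) * indicator (A j) w) \<partial>lborel)"
      unfolding weight_int_def
    proof (rule nn_integral_mono)
      fix w :: "complex ^ 'n"
      let ?x = "1 - (norm w)\<^sup>2"
      show "ennreal (?x powr \<alpha>) * indicator (Q \<inter> shell t \<inter> ball 0 1) w
        \<le> (\<Sum>j. ennreal (c * (t * delta j) powr \<alpha>) * indicator (A j) w)"
      proof (cases "w \<in> Q \<inter> shell t \<inter> ball 0 1")
        case True
        then have x: "0 < ?x" "?x \<le> t" by (auto simp: abs_square_less_1)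
        obtain j where j: "delta (Suc j) < ?x / t" "?x / t \<le> delta j"
          using dyadic_exists[of "?x / t"] x t by auto
        have j': "t * delta j / 2 < ?x" "?x \<le> t * delta j"
          using j t by (auto simp: delta_Suc field_simps)
        have "?x powr \<alpha> \<le> c * (t * delta j) powr \<alpha>"
        proof (cases "0 \<le> \<alpha>")
          case True
          have "?x powr \<alpha> \<le> 1 * (t * delta j) powr \<alpha>" using True x j' by (simp add: powr_mono2)
          also have "\<dots> \<le> c * (t * delta j) powr \<alpha>" by (intro mult_right_mono) (simp_all add: c_def)
          finally show ?thesis .
        next
          case False
          have "?x powr \<alpha> \<le> (t * delta j / 2) powr \<alpha>" using False td[of j] j' by (intro powr_mono2') auto
          also have "\<dots> = 2 powr - \<alpha> * (t * delta j) powr \<alpha>"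
            using td[of j] by (simp add: powr_divide powr_minus_divide)
          also have "\<dots> \<le> c * (t * delta j) powr \<alpha>" by (intro mult_right_mono) (simp_all add: c_def)
          finally show ?thesis .
        qed
        then have "ennreal (?x powr \<alpha>) \<le> ennreal (c * (t * delta j) powr \<alpha>) * indicator (A j) w"
          using True j' by (simp add: A_def ennreal_leI)
        also have "\<dots> \<le> (\<Sum>j. ennreal (c * (t * delta j) powr \<alpha>) * indicator (A j) w)"
          by (rule ennreal_le_suminf)
        finally show ?thesis using True by simp
      qed simp
    qed
    also have "\<dots> = (\<Sum>j. \<integral>\<^sup>+w. ennreal (c * (t * delta j) powr \<alpha>) * indicator (A j) w \<partial>lborel)"
    proof (rule nn_integral_suminf)
      fix j
      note [measurable] = A_borel[of j]
      show "(\<lambda>w. ennreal (c * (t * delta j) powr \<alpha>) * indicator (A j) w) \<in> borel_measurable lborel" by measurable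
    qed
    also have "\<dots> = (\<Sum>j. ennreal (c * (t * delta j) powr \<alpha>) * emeasure lborel (A j))"
      using A_borel by (simp add: nn_integral_cmult_indicator)
    also have "\<dots> \<le> (\<Sum>j. ennreal (c * real CARD('n) * t powr (1 + \<alpha>) * V * delta j powr (1 + \<alpha>)))"
    proof (intro suminf_le summableI)
      fix j
      have "ennreal (c * (t * delta j) powr \<alpha>) * emeasure lborel (A j)
          \<le> ennreal (c * (t * delta j) powr \<alpha>) * ennreal (real CARD('n) * (t * delta j) * V)"
        by (intro mult_left_mono eA) simp
      also have "\<dots> = ennreal (c * (t * delta j) powr \<alpha> * (real CARD('n) * (t * delta j) * V))"
        using c by (simp add: ennreal_mult')
      also have "c * (t * delta j) powr \<alpha> * (real CARD('n) * (t * delta j) * V)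
          = c * real CARD('n) * t powr (1 + \<alpha>) * V * delta j powr (1 + \<alpha>)"
        using t delta_pos[of j] by (simp add: powr_mult powr_add)
      finally show "ennreal (c * (t * delta j) powr \<alpha>) * emeasure lborel (A j)
        \<le> ennreal (c * real CARD('n) * t powr (1 + \<alpha>) * V * delta j powr (1 + \<alpha>))" .
    qed
    also have "\<dots> = ennreal (\<Sum>j. c * real CARD('n) * t powr (1 + \<alpha>) * V * delta j powr (1 + \<alpha>))"
      using c sS by (intro suminf_ennreal2 summable_mult) (auto simp: V_def)
    also have "(\<Sum>j. c * real CARD('n) * t powr (1 + \<alpha>) * V * delta j powr (1 + \<alpha>)) = C * t powr (1 + \<alpha>) * V"
      unfolding suminf_mult[OF sS] by (simp add: C_def S_def)
    finally show "weight_int \<alpha> (Q \<inter> shell t) \<le> ennreal (C * t powr (1 + \<alpha>) * measure lborel (Q \<inter> ball 0 1))"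
      by (simp add: V_def)
  qed
qed

lemma weight_int_UNIV_finite:
  assumes \<alpha>: "-1 < \<alpha>"
  shows "weight_int \<alpha> (UNIV :: (complex ^ 'n) set) < \<infinity>"
proof -
  obtain C where C: "0 < C" "\<And>(Q :: (complex ^ 'n) set) t. cone_set Q \<Longrightarrow> Q \<in> sets borel \<Longrightarrow> 0 < t \<Longrightarrow> t \<le> 1 \<Longrightarrow>
    weight_int \<alpha> (Q \<inter> shell t) \<le> ennreal (C * t powr (1 + \<alpha>) * measure lborel (Q \<inter> ball 0 1))"
    using weight_int_cone[OF \<alpha>, where 'n='n] by blast
  have "UNIV \<inter> shell 1 = (UNIV :: (complex ^ 'n) set)" by auto
  with C(2)[of UNIV 1] have "weight_int \<alpha> (UNIV :: (complex ^ 'n) set) \<le> ennreal (C * 1 powr (1 + \<alpha>) * measure lborel (ball 0 1 :: (complex ^ 'n) set))"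
    by (simp add: cone_set_def)
  then show ?thesis by (simp add: le_less_trans)
qed

text \<open>The affine image used for the pointwise estimate, now based at the boundary point \<open>axis k 1\<close>,
  covers the nonisotropic ball up to a constant dilation.\<close>

lemma nonisotropic_ball_subset:
  fixes x w :: "complex ^ 'n"
  assumes \<epsilon>: "0 < \<epsilon>" and w: "w = axis k 1 + aniso k \<epsilon> x" "norm w < 1" "norm (1 - w $ k) \<le> 2 * \<epsilon>"
  shows "norm x < 12"
proof -
  have wk: "w $ k - 1 = of_real (\<epsilon> / 4) * x $ k" by (simp add: w(1) aniso_def)
  have wi: "w $ i = of_real (sqrt \<epsilon> / 4) * x $ i" if "i \<noteq> k" for i
    using that by (simp add: w(1) aniso_def axis_def)
  have nsq: "(norm y)\<^sup>2 = (norm (y $ k))\<^sup>2 + (\<Sum>i\<in>UNIV - {k}. (norm (y $ i))\<^sup>2)" for y :: "complex ^ 'n"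
    by (simp add: norm_vec_def L2_set_def sum_nonneg sum.remove[of UNIV k])
  have "norm (w $ k - 1) = \<epsilon> / 4 * norm (x $ k)"
    using \<epsilon> unfolding wk by (simp add: norm_mult)
  then have "\<epsilon> / 4 * norm (x $ k) \<le> 2 * \<epsilon>" using w(3) by (simp add: norm_minus_commute)
  then have xk: "norm (x $ k) \<le> 8" using \<epsilon> by simp
  have "(\<Sum>i\<in>UNIV - {k}. (norm (w $ i))\<^sup>2) = (\<Sum>i\<in>UNIV - {k}. \<epsilon> / 16 * (norm (x $ i))\<^sup>2)"
    using \<epsilon> by (intro sum.cong) (auto simp: wi norm_mult power_mult_distrib power_divide)
  then have sw: "(\<Sum>i\<in>UNIV - {k}. (norm (w $ i))\<^sup>2) = \<epsilon> / 16 * (\<Sum>i\<in>UNIV - {k}. (norm (x $ i))\<^sup>2)"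
    by (simp add: sum_distrib_left)
  have "1 - norm (w $ k) \<le> 2 * \<epsilon>"
    using norm_triangle_ineq2[of 1 "w $ k"] w(3) by simp
  moreover have "norm (w $ k) \<le> 1"
    using Finite_Cartesian_Product.norm_nth_le[of w k] w(2) by simp
  moreover have "1 - (norm (w $ k))\<^sup>2 = (1 - norm (w $ k)) * (1 + norm (w $ k))"
    by (simp add: power2_eq_square algebra_simps)
  moreover have "(1 - norm (w $ k)) * (1 + norm (w $ k)) \<le> 2 * \<epsilon> * 2"
    using calculation(1,2) \<epsilon> by (intro mult_mono) auto
  ultimately have "1 - (norm (w $ k))\<^sup>2 \<le> 4 * \<epsilon>" by simp
  moreover have "(norm w)\<^sup>2 < 1" using w(2) by (simp add: abs_square_less_1)
  ultimately have "\<epsilon> / 16 * (\<Sum>i\<in>UNIV - {k}. (norm (x $ i))\<^sup>2) \<le> 4 * \<epsilon>"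
    using nsq[of w] sw by simp
  then have xs: "(\<Sum>i\<in>UNIV - {k}. (norm (x $ i))\<^sup>2) \<le> 64" using \<epsilon> by simp
  have "(norm (x $ k))\<^sup>2 \<le> 8\<^sup>2" using xk by (intro power_mono) auto
  then have "(norm x)\<^sup>2 < 12\<^sup>2" using nsq[of x] xs by simp
  then show ?thesis by (rule power_less_imp_less_base) simp
qed

lemma hinner_measurable [measurable]: "(\<lambda>w :: complex ^ 'n. hinner w v) \<in> borel_measurable borel"
  unfolding hinner_def by (intro borel_measurable_continuous_onI continuous_intros)

lemma measure_nonisotropic_ball:
  obtains C where "0 < C" "\<And>(\<xi> :: complex ^ 'n) \<epsilon>. norm \<xi> = 1 \<Longrightarrow> 0 < \<epsilon> \<Longrightarrow>
    measure lborel {w \<in> ball 0 1. norm (1 - hinner w \<xi>) \<le> 2 * \<epsilon>} \<le> C * \<epsilon> ^ (CARD('n) + 1)"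
proof -
  define V where "V = measure lborel (ball 0 12 :: (complex ^ 'n) set)"
  have V: "0 < V" unfolding V_def by (simp add: content_ball_pos)
  have eV: "emeasure lborel (ball 0 12 :: (complex ^ 'n) set) = ennreal V"
    unfolding V_def by (rule emeasure_ball_measure)
  define c where "c = (1 / 4 :: real) ^ (2 * CARD('n))"
  have c: "0 < c" by (simp add: c_def)
  show ?thesis
  proof (rule that[of "c * V"])
    show "0 < c * V" using c V by simp
    fix \<xi> :: "complex ^ 'n" and \<epsilon> :: real assume \<xi>: "norm \<xi> = 1" and \<epsilon>: "0 < \<epsilon>"
    define k :: 'n where "k = undefined"
    define e :: "complex ^ 'n" where "e = axis k 1"
    have e: "norm e = 1" by (simp add: e_def norm_eq_1 inner_axis')
    obtain U where U: "unitary_map U" "U e = \<xi>" using unitary_map_exists[OF e \<xi>] by blast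
    define A where "A = {w \<in> ball 0 1. norm (1 - hinner w \<xi>) \<le> 2 * \<epsilon>}"
    have [measurable]: "A \<in> sets borel"
    proof -
      have "A = ball 0 1 \<inter> {w. norm (1 - hinner w \<xi>) \<le> 2 * \<epsilon>}" by (auto simp: A_def)
      moreover have "{w :: complex ^ 'n. norm (1 - hinner w \<xi>) \<le> 2 * \<epsilon>} \<in> sets borel" by measurable
      ultimately show ?thesis by simp
    qed
    have he: "hinner w e = w $ k" for w
    proof -
      have "hinner w e = (\<Sum>i\<in>UNIV. if i = k then w $ i else 0)"
        unfolding hinner_def e_def axis_def by (intro sum.cong) auto
      then show ?thesis by simp
    qed
    have lin: "linear U" and nU: "\<And>x. norm (U x) = norm x" using U(1) by (auto simp: unitary_map_def)
    have UA: "U w \<in> A \<longleftrightarrow> norm w < 1 \<and> norm (1 - w $ k) \<le> 2 * \<epsilon>" for w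
      using unitary_map_hinner[OF U(1), of w e] by (simp add: A_def nU U(2) he)
    have [measurable]: "(\<lambda>w. indicator A (U w) :: ennreal) \<in> borel_measurable borel"
    proof -
      have [measurable]: "U \<in> borel_measurable borel"
        using lin by (intro borel_measurable_continuous_onI linear_continuous_on) (simp add: linear_conv_bounded_linear)
      show ?thesis by measurable
    qed
    have "emeasure lborel A = (\<integral>\<^sup>+w. indicator A w \<partial>lborel)" by simp
    also have "\<dots> = (\<integral>\<^sup>+w. indicator A (U w) \<partial>lborel)"
      by (rule nn_integral_lborel_isometry[OF lin nU, symmetric]) measurable
    also have "\<dots> = ennreal (c * \<epsilon> ^ (CARD('n) + 1)) * (\<integral>\<^sup>+x. indicator A (U (e + aniso k \<epsilon> x)) \<partial>lborel)"
      unfolding c_def by (rule nn_integral_aniso[OF \<epsilon>]) measurable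
    also have "(\<integral>\<^sup>+x. indicator A (U (e + aniso k \<epsilon> x)) \<partial>lborel) \<le> (\<integral>\<^sup>+x. indicator (ball 0 12 :: (complex ^ 'n) set) x \<partial>lborel)"
    proof (rule nn_integral_mono)
      fix x :: "complex ^ 'n"
      show "indicator A (U (e + aniso k \<epsilon> x)) \<le> (indicator (ball 0 12) x :: ennreal)"
        using nonisotropic_ball_subset[OF \<epsilon>, of _ k x] by (auto simp: indicator_def UA e_def)
    qed
    also have "\<dots> = ennreal V" using eV by simp
    finally have "emeasure lborel A \<le> ennreal (c * \<epsilon> ^ (CARD('n) + 1)) * ennreal V"
      by (simp add: mult_left_mono)
    also have "\<dots> = ennreal (c * V * \<epsilon> ^ (CARD('n) + 1))"
      using c V \<epsilon> by (simp add: ennreal_mult[symmetric] mult_ac)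
    finally have "measure lborel A \<le> c * V * \<epsilon> ^ (CARD('n) + 1)"
      unfolding measure_def using c V \<epsilon> by (intro enn2real_leI) auto
    then show "measure lborel {w \<in> ball 0 1. norm (1 - hinner w \<xi>) \<le> 2 * \<epsilon>} \<le> c * V * \<epsilon> ^ (CARD('n) + 1)"
      by (simp add: A_def)
  qed
qed

definition nonisotropic_cone :: "complex ^ 'n \<Rightarrow> real \<Rightarrow> (complex ^ 'n) set"
  where "nonisotropic_cone \<xi> \<epsilon> = {w. w \<noteq> 0 \<and> norm (1 - hinner w \<xi> / of_real (norm w)) < \<epsilon>}"

lemma nonisotropic_cone_borel: "nonisotropic_cone \<xi> \<epsilon> \<in> sets borel"
proof -
  have "{w. norm (1 - hinner w \<xi> / of_real (norm w)) < \<epsilon>} - {0} \<in> sets borel"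
    by measurable
  also have "{w. norm (1 - hinner w \<xi> / of_real (norm w)) < \<epsilon>} - {0} = nonisotropic_cone \<xi> \<epsilon>"
    by (auto simp: nonisotropic_cone_def)
  finally show ?thesis .
qed

lemma cone_set_nonisotropic_cone: "cone_set (nonisotropic_cone \<xi> \<epsilon>)"
  unfolding cone_set_def nonisotropic_cone_def by (auto simp: hinner_scaleR_left)

lemma kernel_radial_diff:
  assumes \<xi>: "norm \<xi> = 1" and w: "w \<noteq> 0" "norm w \<le> 1"
  shows "norm (hinner w \<xi> / of_real (norm w) - hinner w \<xi>) \<le> 1 - norm w"
proof -
  have "hinner w \<xi> / of_real (norm w) - hinner w \<xi> = hinner w \<xi> * of_real ((1 - norm w) / norm w)"
    using w(1) by (simp add: field_simps)
  also have "norm \<dots> = norm (hinner w \<xi>) * ((1 - norm w) / norm w)"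
    using w unfolding norm_mult norm_of_real by simp
  also have "\<dots> \<le> norm w * ((1 - norm w) / norm w)"
    using cmod_hinner_le[of w \<xi>] \<xi> w by (intro mult_right_mono) auto
  also have "\<dots> = 1 - norm w" using w by simp
  finally show ?thesis .
qed

lemma measure_nonisotropic_cone:
  obtains C where "0 < C" "\<And>(\<xi> :: complex ^ 'n) \<epsilon>. norm \<xi> = 1 \<Longrightarrow> 0 < \<epsilon> \<Longrightarrow> \<epsilon> \<le> 1 \<Longrightarrow>
    measure lborel (nonisotropic_cone \<xi> \<epsilon> \<inter> ball 0 1) \<le> C * \<epsilon> ^ CARD('n)"
proof -
  obtain C where C: "0 < C" "\<And>(\<xi> :: complex ^ 'n) \<epsilon>. norm \<xi> = 1 \<Longrightarrow> 0 < \<epsilon> \<Longrightarrow>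
    measure lborel {w \<in> ball 0 1. norm (1 - hinner w \<xi>) \<le> 2 * \<epsilon>} \<le> C * \<epsilon> ^ (CARD('n) + 1)"
    using measure_nonisotropic_ball[where 'n='n] by blast
  show ?thesis
  proof (rule that[OF C(1)])
    fix \<xi> :: "complex ^ 'n" and \<epsilon> :: real assume \<xi>: "norm \<xi> = 1" and \<epsilon>: "0 < \<epsilon>" "\<epsilon> \<le> 1"
    let ?Q = "nonisotropic_cone \<xi> \<epsilon>"
    let ?A = "{w \<in> ball 0 1. norm (1 - hinner w \<xi>) \<le> 2 * \<epsilon>}"
    let ?V = "measure lborel (?Q \<inter> ball 0 1)"
    have sub: "?Q \<inter> ball 0 1 - ball 0 (1 - \<epsilon>) \<subseteq> ?A"
    proof
      fix w assume w: "w \<in> ?Q \<inter> ball 0 1 - ball 0 (1 - \<epsilon>)"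
      then have w': "w \<noteq> 0" "norm w < 1" "1 - \<epsilon> \<le> norm w" "norm (1 - hinner w \<xi> / of_real (norm w)) < \<epsilon>"
        by (auto simp: nonisotropic_cone_def)
      have "norm (1 - hinner w \<xi>) \<le> norm (1 - hinner w \<xi> / of_real (norm w)) + norm (hinner w \<xi> / of_real (norm w) - hinner w \<xi>)"
        using norm_triangle_ineq[of "1 - hinner w \<xi> / of_real (norm w)" "hinner w \<xi> / of_real (norm w) - hinner w \<xi>"] by simp
      also have "\<dots> \<le> \<epsilon> + \<epsilon>"
        using kernel_radial_diff[OF \<xi> w'(1)] w' by (intro add_mono) auto
      finally show "w \<in> ?A" using w' by simp
    qed
    have "(1 - \<epsilon>) ^ DIM(complex ^ 'n) \<le> (1 - \<epsilon>) ^ 1"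
      using \<epsilon> by (intro power_decreasing) (auto simp: Suc_le_eq)
    then have "\<epsilon> * ?V \<le> (1 - (1 - \<epsilon>) ^ DIM(complex ^ 'n)) * ?V"
      by (intro mult_right_mono) auto
    also have "\<dots> = measure lborel (?Q \<inter> ball 0 1 - ball 0 (1 - \<epsilon>))"
      using \<epsilon> by (intro measure_cone_shell[symmetric] cone_set_nonisotropic_cone nonisotropic_cone_borel) auto
    also have "\<dots> \<le> measure lborel ?A"
    proof (rule measure_mono_fmeasurable[OF sub])
      show "?Q \<inter> ball 0 1 - ball 0 (1 - \<epsilon>) \<in> sets lborel" using nonisotropic_cone_borel[of \<xi> \<epsilon>] by simp
      have m: "{w :: complex ^ 'n. norm (1 - hinner w \<xi>) \<le> 2 * \<epsilon>} \<in> sets borel" by measurable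
      have "?A = {w. norm (1 - hinner w \<xi>) \<le> 2 * \<epsilon>} \<inter> ball 0 1" by auto
      then show "?A \<in> fmeasurable lborel" using lmeasurable_cone_ball[OF m] by simp
    qed
    also have "\<dots> \<le> C * \<epsilon> ^ (CARD('n) + 1)" by (rule C(2)[OF \<xi> \<epsilon>(1)])
    finally show "?V \<le> C * \<epsilon> ^ CARD('n)" using \<epsilon> by (simp add: mult.left_commute)
  qed
qed

lemma weight_int_nonisotropic_ball:
  fixes \<xi> :: "complex ^ 'n"
  assumes \<alpha>: "-1 < \<alpha>" and \<xi>: "norm \<xi> = 1"
  obtains C where "0 < C" "\<And>\<epsilon>. 0 < \<epsilon> \<Longrightarrow> weight_int \<alpha> {w. norm (1 - hinner w \<xi>) < \<epsilon>} \<le> ennreal (C * \<epsilon> powr (real CARD('n) + 1 + \<alpha>))"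
proof -
  let ?d = "real CARD('n) + 1 + \<alpha>"
  obtain C1 where C1: "0 < C1" "\<And>(Q :: (complex ^ 'n) set) t. cone_set Q \<Longrightarrow> Q \<in> sets borel \<Longrightarrow> 0 < t \<Longrightarrow> t \<le> 1 \<Longrightarrow>
    weight_int \<alpha> (Q \<inter> shell t) \<le> ennreal (C1 * t powr (1 + \<alpha>) * measure lborel (Q \<inter> ball 0 1))"
    using weight_int_cone[OF \<alpha>, where 'n='n] by blast
  obtain C2 where C2: "0 < C2" "\<And>(\<xi> :: complex ^ 'n) \<epsilon>. norm \<xi> = 1 \<Longrightarrow> 0 < \<epsilon> \<Longrightarrow> \<epsilon> \<le> 1 \<Longrightarrow>
    measure lborel (nonisotropic_cone \<xi> \<epsilon> \<inter> ball 0 1) \<le> C2 * \<epsilon> ^ CARD('n)"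
    using measure_nonisotropic_cone[where 'n='n] by blast
  define W where "W = enn2real (weight_int \<alpha> (UNIV :: (complex ^ 'n) set))"
  have W: "weight_int \<alpha> (UNIV :: (complex ^ 'n) set) = ennreal W" "0 \<le> W"
    using weight_int_UNIV_finite[OF \<alpha>, where 'n='n] by (simp_all add: W_def)
  define C where "C = (C1 * C2 + W) * 2 powr ?d"
  show ?thesis
  proof (rule that[of C])
    show "0 < C" using C1 C2 W by (simp add: C_def add_pos_nonneg)
    fix \<epsilon> :: real assume \<epsilon>: "0 < \<epsilon>"
    have eq: "C * \<epsilon> powr ?d = (C1 * C2 + W) * (2 * \<epsilon>) powr ?d" using \<epsilon> by (simp add: C_def powr_mult)
    show "weight_int \<alpha> {w. norm (1 - hinner w \<xi>) < \<epsilon>} \<le> ennreal (C * \<epsilon> powr ?d)"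
    proof (cases "\<epsilon> \<le> 1 / 2")
      case True
      have sub: "{w. norm (1 - hinner w \<xi>) < \<epsilon>} \<inter> ball 0 1 \<subseteq> nonisotropic_cone \<xi> (2 * \<epsilon>) \<inter> shell (2 * \<epsilon>)"
      proof
        fix w assume "w \<in> {w. norm (1 - hinner w \<xi>) < \<epsilon>} \<inter> ball 0 1"
        then have w: "norm (1 - hinner w \<xi>) < \<epsilon>" "norm w < 1" by auto
        have "1 - norm (hinner w \<xi>) \<le> norm (1 - hinner w \<xi>)"
          using norm_triangle_ineq2[of 1 "hinner w \<xi>"] by simp
        then have nw: "1 - norm w \<le> \<epsilon>" using cmod_hinner_le[of w \<xi>] \<xi> w by simp
        then have w0: "w \<noteq> 0" using True by auto
        have "norm (1 - hinner w \<xi> / of_real (norm w)) \<le> norm (1 - hinner w \<xi>) + norm (hinner w \<xi> / of_real (norm w) - hinner w \<xi>)"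
          using norm_triangle_ineq4[of "1 - hinner w \<xi>" "hinner w \<xi> / of_real (norm w) - hinner w \<xi>"] by simp
        also have "\<dots> < \<epsilon> + \<epsilon>"
          using kernel_radial_diff[OF \<xi> w0] w nw by (intro add_less_le_mono) auto
        finally have 1: "norm (1 - hinner w \<xi> / of_real (norm w)) < 2 * \<epsilon>" by simp
        have "1 - (norm w)\<^sup>2 = (1 - norm w) * (1 + norm w)" by (simp add: power2_eq_square algebra_simps)
        also have "\<dots> \<le> \<epsilon> * 2" using nw w \<epsilon> by (intro mult_mono) auto
        finally show "w \<in> nonisotropic_cone \<xi> (2 * \<epsilon>) \<inter> shell (2 * \<epsilon>)"
          using 1 w0 by (simp add: nonisotropic_cone_def)
      qed
      have "weight_int \<alpha> {w. norm (1 - hinner w \<xi>) < \<epsilon>} \<le> weight_int \<alpha> (nonisotropic_cone \<xi> (2 * \<epsilon>) \<inter> shell (2 * \<epsilon>))"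
        by (rule weight_int_mono[OF sub])
      also have "\<dots> \<le> ennreal (C1 * (2 * \<epsilon>) powr (1 + \<alpha>) * measure lborel (nonisotropic_cone \<xi> (2 * \<epsilon>) \<inter> ball 0 1))"
        using True \<epsilon> by (intro C1(2) cone_set_nonisotropic_cone nonisotropic_cone_borel) auto
      also have "\<dots> \<le> ennreal (C1 * (2 * \<epsilon>) powr (1 + \<alpha>) * (C2 * (2 * \<epsilon>) ^ CARD('n)))"
        using C1(1) True \<epsilon> by (intro ennreal_leI mult_left_mono C2(2) \<xi>) auto
      also have "C1 * (2 * \<epsilon>) powr (1 + \<alpha>) * (C2 * (2 * \<epsilon>) ^ CARD('n)) = C1 * C2 * (2 * \<epsilon>) powr ?d"
        using \<epsilon> by (simp add: powr_add powr_realpow)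
      also have "ennreal \<dots> \<le> ennreal ((C1 * C2 + W) * (2 * \<epsilon>) powr ?d)"
        using W by (intro ennreal_leI mult_right_mono) auto
      finally show ?thesis by (simp only: eq)
    next
      case False
      have "weight_int \<alpha> {w. norm (1 - hinner w \<xi>) < \<epsilon>} \<le> ennreal W"
        unfolding W(1)[symmetric] by (rule weight_int_mono) simp
      also have "\<dots> \<le> ennreal ((C1 * C2 + W) * (2 * \<epsilon>) powr ?d)"
      proof (rule ennreal_leI)
        have "1 \<le> (2 * \<epsilon>) powr ?d" using False \<alpha> by (intro ge_one_powr_ge_zero) auto
        then have "W * 1 \<le> (C1 * C2 + W) * (2 * \<epsilon>) powr ?d" using W C1 C2 by (intro mult_mono) auto
        then show "W \<le> (C1 * C2 + W) * (2 * \<epsilon>) powr ?d" by simp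
      qed
      finally show ?thesis by (simp only: eq)
    qed
  qed
qed

section \<open>Test functions\<close>

definition test_kernel :: "complex ^ 'n \<Rightarrow> real \<Rightarrow> nat \<Rightarrow> complex ^ 'n \<Rightarrow> complex"
  where "test_kernel \<xi> s k z =
    complex_of_real (delta k powr s) * (1 / (1 - of_real (radius k) * hinner z \<xi>) powr of_real (2 * s))"

lemma radius_less_1: "radius k < 1"
  by (simp add: radius_eq delta_pos)

lemma holomorphic_vec_test_kernel:
  assumes "norm \<xi> = 1"
  shows "holomorphic_vec (test_kernel \<xi> s k) (ball 0 1)"
  unfolding test_kernel_def[abs_def]
  by (intro holomorphic_vec_mult holomorphic_vec_const
      holomorphic_vec_kernel[OF inverse_powr_holomorphic assms] radius_nonneg less_imp_le[OF radius_less_1])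

lemma delta_powr_ratio:
  "delta k powr s / max (delta k) (delta j) powr (2 * s) = delta j powr - s * (2 powr - s) ^ ((j - k) + (k - j))"
proof -
  have L: "delta i powr a = 2 powr (- (a * real i))" for i a
  proof -
    have "delta i = 2 powr - real i" by (simp add: delta_def powr_minus powr_realpow divide_inverse)
    then show ?thesis by (simp add: powr_powr mult.commute)
  qed
  have x: "(2 powr - s) ^ i = 2 powr (- (s * real i))" for i
    by (simp add: powr_powr powr_realpow[symmetric])
  show ?thesis
  proof (cases "k \<le> j")
    case True
    then have m: "max (delta k) (delta j) = delta k" using delta_antimono[OF True] by simp
    show ?thesis
      unfolding m x L powr_diff[symmetric] powr_add[symmetric]
      by (rule arg_cong[where f="(powr) 2"]) (use True in \<open>simp add: of_nat_diff algebra_simps\<close>)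
  next
    case False
    then have m: "max (delta k) (delta j) = delta j" using delta_antimono[of j k] by simp
    show ?thesis
      unfolding m x L powr_diff[symmetric] powr_add[symmetric]
      by (rule arg_cong[where f="(powr) 2"]) (use False in \<open>simp add: of_nat_diff algebra_simps\<close>)
  qed
qed

lemma norm_test_kernel_le:
  fixes z \<xi> :: "complex ^ 'n"
  assumes \<xi>: "norm \<xi> = 1" and z: "norm z < 1" and s: "0 < s" and j: "delta j \<le> norm (1 - hinner z \<xi>)"
  shows "norm (test_kernel \<xi> s k z) \<le> 4 powr s * delta j powr - s * (2 powr - s) ^ ((j - k) + (k - j))"
proof -
  let ?b = "1 - of_real (radius k) * hinner z \<xi>"
  have zx: "norm (hinner z \<xi>) \<le> 1" using cmod_hinner_le[of z \<xi>] \<xi> z by simp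
  have b1: "delta k \<le> norm ?b"
  proof -
    have "norm (of_real (radius k) * hinner z \<xi>) \<le> radius k"
      using zx radius_nonneg[of k] by (simp add: norm_mult mult_left_le)
    then show ?thesis
      using norm_triangle_ineq2[of 1 "of_real (radius k) * hinner z \<xi>"] by (simp add: radius_eq)
  qed
  have b2: "norm (1 - hinner z \<xi>) \<le> 2 * norm ?b"
  proof -
    have "1 - hinner z \<xi> = ?b - of_real (delta k) * hinner z \<xi>" by (simp add: radius_eq algebra_simps)
    then have "norm (1 - hinner z \<xi>) \<le> norm ?b + norm (of_real (delta k) * hinner z \<xi>)"
      using norm_triangle_ineq4[of ?b "of_real (delta k) * hinner z \<xi>"] by (simp only:)
    also have "norm (of_real (delta k) * hinner z \<xi>) \<le> delta k"
      using zx delta_pos[of k] by (simp add: norm_mult mult_left_le)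
    finally show ?thesis using b1 by simp
  qed
  define m where "m = max (delta k) (delta j)"
  have m: "0 < m" "m / 2 \<le> norm ?b" using b1 b2 j delta_pos[of k] by (auto simp: m_def)
  have "norm (test_kernel \<xi> s k z) = delta k powr s / norm ?b powr (2 * s)"
    by (simp add: test_kernel_def norm_mult norm_divide norm_powr_real_powr')
  also have "\<dots> \<le> delta k powr s / (m / 2) powr (2 * s)"
    using m s by (intro divide_left_mono powr_mono2 mult_pos_pos) auto
  also have "\<dots> = 4 powr s * (delta k powr s / m powr (2 * s))"
  proof -
    have "(2 :: real) powr (2 * s) = 4 powr s" by (simp flip: powr_powr)
    then show ?thesis using m by (simp add: powr_divide)
  qed
  finally show ?thesis unfolding m_def delta_powr_ratio by (simp only: mult.assoc)
qed

lemma sum_power_dist_le: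
  fixes x :: real
  assumes x: "0 < x" "x < 1"
  shows "(\<Sum>j<N. x ^ ((j - k) + (k - j))) \<le> 2 / (1 - x)"
proof -
  have g: "(\<Sum>i<m. x ^ i) \<le> 1 / (1 - x)" for m
  proof -
    have "(\<Sum>i<m. x ^ i) \<le> (\<Sum>i. x ^ i)" using x by (intro sum_le_suminf summable_geometric) auto
    then show ?thesis using x by (simp add: suminf_geometric)
  qed
  have "(\<Sum>j<N. x ^ ((j - k) + (k - j))) \<le> (\<Sum>j\<in>{..k} \<union> {k..<k + N}. x ^ ((j - k) + (k - j)))"
    using x by (intro sum_mono2) auto
  also have "\<dots> \<le> (\<Sum>j\<in>{..k}. x ^ ((j - k) + (k - j))) + (\<Sum>j\<in>{k..<k + N}. x ^ ((j - k) + (k - j)))"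
    using x by (subst sum_Un) (auto intro!: sum_nonneg)
  also have "(\<Sum>j\<in>{..k}. x ^ ((j - k) + (k - j))) = (\<Sum>i<Suc k. x ^ i)"
    by (rule sum.reindex_bij_witness[of _ "\<lambda>i. k - i" "\<lambda>j. k - j"]) auto
  also have "(\<Sum>j\<in>{k..<k + N}. x ^ ((j - k) + (k - j))) = (\<Sum>i<N. x ^ i)"
    by (rule sum.reindex_bij_witness[of _ "\<lambda>i. k + i" "\<lambda>j. j - k"]) auto
  also have "(\<Sum>i<Suc k. x ^ i) + (\<Sum>i<N. x ^ i) \<le> 1 / (1 - x) + 1 / (1 - x)"
    by (intro add_mono g)
  finally show ?thesis by simp
qed

text \<open>For \<open>p \<ge> 1\<close> this is Jensen's inequality up to the constant, for \<open>p \<le> 1\<close> the subadditivity of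
  \<open>x powr p\<close>.\<close>

lemma powr_sum_le:
  fixes c \<kappa> :: "nat \<Rightarrow> real"
  assumes p: "0 < p" and F: "finite F" and c: "\<And>k. 0 \<le> c k" and \<kappa>: "\<And>k. 0 \<le> \<kappa> k" and A: "(\<Sum>k\<in>F. \<kappa> k) \<le> A"
  shows "(\<Sum>k\<in>F. c k * \<kappa> k) powr p \<le> (A + 1) powr p * (\<Sum>k\<in>F. c k powr p * \<kappa> k powr min 1 p)"
proof -
  have A0: "0 \<le> A" using A sum_nonneg[of F \<kappa>] \<kappa> by (meson order_trans)
  let ?S = "\<Sum>k\<in>F. c k * \<kappa> k"
  define B where "B = (\<Sum>k\<in>F. c k powr p * \<kappa> k powr min 1 p)"
  have B0: "0 \<le> B" unfolding B_def by (intro sum_nonneg) auto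
  have S0: "0 \<le> ?S" using c \<kappa> by (intro sum_nonneg) auto
  have main: "?S \<le> (A + 1) * B powr (1 / p)"
  proof (cases "B = 0")
    case True
    then have "c k powr p * \<kappa> k powr min 1 p = 0" if "k \<in> F" for k
      using that F unfolding B_def by (subst (asm) sum_nonneg_eq_0_iff) auto
    then have "?S = 0" by (intro sum.neutral) (auto simp: powr_eq_0_iff)
    then show ?thesis by (simp add: True)
  next
    case False
    then have B: "0 < B" using B0 by simp
    show ?thesis
    proof (cases "1 \<le> p")
      case True
      define l where "l = B powr (1 / p)"
      have l: "0 < l" "l powr p = B" using B p by (auto simp: l_def powr_powr)
      have "?S \<le> (\<Sum>k\<in>F. (l + l powr (1 - p) * c k powr p) * \<kappa> k)"
        by (intro sum_mono mult_right_mono le_powr_interpolate c l True \<kappa>)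
      also have "\<dots> = l * (\<Sum>k\<in>F. \<kappa> k) + l powr (1 - p) * (\<Sum>k\<in>F. c k powr p * \<kappa> k)"
        by (simp add: sum_distrib_left ring_distribs sum.distrib mult.assoc)
      also have "(\<Sum>k\<in>F. c k powr p * \<kappa> k) = B"
        unfolding B_def using True \<kappa> by (intro sum.cong) (auto simp: min_def)
      also have "l powr (1 - p) * B = l" unfolding l(2)[symmetric] using l(1) by (simp flip: powr_add)
      also have "l * (\<Sum>k\<in>F. \<kappa> k) + l \<le> (A + 1) * l"
        using mult_left_mono[OF A, of l] l by (simp add: algebra_simps)
      finally show ?thesis by (simp add: l_def)
    next
      case False
      define N where "N = B powr (1 / p)"
      have N: "0 < N" "N powr p = B" using B p by (auto simp: N_def powr_powr)
      have Bp: "B = (\<Sum>k\<in>F. (c k * \<kappa> k) powr p)"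
        unfolding B_def using False c \<kappa> by (intro sum.cong) (auto simp: powr_mult min_def)
      have "c k * \<kappa> k \<le> N powr (1 - p) * (c k * \<kappa> k) powr p" if k: "k \<in> F" for k
      proof (rule le_powr_product)
        have "(c k * \<kappa> k) powr p \<le> B"
          unfolding Bp by (rule member_le_sum[OF k _ F]) simp
        then have "((c k * \<kappa> k) powr p) powr (1 / p) \<le> B powr (1 / p)"
          using p by (intro powr_mono2[where a="1 / p"]) simp_all
        then show "c k * \<kappa> k \<le> N" using p c \<kappa> by (simp add: powr_powr N_def)
      qed (use c \<kappa> p False in auto)
      then have "?S \<le> (\<Sum>k\<in>F. N powr (1 - p) * (c k * \<kappa> k) powr p)" by (rule sum_mono)
      also have "\<dots> = N powr (1 - p) * N powr p" unfolding N(2) Bp by (simp add: sum_distrib_left)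
      also have "\<dots> = 1 * N" using N(1) by (simp flip: powr_add)
      also have "\<dots> \<le> (A + 1) * N" using A0 N by (intro mult_right_mono) auto
      finally show ?thesis by (simp add: N_def)
    qed
  qed
  have "?S powr p \<le> ((A + 1) * B powr (1 / p)) powr p"
    using main S0 p by (intro powr_mono2) auto
  also have "\<dots> = (A + 1) powr p * B" using p A0 B0 by (simp add: powr_mult powr_powr)
  finally show ?thesis by (simp add: B_def)
qed

lemma test_function_bergman_int:
  fixes \<xi> :: "complex ^ 'n"
  assumes \<alpha>: "-1 < \<alpha>" and p: "0 < p" and \<xi>: "norm \<xi> = 1"
  shows "\<exists>C>0. \<forall>K c. (\<forall>k. 0 \<le> c k) \<longrightarrow>
    bergman_int \<alpha> p (\<lambda>z. \<Sum>k\<le>K. of_real (c k) * test_kernel \<xi> ((real CARD('n) + 1 + \<alpha>) / p) k z) UNIV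
      \<le> ennreal (C * (\<Sum>k\<le>K. c k powr p))"
proof -
  define d where "d = real CARD('n) + 1 + \<alpha>"
  define s where "s = d / p"
  have d: "0 < d" using \<alpha> by (simp add: d_def)
  have s: "0 < s" "s * p = d" using d p by (auto simp: s_def)
  define x where "x = (2 :: real) powr - s"
  have x: "0 < x" "x < 1" using s by (auto simp: x_def powr_less_one)
  define q where "q = min 1 p"
  define y where "y = x powr q"
  have y: "0 < y" "y < 1"
  proof -
    show "0 < y" using x by (simp add: y_def)
    have "y = 2 powr - (s * q)" by (simp add: y_def x_def powr_powr)
    moreover have "0 < s * q" using s p by (simp add: q_def)
    ultimately show "y < 1" by (simp add: powr_less_one)
  qed
  define A where "A = 2 / (1 - x)"
  have A: "0 < A" using x by (simp add: A_def)
  obtain C0 where C0: "0 < C0" "\<And>\<epsilon>. 0 < \<epsilon> \<Longrightarrow> weight_int \<alpha> {w. norm (1 - hinner w \<xi>) < \<epsilon>} \<le> ennreal (C0 * \<epsilon> powr d)"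
    using weight_int_nonisotropic_ball[OF \<alpha> \<xi>] unfolding d_def by blast
  define C1 where "C1 = C0 * 3 powr d * 4 powr d * (A + 1) powr p"
  have C1: "0 < C1" using C0 A by (simp add: C1_def)
  have "bergman_int \<alpha> p (\<lambda>z. \<Sum>k\<le>K. of_real (c k) * test_kernel \<xi> s k z) UNIV
      \<le> ennreal (C1 * (2 / (1 - y)) * (\<Sum>k\<le>K. c k powr p))" if c: "\<And>k. 0 \<le> c k" for K c
  proof -
    define f where "f z = (\<Sum>k\<le>K. of_real (c k) * test_kernel \<xi> s k z)" for z
    define D where "D j k = (j - k) + (k - j)" for j k :: nat
    define E where "E j = (4 powr s * delta j powr - s * (\<Sum>k\<le>K. c k * x ^ D j k)) powr p" for j
    define T where "T j = {w. norm (1 - hinner w \<xi>) < 3 * delta j}" for j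
    have Tb: "T j \<in> sets borel" for j unfolding T_def by measurable
    let ?w = "\<lambda>w :: complex ^ 'n. ennreal (weight \<alpha> w)"
    have wm: "(\<lambda>w. ?w w * indicator (T j \<inter> ball 0 1) w) \<in> borel_measurable lborel" for j
    proof -
      have [measurable]: "T j \<inter> ball 0 1 \<in> sets lborel" using Tb by simp
      show ?thesis by measurable
    qed
    have "bergman_int \<alpha> p f UNIV \<le> (\<integral>\<^sup>+w. (\<Sum>j. ennreal (E j) * (?w w * indicator (T j \<inter> ball 0 1) w)) \<partial>lborel)"
      unfolding bergman_int_def
    proof (rule nn_integral_mono)
      fix w :: "complex ^ 'n"
      show "ennreal (norm (f w) powr p * weight \<alpha> w) * indicator (UNIV \<inter> ball 0 1) w
          \<le> (\<Sum>j. ennreal (E j) * (?w w * indicator (T j \<inter> ball 0 1) w))"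
      proof (cases "norm w < 1")
        case True
        let ?u = "norm (1 - hinner w \<xi>)"
        have "norm (hinner w \<xi>) < 1" using cmod_hinner_le[of w \<xi>] \<xi> True by simp
        then have u: "0 < ?u / 2" "?u / 2 \<le> 1"
          using norm_triangle_ineq4[of 1 "hinner w \<xi>"] by auto
        obtain j where j: "delta (Suc j) < ?u / 2" "?u / 2 \<le> delta j" using dyadic_exists[OF u] by blast
        have "norm (f w) \<le> (\<Sum>k\<le>K. norm (of_real (c k) * test_kernel \<xi> s k w))"
          unfolding f_def by (rule norm_sum)
        also have "\<dots> \<le> (\<Sum>k\<le>K. c k * (4 powr s * delta j powr - s * x ^ D j k))"
          using norm_test_kernel_le[OF \<xi> True s(1), of j] j c
          by (intro sum_mono) (auto simp: norm_mult delta_Suc x_def D_def intro!: mult_left_mono)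
        also have "\<dots> = 4 powr s * delta j powr - s * (\<Sum>k\<le>K. c k * x ^ D j k)"
          by (simp add: sum_distrib_left mult_ac)
        finally have "norm (f w) powr p \<le> E j" unfolding E_def using p by (intro powr_mono2) auto
        then have "ennreal (norm (f w) powr p * weight \<alpha> w) \<le> ennreal (E j * weight \<alpha> w)"
          by (intro ennreal_leI mult_right_mono) auto
        also have "\<dots> = ennreal (E j) * (?w w * indicator (T j \<inter> ball 0 1) w)"
          using True j delta_pos[of j] by (simp add: T_def ennreal_mult' E_def)
        also have "\<dots> \<le> (\<Sum>j. ennreal (E j) * (?w w * indicator (T j \<inter> ball 0 1) w))"
          by (rule ennreal_le_suminf)
        finally show ?thesis using True by simp
      qed simp
    qed
    also have "\<dots> = (\<Sum>j. \<integral>\<^sup>+w. ennreal (E j) * (?w w * indicator (T j \<inter> ball 0 1) w) \<partial>lborel)"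
      by (intro nn_integral_suminf borel_measurable_times_ennreal wm) simp_all
    also have "\<dots> = (\<Sum>j. ennreal (E j) * weight_int \<alpha> (T j))"
      unfolding weight_int_def by (intro suminf_cong nn_integral_cmult wm)
    also have "\<dots> \<le> (\<Sum>j. ennreal (C1 * (\<Sum>k\<le>K. c k powr p * y ^ D j k)))"
    proof (intro suminf_le summableI)
      fix j
      let ?S = "\<Sum>k\<le>K. c k * x ^ D j k"
      have S0: "0 \<le> ?S" using c x by (intro sum_nonneg) auto
      have "ennreal (E j) * weight_int \<alpha> (T j) \<le> ennreal (E j) * ennreal (C0 * (3 * delta j) powr d)"
        unfolding T_def using delta_pos[of j] by (intro mult_left_mono C0(2)) auto
      also have "\<dots> = ennreal (E j * (C0 * (3 * delta j) powr d))"
        using C0(1) by (simp add: ennreal_mult E_def)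
      also have "E j * (C0 * (3 * delta j) powr d) = C0 * 3 powr d * 4 powr d * ?S powr p"
      proof -
        have "E j = 4 powr d * delta j powr - d * ?S powr p"
          unfolding E_def using S0 s by (simp add: powr_mult powr_powr)
        moreover have "delta j powr - d * delta j powr d = 1" using delta_pos[of j] by (simp flip: powr_add)
        ultimately show ?thesis using delta_pos[of j] by (simp add: powr_mult mult_ac)
      qed
      also have "ennreal (C0 * 3 powr d * 4 powr d * ?S powr p) \<le> ennreal (C1 * (\<Sum>k\<le>K. c k powr p * y ^ D j k))"
      proof (rule ennreal_leI)
        have "?S powr p \<le> (A + 1) powr p * (\<Sum>k\<le>K. c k powr p * (x ^ D j k) powr min 1 p)"
        proof (rule powr_sum_le[OF p])
          have "(\<Sum>k\<le>K. x ^ D j k) = (\<Sum>k<Suc K. x ^ ((k - j) + (j - k)))"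
            by (simp add: D_def lessThan_Suc_atMost add.commute)
          also have "\<dots> \<le> A" unfolding A_def by (rule sum_power_dist_le[OF x])
          finally show "(\<Sum>k\<le>K. x ^ D j k) \<le> A" .
        qed (use c x in auto)
        also have "(\<Sum>k\<le>K. c k powr p * (x ^ D j k) powr min 1 p) = (\<Sum>k\<le>K. c k powr p * y ^ D j k)"
          using x by (simp add: y_def q_def powr_power powr_realpow[symmetric] powr_powr mult.commute)
        finally have "?S powr p \<le> (A + 1) powr p * (\<Sum>k\<le>K. c k powr p * y ^ D j k)" .
        then have "C0 * 3 powr d * 4 powr d * ?S powr p \<le> C0 * 3 powr d * 4 powr d * ((A + 1) powr p * (\<Sum>k\<le>K. c k powr p * y ^ D j k))"
          using C0(1) by (intro mult_left_mono) auto
        then show "C0 * 3 powr d * 4 powr d * ?S powr p \<le> C1 * (\<Sum>k\<le>K. c k powr p * y ^ D j k)"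
          by (simp add: C1_def mult.assoc)
      qed
      finally show "ennreal (E j) * weight_int \<alpha> (T j) \<le> ennreal (C1 * (\<Sum>k\<le>K. c k powr p * y ^ D j k))" .
    qed
    also have "\<dots> \<le> ennreal (C1 * (2 / (1 - y)) * (\<Sum>k\<le>K. c k powr p))"
    proof (rule suminf_le_const[OF summableI])
      fix N
      have "(\<Sum>j<N. C1 * (\<Sum>k\<le>K. c k powr p * y ^ D j k)) = C1 * (\<Sum>k\<le>K. c k powr p * (\<Sum>j<N. y ^ D j k))"
        unfolding sum_distrib_left[symmetric] by (subst sum.swap) (simp add: sum_distrib_left)
      also have "\<dots> \<le> C1 * (\<Sum>k\<le>K. c k powr p * (2 / (1 - y)))"
        using C1 unfolding D_def by (intro mult_left_mono sum_mono sum_power_dist_le y) auto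
      also have "\<dots> = C1 * (2 / (1 - y)) * (\<Sum>k\<le>K. c k powr p)"
        by (simp only: sum_distrib_right[symmetric] mult_ac)
      finally show "(\<Sum>j<N. ennreal (C1 * (\<Sum>k\<le>K. c k powr p * y ^ D j k))) \<le> ennreal (C1 * (2 / (1 - y)) * (\<Sum>k\<le>K. c k powr p))"
        using C1 y by (subst sum_ennreal) (auto intro!: ennreal_leI mult_nonneg_nonneg sum_nonneg)
    qed
    finally show ?thesis by (simp only: f_def[abs_def])
  qed
  moreover have "0 < C1 * (2 / (1 - y))" using C1 y by simp
  ultimately show ?thesis unfolding s_def d_def by blast
qed

section \<open>Necessity\<close>

lemma finite_measure_of_integrable_const:
  assumes "integrable \<mu> (\<lambda>t. 1 :: complex)"
  shows "finite_measure \<mu>"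
proof (rule finite_measureI)
  have "emeasure \<mu> (space \<mu>) = (\<integral>\<^sup>+t. ennreal (norm (1 :: complex)) \<partial>\<mu>)" by simp
  also have "\<dots> < \<infinity>" using assms unfolding integrable_iff_bounded by simp
  finally show "emeasure \<mu> (space \<mu>) \<noteq> \<infinity>" by simp
qed

lemma cesaro_bounded_finite_measure:
  assumes "cesaro_bounded \<mu> \<beta> \<xi> X nX Y nY" "(\<lambda>z. 1) \<in> X"
  shows "finite_measure \<mu>"
proof -
  have "integrable \<mu> (cesaro_integrand \<beta> \<xi> (\<lambda>z. 1) 0)"
    using assms unfolding cesaro_bounded_def by auto
  moreover have "hinner 0 \<xi> = 0" by (simp add: hinner_def)
  then have "cesaro_integrand \<beta> \<xi> (\<lambda>z. 1) 0 = (\<lambda>t. 1 :: complex)"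
    by (simp add: cesaro_integrand_def fun_eq_iff)
  ultimately show ?thesis by (intro finite_measure_of_integrable_const) simp
qed

lemma one_in_bergman_space:
  assumes "-1 < \<alpha>" "0 < p"
  shows "(\<lambda>z :: complex ^ 'n. 1) \<in> bergman_space p \<alpha>"
proof (rule bergman_spaceI[OF assms holomorphic_vec_const])
  have "bergman_int \<alpha> p (\<lambda>z :: complex ^ 'n. 1) UNIV = weight_int \<alpha> (UNIV :: (complex ^ 'n) set)"
    by (simp add: bergman_int_def weight_int_def)
  then show "bergman_int \<alpha> p (\<lambda>z :: complex ^ 'n. 1) UNIV < \<infinity>"
    using weight_int_UNIV_finite[OF assms(1), where 'n='n] by simp
qed

lemma cesaro_necessary:
  fixes \<xi> :: "complex ^ 'n"
  assumes \<alpha>: "-1 < \<alpha>" and p: "0 < p" and \<beta>: "0 < \<beta>" and \<xi>: "norm \<xi> = 1"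
    and \<mu>: "unit_borel \<mu>"
    and bd: "bergman_bounded \<mu> \<beta> \<xi> p \<alpha>"
  shows "\<exists>C\<ge>0. \<forall>K c. (\<forall>k. 0 \<le> c k) \<longrightarrow>
    (\<Sum>k\<le>K. c k * tail_ratio \<mu> (\<beta> + (real CARD('n) + 1 + \<alpha>) / p) k)
      \<le> C * (\<Sum>k\<le>K. c k powr p) powr (1 / p)"
proof -
  define s where "s = (real CARD('n) + 1 + \<alpha>) / p"
  have s: "0 < s" using \<alpha> p by (simp add: s_def)
  have fin: "finite_measure \<mu>"
    by (rule cesaro_bounded_finite_measure[OF bd one_in_bergman_space[OF \<alpha> p]])
  interpret finite_measure \<mu> by (rule fin)
  have "\<exists>C>0. \<forall>K c. (\<forall>k. 0 \<le> c k) \<longrightarrow>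
    bergman_int \<alpha> p (\<lambda>z. \<Sum>k\<le>K. of_real (c k) * test_kernel \<xi> s k z) UNIV
      \<le> ennreal (C * (\<Sum>k\<le>K. c k powr p))"
    using test_function_bergman_int[OF \<alpha> p \<xi>] unfolding s_def .
  then obtain C0 where C0: "0 < C0" "\<forall>K c. (\<forall>k. 0 \<le> c k) \<longrightarrow>
    bergman_int \<alpha> p (\<lambda>z. \<Sum>k\<le>K. of_real (c k) * test_kernel \<xi> s k z) UNIV
      \<le> ennreal (C0 * (\<Sum>k\<le>K. c k powr p))"
    by (elim exE conjE) (rule that)
  obtain C1 where C1: "\<forall>f\<in>bergman_space p \<alpha>. H_infty_norm (cesaro \<mu> \<beta> \<xi> f) \<le> C1 * bergman_norm p \<alpha> f"
    using bd unfolding cesaro_bounded_def by blast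
  define V where "V = vol_const TYPE('n) \<alpha>"
  have V: "0 < V" using vol_const_pos[OF \<alpha>] by (simp add: V_def)
  define c0 where "c0 = 1 / (3 powr (2 * s) * 2 powr \<beta>)"
  have c0: "0 < c0" by (simp add: c0_def)
  define C where "C = \<bar>C1\<bar> * (V * C0) powr (1 / p) / c0"
  have C: "0 \<le> C" using c0 by (simp add: C_def)
  have "(\<Sum>k\<le>K. c k * tail_ratio \<mu> (\<beta> + s) k) \<le> C * (\<Sum>k\<le>K. c k powr p) powr (1 / p)"
    if c: "\<And>k. 0 \<le> c k" for K c
  proof -
    define P where "P = (\<Sum>k\<le>K. c k powr p)"
    have P0: "0 \<le> P" unfolding P_def by (intro sum_nonneg) simp
    define f where "f z = (\<Sum>k\<le>K. of_real (c k) * test_kernel \<xi> s k z)" for z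
    have f: "holomorphic_vec f (ball 0 1)"
      unfolding f_def[abs_def]
      by (intro holomorphic_vec_sum holomorphic_vec_mult holomorphic_vec_const holomorphic_vec_test_kernel \<xi>)
    have fi: "bergman_int \<alpha> p f UNIV \<le> ennreal (C0 * P)"
      using C0(2) c unfolding f_def[abs_def] P_def by blast
    have fA: "f \<in> bergman_space p \<alpha>"
      using fi by (intro bergman_spaceI[OF \<alpha> p f]) (simp add: le_less_trans)
    have "ennreal (bergman_norm p \<alpha> f powr p) \<le> ennreal V * ennreal (C0 * P)"
      unfolding bergman_norm_powr[OF \<alpha> p fA] V_def[symmetric] by (intro mult_left_mono fi) simp
    also have "\<dots> = ennreal (V * C0 * P)" using V C0(1) P0 by (simp add: ennreal_mult mult.assoc)
    finally have "bergman_norm p \<alpha> f powr p \<le> V * C0 * P" using V C0(1) P0 by simp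
    then have "(bergman_norm p \<alpha> f powr p) powr (1 / p) \<le> (V * C0 * P) powr (1 / p)"
      using p by (intro powr_mono2[where a="1 / p"]) simp_all
    then have nf: "bergman_norm p \<alpha> f \<le> (V * C0) powr (1 / p) * P powr (1 / p)"
      using p V C0(1) P0 by (simp add: powr_powr powr_mult bergman_norm_nonneg)
    define R where "R = radius K"
    have R: "0 \<le> R" "R < 1" by (simp_all add: R_def radius_nonneg radius_less_1)
    define z where "z = R *\<^sub>R \<xi>"
    have z: "z \<in> ball 0 1" using R \<xi> by (simp add: z_def)
    define G where "G t = (\<Sum>k\<le>K. c k * (delta k powr s * (1 / (1 - radius k * (t * R)) powr (2 * s)))) / (1 - t * R) powr \<beta>" for t
    have int_eq: "cesaro_integrand \<beta> \<xi> f z t = complex_of_real (G t)" if t: "t \<in> space \<mu>" for t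
    proof -
      have t: "0 \<le> t" "t < 1" using t by (auto simp: space_eq_unit[OF \<mu>])
      have tR: "0 \<le> t * R" "t * R \<le> 1" using t R by (auto simp: mult_le_one)
      have hx: "hinner \<xi> \<xi> = 1" using \<xi> by (simp add: hinner_self)
      have rt: "0 \<le> 1 - radius k * (t * R)" for k
        using mult_le_one[OF less_imp_le[OF radius_less_1] tR] by simp
      have tk: "test_kernel \<xi> s k (t *\<^sub>R z) = complex_of_real (delta k powr s * (1 / (1 - radius k * (t * R)) powr (2 * s)))" for k
      proof -
        have eq: "1 - of_real (radius k) * hinner (t *\<^sub>R z) \<xi> = complex_of_real (1 - radius k * (t * R))"
          by (simp add: z_def hinner_scaleR_left hx)
        show ?thesis unfolding test_kernel_def eq powr_of_real[OF rt] by simp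
      qed
      have eq: "1 - of_real t * hinner z \<xi> = complex_of_real (1 - t * R)"
        by (simp add: z_def hinner_scaleR_left hx)
      have "0 \<le> 1 - t * R" using tR by simp
      then show ?thesis
        unfolding cesaro_integrand_def f_def G_def tk eq by (simp only: powr_of_real) simp
    qed
    have "integrable \<mu> (cesaro_integrand \<beta> \<xi> f z)"
      using bd fA z unfolding cesaro_bounded_def by blast
    then have "integrable \<mu> (\<lambda>t. complex_of_real (G t))"
      by (rule Bochner_Integration.integrable_cong[THEN iffD1, rotated 2]) (simp_all add: int_eq)
    then have intG: "integrable \<mu> G"
      by (rule integrable_Re[of \<mu> "\<lambda>t. complex_of_real (G t)", simplified])
    have ces: "cesaro \<mu> \<beta> \<xi> f z = complex_of_real (LINT t|\<mu>. G t)"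
    proof -
      have "cesaro \<mu> \<beta> \<xi> f z = (LINT t|\<mu>. complex_of_real (G t))"
        unfolding cesaro_def by (rule Bochner_Integration.integral_cong) (simp_all add: int_eq)
      then show ?thesis by simp
    qed
    have meas: "measure \<mu> {radius k..<1} = enn2real (tail \<mu> (radius k))" for k
      by (simp add: measure_def tail_def)
    have tset: "{radius k..<1} \<in> sets \<mu>" for k by (rule tail_sets[OF \<mu> radius_nonneg])
    define g where "g k t = c k * (c0 * delta k powr - (\<beta> + s)) * indicat_real {radius k..<1} t" for k t
    have intg: "integrable \<mu> (g k)" for k
      unfolding g_def using tset[of k] by (intro integrable_mult_right integrable_real_indicator) (auto simp: less_top[symmetric])
    have "c0 * (\<Sum>k\<le>K. c k * tail_ratio \<mu> (\<beta> + s) k) = (\<Sum>k\<le>K. LINT t|\<mu>. g k t)"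
    proof -
      have "(LINT t|\<mu>. g k t) = c0 * (c k * tail_ratio \<mu> (\<beta> + s) k)" for k
      proof -
        have "(LINT t|\<mu>. g k t) = c k * (c0 * delta k powr - (\<beta> + s)) * measure \<mu> {radius k..<1}"
          unfolding g_def using sets.sets_into_space[OF tset[of k]] by (simp add: Int_absorb2 del: powr_minus)
        also have "delta k powr - (\<beta> + s) = 1 / delta k powr (\<beta> + s)" by (rule powr_minus_divide)
        finally show ?thesis unfolding meas by simp
      qed
      then show ?thesis by (simp only: sum_distrib_left)
    qed
    also have "\<dots> = (LINT t|\<mu>. (\<Sum>k\<le>K. g k t))"
      by (rule Bochner_Integration.integral_sum[symmetric]) (rule intg)
    also have "\<dots> \<le> (LINT t|\<mu>. G t)"
    proof (rule integral_mono[OF _ intG])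
      show "integrable \<mu> (\<lambda>t. \<Sum>k\<le>K. g k t)" by (intro Bochner_Integration.integrable_sum intg)
      fix t assume "t \<in> space \<mu>"
      then have t: "0 \<le> t" "t < 1" by (auto simp: space_eq_unit[OF \<mu>])
      have tR: "0 \<le> t * R" "t * R < 1" using t R mult_left_le_one_le[of R t] by auto
      show "(\<Sum>k\<le>K. g k t) \<le> G t"
        unfolding G_def sum_divide_distrib
      proof (rule sum_mono)
        fix k assume k: "k \<in> {..K}"
        have rt: "0 < 1 - radius k * (t * R)"
          using tR radius_nonneg[of k] mult_left_le_one_le[of "t * R" "radius k"] radius_less_1[of k] by simp
        show "g k t \<le> c k * (delta k powr s * (1 / (1 - radius k * (t * R)) powr (2 * s))) / (1 - t * R) powr \<beta>"
        proof (cases "radius k \<le> t")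
          case True
          have "delta K \<le> delta k" using k by (intro delta_antimono) simp
          then have Rk: "1 - R \<le> delta k" by (simp add: R_def radius_eq)
          have tk: "1 - t \<le> delta k" using True by (simp add: radius_eq)
          have "1 - t * R = (1 - t) + t * (1 - R)" by (simp add: algebra_simps)
          also have "\<dots> \<le> delta k + 1 * delta k" using tk Rk t R by (intro add_mono mult_mono) auto
          finally have e1: "1 - t * R \<le> 2 * delta k" by simp
          have "1 - radius k * (t * R) = (1 - radius k) + radius k * (1 - t * R)" by (simp add: algebra_simps)
          also have "\<dots> \<le> delta k + 1 * (2 * delta k)"
            using e1 radius_nonneg[of k] radius_less_1[of k] tR by (intro add_mono mult_mono) (auto simp: radius_eq)
          finally have e2: "1 - radius k * (t * R) \<le> 3 * delta k" by simp
          have "c0 * delta k powr - (\<beta> + s) = delta k powr s * (1 / (3 * delta k) powr (2 * s)) / (2 * delta k) powr \<beta>"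
          proof -
            have "delta k powr - (\<beta> + s) = delta k powr s / delta k powr (2 * s) / delta k powr \<beta>"
              unfolding powr_diff[symmetric] by (rule arg_cong[where f="(powr) (delta k)"]) simp
            then show ?thesis using delta_pos[of k] by (simp add: c0_def powr_mult)
          qed
          also have "\<dots> \<le> delta k powr s * (1 / (1 - radius k * (t * R)) powr (2 * s)) / (1 - t * R) powr \<beta>"
            using e1 e2 rt tR s \<beta> delta_pos[of k]
            by (intro frac_le mult_left_mono powr_mono2 mult_nonneg_nonneg divide_nonneg_nonneg) auto
          finally have "c k * (c0 * delta k powr - (\<beta> + s)) \<le> c k * (delta k powr s * (1 / (1 - radius k * (t * R)) powr (2 * s)) / (1 - t * R) powr \<beta>)"
            by (intro mult_left_mono c)
          then show ?thesis using True t by (simp add: g_def)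
        next
          case False
          then show ?thesis using c[of k] by (simp add: g_def)
        qed
      qed
    qed
    also have "\<dots> \<le> norm (cesaro \<mu> \<beta> \<xi> f z)" unfolding ces by simp
    also have "\<dots> \<le> H_infty_norm (cesaro \<mu> \<beta> \<xi> f)"
      using bd fA z unfolding cesaro_bounded_def by (intro H_infty_norm_upper) auto
    also have "\<dots> \<le> C1 * bergman_norm p \<alpha> f" using C1 fA by blast
    also have "\<dots> \<le> \<bar>C1\<bar> * ((V * C0) powr (1 / p) * P powr (1 / p))"
      using nf bergman_norm_nonneg[of p \<alpha> f] by (intro mult_mono) auto
    finally have "c0 * (\<Sum>k\<le>K. c k * tail_ratio \<mu> (\<beta> + s) k) \<le> \<bar>C1\<bar> * ((V * C0) powr (1 / p) * P powr (1 / p))" .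
    then show ?thesis using c0 unfolding C_def P_def[symmetric] by (simp add: pos_le_divide_eq mult_ac)
  qed
  then show ?thesis using C unfolding s_def by blast
qed

lemma cesaro_necessary_le_1:
  fixes \<xi> :: "complex ^ 'n"
  assumes \<alpha>: "-1 < \<alpha>" and p: "0 < p" and \<beta>: "0 < \<beta>" and \<xi>: "norm \<xi> = 1"
    and \<mu>: "unit_borel \<mu>"
    and bd: "bergman_bounded \<mu> \<beta> \<xi> p \<alpha>"
  shows "(SUP r\<in>{0..<1}. tail \<mu> r / ennreal ((1 - r) powr (\<beta> + (real CARD('n) + 1 + \<alpha>) / p))) < \<infinity>"
proof -
  let ?g = "\<beta> + (real CARD('n) + 1 + \<alpha>) / p"
  have "0 < real CARD('n) + 1 + \<alpha>" using \<alpha> by simp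
  then have g: "0 < ?g" using p \<beta> by (simp add: add_pos_pos)
  interpret finite_measure \<mu>
    by (rule cesaro_bounded_finite_measure[OF bd one_in_bergman_space[OF \<alpha> p]])
  obtain C where C: "0 \<le> C" "\<forall>K c. (\<forall>k. 0 \<le> c k) \<longrightarrow>
    (\<Sum>k\<le>K. c k * tail_ratio \<mu> ?g k) \<le> C * (\<Sum>k\<le>K. c k powr p) powr (1 / p)"
    using cesaro_necessary[OF \<alpha> p \<beta> \<xi> \<mu> bd] by (elim exE conjE) (rule that)
  have a: "tail_ratio \<mu> ?g m \<le> C" for m
  proof -
    define c where "c k = (if k = m then 1 else 0 :: real)" for k
    have "(\<Sum>k\<le>m. c k * tail_ratio \<mu> ?g k) \<le> C * (\<Sum>k\<le>m. c k powr p) powr (1 / p)"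
      using C(2) by (simp add: c_def)
    moreover have "(\<Sum>k\<le>m. c k * tail_ratio \<mu> ?g k) = tail_ratio \<mu> ?g m"
    proof -
      have "(\<Sum>k\<le>m. c k * tail_ratio \<mu> ?g k)
        = (\<Sum>k\<le>m. if k = m then tail_ratio \<mu> ?g k else 0)"
        by (intro sum.cong) (auto simp: c_def)
      then show ?thesis by simp
    qed
    moreover have "(\<Sum>k\<le>m. c k powr p) = 1"
      by (simp add: c_def if_distrib[where f="\<lambda>x. x powr p"] cong: if_cong)
    ultimately show ?thesis by simp
  qed
  have "(SUP r\<in>{0..<1}. tail \<mu> r / ennreal ((1 - r) powr ?g)) \<le> ennreal (C * 2 powr ?g)"
  proof (rule SUP_least)
    fix r :: real assume "r \<in> {0..<1}"
    then have r: "0 < 1 - r" "1 - r \<le> 1" "0 \<le> r" by auto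
    obtain m where m: "delta (Suc m) < 1 - r" "1 - r \<le> delta m" using dyadic_exists[OF r(1,2)] by blast
    have "tail \<mu> r \<le> tail \<mu> (radius m)"
      unfolding tail_def using m by (intro emeasure_mono tail_sets[OF \<mu> radius_nonneg]) (auto simp: radius_eq)
    also have "tail \<mu> (radius m) = ennreal (enn2real (tail \<mu> (radius m)))"
      by (simp add: tail_def emeasure_eq_measure)
    also have "\<dots> \<le> ennreal (C * 2 powr ?g * (1 - r) powr ?g)"
    proof (rule ennreal_leI)
      have "enn2real (tail \<mu> (radius m)) \<le> C * delta m powr ?g"
        using a[of m] delta_pos[of m] by (simp add: divide_le_eq)
      also have "\<dots> \<le> C * (2 * (1 - r)) powr ?g"
        using m C(1) g delta_pos[of m] by (intro mult_left_mono powr_mono2) (auto simp: delta_Suc)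
      also have "(2 * (1 - r)) powr ?g = 2 powr ?g * (1 - r) powr ?g"
        using r by (intro powr_mult)
      finally show "enn2real (tail \<mu> (radius m)) \<le> C * 2 powr ?g * (1 - r) powr ?g"
        by (simp only: mult.assoc)
    qed
    finally have le: "tail \<mu> r \<le> ennreal (C * 2 powr ?g * (1 - r) powr ?g)" .
    have "tail \<mu> r / ennreal ((1 - r) powr ?g) \<le> ennreal (C * 2 powr ?g * (1 - r) powr ?g) / ennreal ((1 - r) powr ?g)"
      by (rule divide_right_mono_ennreal[OF le])
    also have "\<dots> = ennreal (C * 2 powr ?g)"
      using r C(1) by (simp add: divide_ennreal)
    finally show "tail \<mu> r / ennreal ((1 - r) powr ?g) \<le> ennreal (C * 2 powr ?g)" .
  qed
  then show ?thesis by (simp add: le_less_trans)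
qed

lemma cesaro_necessary_gt_1:
  fixes \<xi> :: "complex ^ 'n"
  assumes \<alpha>: "-1 < \<alpha>" and p: "1 < p" "1 / p + 1 / p' = 1" and \<beta>: "0 < \<beta>" and \<xi>: "norm \<xi> = 1"
    and \<mu>: "unit_borel \<mu>"
    and bd: "bergman_bounded \<mu> \<beta> \<xi> p \<alpha>"
  shows "finite_measure \<mu> \<and> (\<lambda>k. tail_ratio \<mu> (\<beta> + (real CARD('n) + 1 + \<alpha>) / p) (Suc k)) \<in> ell_p p'"
proof
  have p0: "0 < p" using p by simp
  show "finite_measure \<mu>"
    by (rule cesaro_bounded_finite_measure[OF bd one_in_bergman_space[OF \<alpha> p0]])
  let ?g = "\<beta> + (real CARD('n) + 1 + \<alpha>) / p"
  define a where "a m = tail_ratio \<mu> ?g m" for m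
  have a0: "0 \<le> a m" for m by (simp add: a_def)
  have "\<exists>C\<ge>0. \<forall>K c. (\<forall>k. 0 \<le> c k) \<longrightarrow> (\<Sum>k\<le>K. c k * a k) \<le> C * (\<Sum>k\<le>K. c k powr p) powr (1 / p)"
    using cesaro_necessary[OF \<alpha> p0 \<beta> \<xi> \<mu> bd] unfolding a_def .
  then obtain C where C: "0 \<le> C" "\<forall>K c. (\<forall>k. 0 \<le> c k) \<longrightarrow> (\<Sum>k\<le>K. c k * a k) \<le> C * (\<Sum>k\<le>K. c k powr p) powr (1 / p)"
    by (elim exE conjE) (rule that)
  have q: "1 < p'" "1 / p' = 1 - 1 / p" "(p' - 1) * p = p'"
  proof -
    have "0 < 1 / p" "1 / p < 1" using p(1) by auto
    then have "0 < 1 / p'" "1 / p' < 1" using p(2) by linarith+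
    then show q1: "1 < p'" by (simp add: divide_less_eq split: if_splits)
    show "1 / p' = 1 - 1 / p" using p(2) by simp
    have "p * p' * (1 / p + 1 / p') = p * p'" using p(2) by simp
    then show "(p' - 1) * p = p'" using p0 q1 by (simp add: algebra_simps)
  qed
  have bound: "(\<Sum>k\<le>K. a k powr p') \<le> C powr p'" for K
  proof -
    define S where "S = (\<Sum>k\<le>K. a k powr p')"
    have S0: "0 \<le> S" unfolding S_def by (intro sum_nonneg) simp
    have 1: "(\<Sum>k\<le>K. a k powr (p' - 1) * a k) = S"
      unfolding S_def
    proof (rule sum.cong)
      fix k
      have "a k powr (p' - 1) * a k = a k powr (p' - 1) * a k powr 1" using a0 by simp
      then show "a k powr (p' - 1) * a k = a k powr p'" unfolding powr_add[symmetric] by simp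
    qed simp
    have 2: "(\<Sum>k\<le>K. (a k powr (p' - 1)) powr p) = S"
      unfolding S_def powr_powr q(3) ..
    have "S \<le> C * S powr (1 / p)"
      using C(2)[rule_format, of "\<lambda>k. a k powr (p' - 1)" K] unfolding 1 2 by simp
    show "S \<le> C powr p'"
    proof (cases "S = 0")
      case False
      then have S: "0 < S" using S0 by simp
      have "S powr (1 / p') = S / S powr (1 / p)"
        unfolding q(2) using S by (simp add: powr_diff)
      also have "\<dots> \<le> C" using \<open>S \<le> C * S powr (1 / p)\<close> S by (simp add: divide_le_eq)
      finally have "(S powr (1 / p')) powr p' \<le> C powr p'" using q(1) by (intro powr_mono2) auto
      then show ?thesis using S q(1) by (simp add: powr_powr)
    qed simp
  qed
  have "summable (\<lambda>k. a k powr p')"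
  proof (rule bounded_imp_summable)
    show "(\<Sum>k\<le>n. a k powr p') \<le> C powr p'" for n by (rule bound)
  qed simp
  then have "summable (\<lambda>k. a (Suc k) powr p')" by (subst summable_Suc_iff)
  then show "(\<lambda>k. tail_ratio \<mu> ?g (Suc k)) \<in> ell_p p'"
    unfolding ell_p_def a_def by simp
qed

lemma cesaro_necessary_H_infty:
  fixes \<xi> :: "complex ^ 'n"
  assumes \<beta>: "0 < \<beta>" and \<xi>: "norm \<xi> = 1"
    and \<mu>: "unit_borel \<mu>"
    and bd: "cesaro_bounded \<mu> \<beta> \<xi> H_infty H_infty_norm H_infty H_infty_norm"
  shows "(\<integral>\<^sup>+ t. ennreal (1 / (1 - t) powr \<beta>) \<partial>\<mu>) < \<infinity>"
proof -
  let ?f = "\<lambda>z :: complex ^ 'n. 1 :: complex"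
  have f: "?f \<in> H_infty" by (simp add: H_infty_def holomorphic_vec_const image_constant_conv)
  define B where "B = H_infty_norm (cesaro \<mu> \<beta> \<xi> ?f)"
  define G where "G m t = 1 / (1 - t * radius m) powr \<beta>" for m t
  have G: "(\<integral>\<^sup>+t. ennreal (G m t) \<partial>\<mu>) \<le> ennreal B" for m
  proof -
    define z where "z = radius m *\<^sub>R \<xi>"
    have z: "z \<in> ball 0 1" using \<xi> radius_nonneg[of m] radius_less_1[of m] by (simp add: z_def)
    have int_eq: "cesaro_integrand \<beta> \<xi> ?f z t = complex_of_real (G m t)" if "t \<in> space \<mu>" for t
    proof -
      have t: "0 \<le> t" "t < 1" using that by (auto simp: space_eq_unit[OF \<mu>])
      have "t * radius m \<le> 1" using t radius_less_1[of m] radius_nonneg[of m] by (intro mult_le_one) auto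
      then have tR: "0 \<le> 1 - t * radius m" by simp
      have eq: "1 - of_real t * hinner z \<xi> = complex_of_real (1 - t * radius m)"
        using \<xi> by (simp add: z_def hinner_scaleR_left hinner_self)
      show ?thesis
        unfolding cesaro_integrand_def G_def eq powr_of_real[OF tR] by simp
    qed
    have "integrable \<mu> (cesaro_integrand \<beta> \<xi> ?f z)"
      using bd f z unfolding cesaro_bounded_def by blast
    then have "integrable \<mu> (\<lambda>t. complex_of_real (G m t))"
      by (rule Bochner_Integration.integrable_cong[THEN iffD1, rotated 2]) (simp_all add: int_eq)
    then have intG: "integrable \<mu> (G m)"
      by (rule integrable_Re[of \<mu> "\<lambda>t. complex_of_real (G m t)", simplified])
    have "cesaro \<mu> \<beta> \<xi> ?f z = (LINT t|\<mu>. complex_of_real (G m t))"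
      unfolding cesaro_def by (rule Bochner_Integration.integral_cong) (simp_all add: int_eq)
    then have ces: "cesaro \<mu> \<beta> \<xi> ?f z = complex_of_real (LINT t|\<mu>. G m t)" by simp
    have "(\<integral>\<^sup>+t. ennreal (G m t) \<partial>\<mu>) = ennreal (LINT t|\<mu>. G m t)"
      by (rule nn_integral_eq_integral[OF intG]) (simp add: G_def)
    also have "\<dots> \<le> ennreal (norm (cesaro \<mu> \<beta> \<xi> ?f z))" unfolding ces by (intro ennreal_leI) simp
    also have "\<dots> \<le> ennreal B"
      using bd f z unfolding cesaro_bounded_def B_def by (intro ennreal_leI H_infty_norm_upper) auto
    finally show ?thesis .
  qed
  have Gm: "(\<lambda>t. ennreal (G m t)) \<in> borel_measurable \<mu>" for m
  proof -
    have "(\<lambda>t. ennreal (G m t)) \<in> borel_measurable (restrict_space borel {0..<1})"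
      unfolding G_def by (rule measurable_restrict_space1) measurable
    then show ?thesis using measurable_cong_sets[OF \<mu> refl] by blast
  qed
  have "(\<integral>\<^sup>+ t. ennreal (1 / (1 - t) powr \<beta>) \<partial>\<mu>) = (\<integral>\<^sup>+ t. liminf (\<lambda>m. ennreal (G m t)) \<partial>\<mu>)"
  proof (rule nn_integral_cong)
    fix t assume "t \<in> space \<mu>"
    then have t: "0 \<le> t" "t < 1" by (auto simp: space_eq_unit[OF \<mu>])
    have "radius \<longlonglongrightarrow> 1 - 0"
      unfolding radius_eq[abs_def] by (intro tendsto_intros delta_tendsto_0)
    then have "(\<lambda>m. G m t) \<longlonglongrightarrow> 1 / (1 - t * (1 - 0)) powr \<beta>"
      unfolding G_def using t by (intro tendsto_intros) auto
    then have "(\<lambda>m. ennreal (G m t)) \<longlonglongrightarrow> ennreal (1 / (1 - t) powr \<beta>)" by simp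
    then show "ennreal (1 / (1 - t) powr \<beta>) = liminf (\<lambda>m. ennreal (G m t))"
      by (intro lim_imp_Liminf[symmetric]) auto
  qed
  also have "\<dots> \<le> liminf (\<lambda>m. \<integral>\<^sup>+ t. ennreal (G m t) \<partial>\<mu>)"
    by (rule nn_integral_liminf[OF Gm])
  also have "\<dots> \<le> liminf (\<lambda>m. ennreal B)"
    by (intro Liminf_mono always_eventually allI G)
  also have "\<dots> = ennreal B" by (simp add: Liminf_const)
  also have "\<dots> < \<infinity>" by simp
  finally show ?thesis .
qed

theorem theorem1p3:
  fixes \<xi> :: "complex ^ 'n" and \<alpha> \<beta> :: real and \<mu> :: "real measure"
  assumes "\<xi> \<in> sphere 0 1" and "\<alpha> > -1" and "\<beta> > 0"
    and "sets \<mu> = sets (restrict_space borel {0..<1})"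
  shows "(\<forall>p::real. 0 < p \<and> p \<le> 1 \<longrightarrow>
            (cesaro_bounded \<mu> \<beta> \<xi> (bergman_space p \<alpha>) (bergman_norm p \<alpha>) H_infty H_infty_norm \<longleftrightarrow>
             (SUP r\<in>{0..<1}. tail \<mu> r /
                ennreal ((1 - r) powr (\<beta> + (real CARD('n) + 1 + \<alpha>) / p))) < \<infinity>)) \<and>
         (\<forall>p p'::real. 1 < p \<and> 1 / p + 1 / p' = 1 \<longrightarrow>
            (cesaro_bounded \<mu> \<beta> \<xi> (bergman_space p \<alpha>) (bergman_norm p \<alpha>) H_infty H_infty_norm \<longleftrightarrow>
             finite_measure \<mu> \<and>
             (\<lambda>k. enn2real (tail \<mu> (radius (Suc k))) /
                delta (Suc k) powr (\<beta> + (real CARD('n) + 1 + \<alpha>) / p)) \<in> ell_p p')) \<and>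
         (cesaro_bounded \<mu> \<beta> \<xi> H_infty H_infty_norm H_infty H_infty_norm \<longleftrightarrow>
             (\<integral>\<^sup>+ t. ennreal (1 / (1 - t) powr \<beta>) \<partial>\<mu>) < \<infinity>)"
proof -
  have \<xi>: "norm \<xi> = 1" using assms(1) by simp
  show ?thesis
  proof (intro conjI allI impI)
    fix p :: real assume p: "0 < p \<and> p \<le> 1"
    show "cesaro_bounded \<mu> \<beta> \<xi> (bergman_space p \<alpha>) (bergman_norm p \<alpha>) H_infty H_infty_norm \<longleftrightarrow>
      (SUP r\<in>{0..<1}. tail \<mu> r / ennreal ((1 - r) powr (\<beta> + (real CARD('n) + 1 + \<alpha>) / p))) < \<infinity>"
      using p cesaro_necessary_le_1[OF assms(2) _ assms(3) \<xi> assms(4)]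
        cesaro_bounded_suff_le_1[OF assms(2) _ _ assms(3) \<xi> assms(4)] by blast
  next
    fix p p' :: real assume p: "1 < p \<and> 1 / p + 1 / p' = 1"
    show "cesaro_bounded \<mu> \<beta> \<xi> (bergman_space p \<alpha>) (bergman_norm p \<alpha>) H_infty H_infty_norm \<longleftrightarrow>
      finite_measure \<mu> \<and> (\<lambda>k. enn2real (tail \<mu> (radius (Suc k))) /
        delta (Suc k) powr (\<beta> + (real CARD('n) + 1 + \<alpha>) / p)) \<in> ell_p p'"
      using p cesaro_necessary_gt_1[OF assms(2) _ _ assms(3) \<xi> assms(4)]
        cesaro_bounded_suff_gt_1[OF assms(2) _ _ assms(3) \<xi> assms(4)] by blast
  next
    show "cesaro_bounded \<mu> \<beta> \<xi> H_infty H_infty_norm H_infty H_infty_norm \<longleftrightarrow>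
      (\<integral>\<^sup>+ t. ennreal (1 / (1 - t) powr \<beta>) \<partial>\<mu>) < \<infinity>"
      using cesaro_necessary_H_infty[OF assms(3) \<xi> assms(4)] cesaro_bounded_H_infty_suff[OF assms(3) \<xi> assms(4)] by blast
  qed
qed

end
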